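(* Let $\gamma\subset\partial\Omega$ consist of two points if $d=2$, and be a simple closed curve in $\partial\Omega$ if $d=3$, so that $\gamma$ splits $\partial\Omega$ into two connected components $A$ and $B$: $\partial\Omega=A\cup B\cup\gamma$ and $A\cap B=A\cap\gamma=B\cap\gamma=\emptyset$. Let $I$ be a constant and let $$f_0(x,\xi)=\begin{cases} I, & (x,\xi)\in((A\cup\gamma)\times S^{d-1})\cap\Gamma_-,\\ 0, & (x,\xi)\in(B\times S^{d-1})\cap\Gamma_-.\end{cases}$$ Let $f$ be the solution (in the sense defined in the context) to $$\xi\cdot\nabla_x f(x,\xi)+\mu_t(x)f(x,\xi)=\mu_s(x)\int_{S^{d-1}}p(x,\xi,\xi')f(x,\xi')\,d\sigma_{\xi'}\ \text{ on }\Omega_0\times S^{d-1},\qquad f=f_0\ \text{ on }\Gamma_-,$$ let $\overline{f}$ be its extension to $\overline{D}$ given by $\overline{f}=f$ on $D$ and $\overline{f}(x,\xi)=\lim_{t\downarrow0}f(x-t\xi,\xi)$ for $(x,\xi)\in\Gamma_+$, and let $(x^*,\xi^* )\in\operatorname{disc}(\overline{f})$. Then $$[\overline{f}](x^*,\xi^* )=I\exp\left(-\int_0^{\tau_-(x^*,\xi^* )}\mu_t(x^*-r\xi^* )\,dr\right),$$ where, for $(\overline{x},\overline{\xi})\in\operatorname{disc}(\overline{f})$, the jump is $$[\overline{f}](\overline{x},\overline{\xi}):=\lim_{\substack{x\to\overline{x}\\ P(x,\overline{\xi})\in A\cup\gamma}}f(x,\overline{\xi})-\lim_{\substack{x\to\overline{x}\\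 P(x,\overline{\xi})\in B}}f(x,\overline{\xi}),\qquad P(x,\xi):=x-\tau_-(x,\xi)\xi$$ (limits over $x$ with $(x,\overline{\xi})\in D$).
   Context: Let $d\in\{2,3\}$; $S^{d-1}$ is the unit sphere of $\mathbb{R}^d$ and $d\sigma$ is the Lebesgue (surface) measure on it. $\Omega\subset\mathbb{R}^d$ is a bounded convex domain with $C^1$ boundary and outer unit normal $n(x)$ at $x\in\partial\Omega$. $\overline{\Omega}=\bigcup_{j=1}^N\overline{\Omega_j}$, where $\Omega_1,\dots,\Omega_N$ are disjoint open subdomains of $\Omega$ with piecewise $C^1$ boundaries, and $\Omega_0:=\bigcup_{j=1}^N\Omega_j$. Generalized convexity condition (assumed): for every $(x,\xi)\in\Omega\times S^{d-1}$ there are a positive integer $l(x,\xi)$ and reals $0\le t_1(x,\xi)<\dots<t_{l(x,\xi)}(x,\xi)$ such that, for $t\ge0$, $x-t\xi\in\partial\Omega_0$ if and only if $t=t_j(x,\xi)$ for some $j$; moreover $\sup_{(x,\xi)\in\Omega\times S^{d-1}}l(x,\xi)<\infty$. Put $t_0(x,\xi)=0$. Coefficients: $\mu_t,\mu_s$ are nonnegative bounded functions on $\mathbb{R}^d$, continuous on $\Omega_0$, with $\mu_t\ge\mu_s$ on $\Omega_0$ and $\mu_t=\mu_s=0$ on $\mathbb{R}^d\setminus\Omega_0$. $p$ is a nonnegative bounded function on $\mathbb{R}^d\times S^{d-1}\times S^{d-1}$, continuous on $\Omega_0\times S^{d-1}\times S^{d-1}$, zero on $(\mathbb{R}^d\setminus\Omega_0)\times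 S^{d-1}\times S^{d-1}$, with $\int_{S^{d-1}}p(x,\xi,\xi')\,d\sigma_{\xi'}=1$ for all $(x,\xi)\in\Omega_0\times S^{d-1}$. Notation: $\Gamma_\pm:=\{(x,\xi)\in\partial\Omega\times S^{d-1}\mid \pm n(x)\cdot\xi>0\}$; $D:=(\Omega\times S^{d-1})\cup\Gamma_-$; $\overline{D}:=D\cup\Gamma_+$; $\tau_\pm(x,\xi):=\inf\{t>0\mid x\pm t\xi\notin\Omega\}$ for $(x,\xi)\in\overline{D}$; $\Gamma_{-,\xi}:=\{x\in\partial\Omega\mid n(x)\cdot\xi<0\}$ for $\xi\in S^{d-1}$. For a function $g$, $\operatorname{disc}(g)$ is the set of points of its domain at which $g$ is discontinuous. The directional derivative is $\xi\cdot\nabla_xf(x,\xi):=\frac{d}{dt}f(x+t\xi,\xi)\big|_{t=0}$. A solution to the boundary value problem is a bounded function $f$ on $D$ (for which the integral in the equation is defined) such that: (i) $\xi\cdot\nabla_xf(x,\xi)$ exists at all $(x,\xi)\in\Omega_0\times S^{d-1}$; (ii) $f$ satisfies the equation for all $(x,\xi)\in\Omega_0\times S^{d-1}$ and the boundary condition for all $(x,\xi)\in\Gamma_-$; (iii) $f(\cdot,\xi)$ is continuous along the line $\{x+t\xi\mid t\in\mathbb{R}\}\cap(\Omega\cup\Gamma_{-,\xi})$ for all $(x,\xi)\in D$; (iv) for all $(x,\xi)\in\Omega_0\times S^{d-1}$, $\xi\cdot\nabla_xf(\cdot,\xi)$ is continuous on the open segments $\{x-t\xi\mid t\in(t_{j-1}(x,\xi),t_j(x,\xi))\}$,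 $j=1,\dots,l(x,\xi)$. For the given $f_0$ the solution exists and is unique, and the limits defining $\overline{f}$ on $\Gamma_+$ exist. *)

theory Defs
  imports "HOL-Analysis.Analysis"
begin

section \<open>Surface measure on the unit sphere\<close>

text \<open>
  The polar-coordinate definition: the area of a Borel set \<open>E\<close> of unit vectors is \<open>d\<close> times the
  volume of the cone \<open>{r\<xi> | 0 < r < 1, \<xi> \<in> E}\<close>, where \<open>d\<close> is the dimension. The completion makes
  every Lebesgue measurable function on the sphere measurable.
\<close>

definition sphere_measure :: "'a::euclidean_space measure" where
  "sphere_measure =
     completion
       (scale_measure (of_nat DIM('a))
         (distr (restrict_space lborel (ball 0 1 - {0}))
                (restrict_space borel (sphere 0 1)) sgn))"

section \<open>Domains with (piecewise) continuously differentiable boundary\<close>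

definition local_defining_function ::
  "'a::euclidean_space set \<Rightarrow> 'a \<Rightarrow> 'a set \<Rightarrow> ('a \<Rightarrow> real) \<Rightarrow> ('a \<Rightarrow> 'a) \<Rightarrow> bool" where
  "local_defining_function \<Omega> x U \<phi> g \<longleftrightarrow>
     open U \<and> x \<in> U \<and>
     (\<forall>y\<in>U. GDERIV \<phi> y :> g y \<and> g y \<noteq> 0) \<and> continuous_on U g \<and>
     \<Omega> \<inter> U = {y\<in>U. \<phi> y < 0} \<and> frontier \<Omega> \<inter> U = {y\<in>U. \<phi> y = 0}"

definition C1_boundary :: "'a::euclidean_space set \<Rightarrow> bool" where
  "C1_boundary \<Omega> \<longleftrightarrow> (\<forall>x\<in>frontier \<Omega>. \<exists>U \<phi> g. local_defining_function \<Omega> x U \<phi> g)"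

text \<open>At a boundary point the normalised gradient is the same for all local defining functions.\<close>

definition outer_unit_normal :: "'a::euclidean_space set \<Rightarrow> 'a \<Rightarrow> 'a" where
  "outer_unit_normal \<Omega> x =
     (THE \<nu>. \<exists>U \<phi> g. local_defining_function \<Omega> x U \<phi> g \<and> \<nu> = sgn (g x))"

text \<open>
  A patch is a homeomorphic image of a closed disc of dimension \<open>d - 1\<close> (lying in a hyperplane
  through the origin), regularly and continuously differentiably parametrised over the open disc.
  No differentiability is required on the rim, so that corners, cusps and conical points are allowed.
\<close>

definition C1_patch :: "'a::euclidean_space set \<Rightarrow> bool" where
  "C1_patch S \<longleftrightarrow>
     (\<exists>e (\<Phi> :: 'a \<Rightarrow> 'a) \<Phi>'. norm e = 1 \<and>
        (let H = {x. x \<bullet> e = 0} in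
          continuous_on (H \<inter> cball 0 1) \<Phi> \<and> inj_on \<Phi> (H \<inter> cball 0 1) \<and>
          \<Phi> ` (H \<inter> cball 0 1) = S \<and>
          (\<forall>x\<in>H \<inter> ball 0 1. (\<Phi> has_derivative \<Phi>' x) (at x within H) \<and>
                            (\<forall>h\<in>H. \<Phi>' x h = 0 \<longrightarrow> h = 0)) \<and>
          (\<forall>h\<in>H. continuous_on (H \<inter> ball 0 1) (\<lambda>x. \<Phi>' x h))))"

definition piecewise_C1_boundary :: "'a::euclidean_space set \<Rightarrow> bool" where
  "piecewise_C1_boundary W \<longleftrightarrow>
     (\<exists>F. finite F \<and> (\<forall>S\<in>F. C1_patch S) \<and> frontier W = \<Union>F)"

definition subdomain_decomposition ::
  "'a::euclidean_space set \<Rightarrow> nat \<Rightarrow> (nat \<Rightarrow> 'a set) \<Rightarrow> bool" where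
  "subdomain_decomposition \<Omega> N W \<longleftrightarrow>
     1 \<le> N \<and>
     (\<forall>j\<in>{1..N}. open (W j) \<and> connected (W j) \<and> W j \<noteq> {} \<and> W j \<subseteq> \<Omega> \<and>
                  piecewise_C1_boundary (W j)) \<and>
     disjoint_family_on W {1..N} \<and>
     closure \<Omega> = (\<Union>j\<in>{1..N}. closure (W j))"

text \<open>
  The numbers \<open>l x \<xi>\<close> and \<open>t x \<xi> j\<close>, \<open>0 \<le> j \<le> l x \<xi>\<close>, are determined uniquely by this condition for
  \<open>x \<in> \<Omega>\<close> and unit vectors \<open>\<xi>\<close>.
\<close>

definition generalized_convexity ::
  "'a::euclidean_space set \<Rightarrow> 'a set \<Rightarrow> ('a \<Rightarrow> 'a \<Rightarrow> nat) \<Rightarrow> ('a \<Rightarrow> 'a \<Rightarrow> nat \<Rightarrow> real) \<Rightarrow> bool" where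
  "generalized_convexity \<Omega> \<Omega>\<^sub>0 l t \<longleftrightarrow>
     (\<forall>x\<in>\<Omega>. \<forall>\<xi>\<in>sphere 0 1.
        1 \<le> l x \<xi> \<and> t x \<xi> 0 = 0 \<and> 0 \<le> t x \<xi> 1 \<and> strict_mono_on {1..l x \<xi>} (t x \<xi>) \<and>
        (\<forall>s\<ge>0. x - s *\<^sub>R \<xi> \<in> frontier \<Omega>\<^sub>0 \<longleftrightarrow> (\<exists>j\<in>{1..l x \<xi>}. s = t x \<xi> j))) \<and>
     (\<exists>L. \<forall>x\<in>\<Omega>. \<forall>\<xi>\<in>sphere 0 1. l x \<xi> \<le> L)"

section \<open>Coefficients\<close>

definition admissible_coefficients ::
  "'a::euclidean_space set \<Rightarrow> ('a \<Rightarrow> real) \<Rightarrow> ('a \<Rightarrow> real) \<Rightarrow> ('a \<Rightarrow> 'a \<Rightarrow> 'a \<Rightarrow> real) \<Rightarrow> bool" where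
  "admissible_coefficients \<Omega>\<^sub>0 \<mu>\<^sub>t \<mu>\<^sub>s p \<longleftrightarrow>
     (\<forall>x. 0 \<le> \<mu>\<^sub>t x) \<and> bounded (range \<mu>\<^sub>t) \<and> continuous_on \<Omega>\<^sub>0 \<mu>\<^sub>t \<and>
     (\<forall>x. 0 \<le> \<mu>\<^sub>s x) \<and> bounded (range \<mu>\<^sub>s) \<and> continuous_on \<Omega>\<^sub>0 \<mu>\<^sub>s \<and>
     (\<forall>x\<in>\<Omega>\<^sub>0. \<mu>\<^sub>s x \<le> \<mu>\<^sub>t x) \<and> (\<forall>x\<in>- \<Omega>\<^sub>0. \<mu>\<^sub>t x = 0 \<and> \<mu>\<^sub>s x = 0) \<and>
     (\<forall>x. \<forall>\<xi>\<in>sphere 0 1. \<forall>\<xi>'\<in>sphere 0 1. 0 \<le> p x \<xi> \<xi>') \<and>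
     (\<exists>M. \<forall>x. \<forall>\<xi>\<in>sphere 0 1. \<forall>\<xi>'\<in>sphere 0 1. p x \<xi> \<xi>' \<le> M) \<and>
     continuous_on (\<Omega>\<^sub>0 \<times> sphere 0 1 \<times> sphere 0 1) (\<lambda>(x, \<xi>, \<xi>'). p x \<xi> \<xi>') \<and>
     (\<forall>x\<in>- \<Omega>\<^sub>0. \<forall>\<xi>\<in>sphere 0 1. \<forall>\<xi>'\<in>sphere 0 1. p x \<xi> \<xi>' = 0) \<and>
     (\<forall>x\<in>\<Omega>\<^sub>0. \<forall>\<xi>\<in>sphere 0 1. (\<integral>\<xi>'. p x \<xi> \<xi>' \<partial>sphere_measure) = 1)"

section \<open>Phase space\<close>

definition inflow_boundary :: "'a::euclidean_space set \<Rightarrow> ('a \<times> 'a) set" where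
  "inflow_boundary \<Omega> =
     {(x, \<xi>). x \<in> frontier \<Omega> \<and> \<xi> \<in> sphere 0 1 \<and> outer_unit_normal \<Omega> x \<bullet> \<xi> < 0}"

definition outflow_boundary :: "'a::euclidean_space set \<Rightarrow> ('a \<times> 'a) set" where
  "outflow_boundary \<Omega> =
     {(x, \<xi>). x \<in> frontier \<Omega> \<and> \<xi> \<in> sphere 0 1 \<and> outer_unit_normal \<Omega> x \<bullet> \<xi> > 0}"

definition phase_domain :: "'a::euclidean_space set \<Rightarrow> ('a \<times> 'a) set" where
  "phase_domain \<Omega> = (\<Omega> \<times> sphere 0 1) \<union> inflow_boundary \<Omega>"

text \<open>
  This set, the domain of extended solutions, is not the topological closure of
  \<^term>\<open>phase_domain \<Omega>\<close>: the tangential directions at the boundary are missing.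
\<close>

definition extended_phase_domain :: "'a::euclidean_space set \<Rightarrow> ('a \<times> 'a) set" where
  "extended_phase_domain \<Omega> = phase_domain \<Omega> \<union> outflow_boundary \<Omega>"

definition backward_exit_time :: "'a::euclidean_space set \<Rightarrow> 'a \<Rightarrow> 'a \<Rightarrow> real" where
  "backward_exit_time \<Omega> x \<xi> = Inf {t. 0 < t \<and> x - t *\<^sub>R \<xi> \<notin> \<Omega>}"

definition entry_point :: "'a::euclidean_space set \<Rightarrow> 'a \<Rightarrow> 'a \<Rightarrow> 'a" where
  "entry_point \<Omega> x \<xi> = x - backward_exit_time \<Omega> x \<xi> *\<^sub>R \<xi>"

section \<open>Solutions of the boundary value problem\<close>

definition directional_derivative ::
  "('a::euclidean_space \<times> 'a \<Rightarrow> real) \<Rightarrow> 'a \<Rightarrow> 'a \<Rightarrow> real" where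
  "directional_derivative f x \<xi> = deriv (\<lambda>s. f (x + s *\<^sub>R \<xi>, \<xi>)) 0"

definition transport_solution ::
  "'a::euclidean_space set \<Rightarrow> 'a set \<Rightarrow> ('a \<Rightarrow> 'a \<Rightarrow> nat) \<Rightarrow> ('a \<Rightarrow> 'a \<Rightarrow> nat \<Rightarrow> real) \<Rightarrow>
   ('a \<Rightarrow> real) \<Rightarrow> ('a \<Rightarrow> real) \<Rightarrow> ('a \<Rightarrow> 'a \<Rightarrow> 'a \<Rightarrow> real) \<Rightarrow>
   ('a \<times> 'a \<Rightarrow> real) \<Rightarrow> ('a \<times> 'a \<Rightarrow> real) \<Rightarrow> bool" where
  "transport_solution \<Omega> \<Omega>\<^sub>0 l t \<mu>\<^sub>t \<mu>\<^sub>s p f\<^sub>0 f \<longleftrightarrow>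
     bounded (f ` phase_domain \<Omega>) \<and>
     (\<forall>x\<in>\<Omega>\<^sub>0. \<forall>\<xi>\<in>sphere 0 1. integrable sphere_measure (\<lambda>\<xi>'. p x \<xi> \<xi>' * f (x, \<xi>'))) \<and>
     (\<forall>x\<in>\<Omega>\<^sub>0. \<forall>\<xi>\<in>sphere 0 1. (\<lambda>s. f (x + s *\<^sub>R \<xi>, \<xi>)) field_differentiable at 0) \<and>
     (\<forall>x\<in>\<Omega>\<^sub>0. \<forall>\<xi>\<in>sphere 0 1.
        directional_derivative f x \<xi> + \<mu>\<^sub>t x * f (x, \<xi>) =
        \<mu>\<^sub>s x * (\<integral>\<xi>'. p x \<xi> \<xi>' * f (x, \<xi>') \<partial>sphere_measure)) \<and>
     (\<forall>z\<in>inflow_boundary \<Omega>. f z = f\<^sub>0 z) \<and>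
     (\<forall>(x, \<xi>)\<in>phase_domain \<Omega>.
        continuous_on ({x + s *\<^sub>R \<xi> |s. True} \<inter> (\<Omega> \<union> {y. (y, \<xi>) \<in> inflow_boundary \<Omega>}))
          (\<lambda>y. f (y, \<xi>))) \<and>
     (\<forall>x\<in>\<Omega>\<^sub>0. \<forall>\<xi>\<in>sphere 0 1. \<forall>j\<in>{1..l x \<xi>}.
        continuous_on {x - s *\<^sub>R \<xi> |s. t x \<xi> (j - 1) < s \<and> s < t x \<xi> j}
          (\<lambda>y. directional_derivative f y \<xi>))"

definition extended_solution ::
  "'a::euclidean_space set \<Rightarrow> ('a \<times> 'a \<Rightarrow> real) \<Rightarrow> ('a \<times> 'a \<Rightarrow> real)" where
  "extended_solution \<Omega> f =
     (\<lambda>(x, \<xi>). if (x, \<xi>) \<in> phase_domain \<Omega> then f (x, \<xi>)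
               else Lim (at_right 0) (\<lambda>s. f (x - s *\<^sub>R \<xi>, \<xi>)))"

section \<open>Discontinuities and jumps\<close>

definition disc :: "'b::t2_space set \<Rightarrow> ('b \<Rightarrow> 'c::topological_space) \<Rightarrow> 'b set" where
  "disc X g = {z\<in>X. \<not> continuous (at z within X) g}"

text \<open>
  The jump of \<open>f\<close> at \<open>(x, \<xi>)\<close> across the curve separating the boundary parts \<open>A'\<close> and \<open>B\<close> is defined
  and equals \<open>J\<close>. That \<open>x\<close> be a limit point of both sets ensures that the two limits are unique.
\<close>

definition has_jump ::
  "'a::euclidean_space set \<Rightarrow> 'a set \<Rightarrow> 'a set \<Rightarrow> ('a \<times> 'a \<Rightarrow> real) \<Rightarrow> 'a \<Rightarrow> 'a \<Rightarrow> real \<Rightarrow> bool" where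
  "has_jump \<Omega> A' B f x \<xi> J \<longleftrightarrow>
     (let S = (\<lambda>C. {y. (y, \<xi>) \<in> phase_domain \<Omega> \<and> entry_point \<Omega> y \<xi> \<in> C}) in
      x islimpt S A' \<and> x islimpt S B \<and>
      (\<exists>a b. ((\<lambda>y. f (y, \<xi>)) \<longlongrightarrow> a) (at x within S A') \<and>
             ((\<lambda>y. f (y, \<xi>)) \<longlongrightarrow> b) (at x within S B) \<and> J = a - b))"

section \<open>Separating points and curves\<close>

definition separating_set :: "'a::euclidean_space set \<Rightarrow> 'a set \<Rightarrow> bool" where
  "separating_set \<Omega> \<gamma> \<longleftrightarrow>
     \<gamma> \<subseteq> frontier \<Omega> \<and>
     (DIM('a) = 2 \<and> card \<gamma> = 2 \<or>
      DIM('a) = 3 \<and> (\<exists>c. simple_path c \<and> pathfinish c = pathstart c \<and> path_image c = \<gamma>))"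

end

theory Submission
  imports Defs
begin

text \<open>
  Along a characteristic the equation integrates to \<open>f = f\<^sub>0(P) \<sigma> + T f\<close>, where \<open>\<sigma>\<close> is the attenuation
  factor and \<open>T f\<close> is the line integral of the scattered intensity. Since \<open>\<mu>\<^sub>s \<le> \<mu>\<^sub>t\<close>, the operator
  \<open>T\<close> contracts by a factor \<open>q < 1\<close>: if the oscillation of \<open>T f\<close> in \<open>x\<close> is at most \<open>K\<close> everywhere, then
  it is at most \<open>q K\<close>, hence zero. In this step the boundary term \<open>f\<^sub>0(P)\<close> is averaged over directions,
  and its discontinuities do not contribute because the set of directions in which \<open>A \<union> \<gamma>\<close> is seen
  from \<open>x\<close> depends continuously on \<open>x\<close> in measure. As the curve \<open>\<gamma>\<close> is merely continuous, it may have
  positive area; the continuity therefore rests on the comparability of the solid angles seen from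
  nearby points, which comes from a Lipschitz map between cones built from the gauge of \<open>\<Omega>\<close>. So \<open>T f\<close>
  is continuous, and \<open>f\<close> can only jump where \<open>P\<close> lies on the relative boundary of \<open>A \<union> \<gamma>\<close>.
\<close>

section \<open>Normals of convex domains and exit times\<close>

text \<open>The contraction has to run on a quantity that makes sense before any regularity of
  \<open>T f\<close> is known: the asymptotic size of its change along sequences of interior points,
  with the direction held fixed. Fixed directions suffice as input, because the scattering integral
  evaluates \<open>f\<close> at a fixed \<open>\<xi>'\<close>. As output the estimate also admits
  moving directions and boundary points, since these enter only through the line of integration, the
  optical depth and the phase function \<open>p\<close>. Joint continuity is therefore the same
  estimate read once more with bound zero, and no uniformity in the direction is asked for. The
  factor is \<open>q = 1 - exp (- m * R)\<close>, with \<open>m\<close> a bound of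
  \<open>\<mu>\<^sub>t\<close> and \<open>R\<close> a bound of the path lengths in
  \<open>\<Omega>\<close>; it stays below 1 even where \<open>\<mu>\<^sub>s = \<mu>\<^sub>t\<close>,
  because some radiation always crosses without interaction. The jump is the difference of two
  continuous functions, the integrated right-hand side with the entry value frozen at
  \<open>I\<close> and at 0: the scattered part cancels and the attenuation remains.\<close>

locale convex_domain =
  fixes \<Omega> :: "'a::euclidean_space set"
  assumes open_dom: "open \<Omega>" and bounded_dom: "bounded \<Omega>" and convex_dom: "convex \<Omega>"
begin

lemma closure_segment:
  assumes "a \<in> \<Omega>" "b \<in> closure \<Omega>" "0 < u" "u \<le> 1"
  shows "u *\<^sub>R a + (1 - u) *\<^sub>R b \<in> \<Omega>"
proof -
  have "b - u *\<^sub>R (b - a) \<in> interior \<Omega>"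
    by (rule mem_interior_closure_convex_shrink)
       (use assms convex_dom open_dom in \<open>auto simp: interior_open\<close>)
  then show ?thesis
    using open_dom by (simp add: interior_open algebra_simps)
qed

text \<open>The two alternatives for \<open>s\<close> allow the closure point at either end, so that
  half-open segments can be used in both senses along a line.\<close>

lemma line_between:
  assumes a: "x + a *\<^sub>R \<xi> \<in> \<Omega>" and b: "x + b *\<^sub>R \<xi> \<in> closure \<Omega>"
    and s: "a \<le> s \<and> s < b \<or> b < s \<and> s \<le> a"
  shows "x + s *\<^sub>R \<xi> \<in> \<Omega>"
proof -
  have ab: "a - b \<noteq> 0" using s by auto
  define u where "u = (s - b) / (a - b)"
  have u: "0 < u" "u \<le> 1" using s by (auto simp: u_def divide_simps)
  have "u * (a - b) = s - b" using ab by (simp add: u_def)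
  then have us: "u * a + (1 - u) * b = s" by (simp add: algebra_simps)
  have "u *\<^sub>R (x + a *\<^sub>R \<xi>) + (1 - u) *\<^sub>R (x + b *\<^sub>R \<xi>) = x + (u * a + (1 - u) * b) *\<^sub>R \<xi>"
    by (simp add: algebra_simps)
  then show ?thesis
    using closure_segment[OF a b u] by (simp add: us)
qed

lemma line_between_minus:
  assumes "x - a *\<^sub>R \<xi> \<in> \<Omega>" "x - b *\<^sub>R \<xi> \<in> closure \<Omega>" "a \<le> s \<and> s < b \<or> b < s \<and> s \<le> a"
  shows "x - s *\<^sub>R \<xi> \<in> \<Omega>"
  using line_between[of x "-a" \<xi> "-b" "-s"] assms by auto

lemma frontier_not_in: "x \<in> frontier \<Omega> \<Longrightarrow> x \<notin> \<Omega>"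
  using open_dom by (simp add: frontier_def interior_open)

lemma frontier_in_closure: "x \<in> frontier \<Omega> \<Longrightarrow> x \<in> closure \<Omega>"
  by (simp add: frontier_def)

text \<open>The difference quotients of \<open>\<phi>\<close> along \<open>v\<close> tend to
  \<open>g x \<bullet> v\<close>. A strict sign passes from the limit to the quotients, but in the
  other direction only a weak one survives; closing this gap is left to openness and
  convexity.\<close>

lemma defining_function_directions:
  assumes "local_defining_function \<Omega> x U \<phi> g" and x: "x \<in> frontier \<Omega>"
  shows "g x \<noteq> 0"
    and "g x \<bullet> v < 0 \<Longrightarrow> \<forall>\<^sub>F s in at_right 0. x + s *\<^sub>R v \<in> \<Omega>"
    and "\<forall>\<^sub>F s in at_right 0. x + s *\<^sub>R v \<in> \<Omega> \<Longrightarrow> g x \<bullet> v \<le> 0"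
proof -
  have U: "open U" "x \<in> U" and d: "GDERIV \<phi> x :> g x" "g x \<noteq> 0"
    and eq: "\<Omega> \<inter> U = {y\<in>U. \<phi> y < 0}" "frontier \<Omega> \<inter> U = {y\<in>U. \<phi> y = 0}"
    using assms unfolding local_defining_function_def by auto
  show "g x \<noteq> 0" by fact
  have \<phi>x: "\<phi> x = 0" using eq(2) x U by auto
  have "((\<lambda>s. \<phi> (x + s *\<^sub>R v)) has_real_derivative g x \<bullet> v) (at 0)"
  proof -
    have "(\<phi> has_derivative (\<lambda>h. h \<bullet> g x)) (at (x + 0 *\<^sub>R v))"
      using d(1) by (simp add: gderiv_def)
    then have "((\<lambda>s. \<phi> (x + s *\<^sub>R v)) has_derivative (\<lambda>h. (h *\<^sub>R v) \<bullet> g x)) (at 0)"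
      by (rule has_derivative_compose[rotated]) (auto intro!: derivative_eq_intros)
    then show ?thesis
      by (simp add: has_field_derivative_def inner_commute[of _ v] mult.commute[of _ "v \<bullet> g x"])
  qed
  then have lim: "((\<lambda>s. \<phi> (x + s *\<^sub>R v) / s) \<longlongrightarrow> g x \<bullet> v) (at_right 0)"
    by (auto simp: DERIV_def \<phi>x intro: tendsto_mono[OF at_le])
  have inU: "\<forall>\<^sub>F s in at_right 0. x + s *\<^sub>R v \<in> U"
  proof -
    have "((\<lambda>s. x + s *\<^sub>R v) \<longlongrightarrow> x + 0 *\<^sub>R v) (at_right 0)"
      by (intro tendsto_intros)
    then show ?thesis
      using U by (intro topological_tendstoD) auto
  qed
  have pos: "\<forall>\<^sub>F s in at_right 0. (0::real) < s"
    by (rule eventually_at_right_less)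
  show "\<forall>\<^sub>F s in at_right 0. x + s *\<^sub>R v \<in> \<Omega>" if "g x \<bullet> v < 0"
    using order_tendstoD(2)[OF lim that] inU pos
  proof eventually_elim
    case (elim s)
    then have "\<phi> (x + s *\<^sub>R v) < 0" by (simp add: divide_less_0_iff)
    then show ?case using eq(1) elim by blast
  qed
  show "g x \<bullet> v \<le> 0" if "\<forall>\<^sub>F s in at_right 0. x + s *\<^sub>R v \<in> \<Omega>"
  proof (rule tendsto_upperbound[OF lim])
    show "\<forall>\<^sub>F s in at_right 0. \<phi> (x + s *\<^sub>R v) / s \<le> 0"
      using that inU pos
    proof eventually_elim
      case (elim s)
      then have "\<phi> (x + s *\<^sub>R v) < 0" using eq(1) by auto
      then show ?case using elim by (simp add: divide_le_0_iff)
    qed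
  qed auto
qed

text \<open>Uniqueness of the normalised gradient, which resolves the definite description: for
  distinct unit vectors \<open>a\<close> and \<open>b\<close>, the direction \<open>b - a\<close>
  has negative product with \<open>a\<close> and positive product with \<open>b\<close>, so it would
  enter \<open>\<Omega>\<close> according to one defining function and not according to the
  other.\<close>

lemma outer_unit_normal_eq:
  assumes L: "local_defining_function \<Omega> x U \<phi> g" and x: "x \<in> frontier \<Omega>"
  shows "outer_unit_normal \<Omega> x = sgn (g x)"
  unfolding outer_unit_normal_def
proof (rule the_equality)
  show "\<exists>U \<phi> g'. local_defining_function \<Omega> x U \<phi> g' \<and> sgn (g x) = sgn (g' x)"
    using L by blast
  fix \<nu> assume "\<exists>U \<phi> g'. local_defining_function \<Omega> x U \<phi> g' \<and> \<nu> = sgn (g' x)"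
  then obtain U' \<phi>' g' where L': "local_defining_function \<Omega> x U' \<phi>' g'" and \<nu>: "\<nu> = sgn (g' x)"
    by blast
  let ?a = "sgn (g x)" and ?b = "sgn (g' x)"
  have nz: "g x \<noteq> 0" "g' x \<noteq> 0"
    using defining_function_directions(1) L L' x by blast+
  then have unit: "norm ?a = 1" "norm ?b = 1" by (auto simp: norm_sgn)
  show "\<nu> = ?a"
  proof (rule ccontr)
    assume "\<nu> \<noteq> ?a"
    then have "?a \<noteq> ?b" using \<nu> by simp
    then have "0 < (norm (?a - ?b))\<^sup>2" by simp
    also have "(norm (?a - ?b))\<^sup>2 = 2 - 2 * (?a \<bullet> ?b)"
      by (simp only: power2_norm_eq_inner inner_diff inner_commute[of ?b ?a])
         (simp add: unit flip: power2_norm_eq_inner)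
    finally have ab: "?a \<bullet> ?b < 1" by simp
    have aa: "?a \<bullet> ?a = 1" "?b \<bullet> ?b = 1"
      by (simp_all add: unit flip: power2_norm_eq_inner)
    have "?a \<bullet> (?b - ?a) < 0"
      using ab aa by (simp add: inner_diff_right)
    moreover have "?a \<bullet> (?b - ?a) = g x \<bullet> (?b - ?a) / norm (g x)"
      by (simp add: sgn_div_norm divide_inverse mult.commute)
    ultimately have "g x \<bullet> (?b - ?a) < 0"
      by (simp add: divide_less_0_iff)
    then have "g' x \<bullet> (?b - ?a) \<le> 0"
      using defining_function_directions(2)[OF L x] defining_function_directions(3)[OF L' x] by blast
    moreover have "?b \<bullet> (?b - ?a) = g' x \<bullet> (?b - ?a) / norm (g' x)"
      by (simp add: sgn_div_norm divide_inverse mult.commute)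
    ultimately have "?b \<bullet> (?b - ?a) \<le> 0"
      by (simp add: divide_le_0_iff)
    moreover have "?b \<bullet> (?b - ?a) > 0"
      using ab aa by (simp add: inner_diff_right inner_commute)
    ultimately show False by simp
  qed
qed

text \<open>Convexity lets a single point of \<open>\<Omega>\<close> on the half-line decide, and
  this removes normals from the rest of the proof. For the strict sign, the direction is tilted
  slightly towards \<open>g x\<close>: the tilted half-line still meets \<open>\<Omega>\<close>, and
  the weak inequality for it is a strict one for \<open>v\<close>.\<close>

lemma outer_unit_normal_directions:
  assumes "C1_boundary \<Omega>" and x: "x \<in> frontier \<Omega>"
  shows "outer_unit_normal \<Omega> x \<bullet> v < 0 \<longleftrightarrow> (\<exists>s>0. x + s *\<^sub>R v \<in> \<Omega>)"
proof -
  obtain U \<phi> g where L: "local_defining_function \<Omega> x U \<phi> g"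
    using assms unfolding C1_boundary_def by blast
  note n = outer_unit_normal_eq[OF L x] and d = defining_function_directions[OF L x]
  have sg: "sgn (g x) \<bullet> v = g x \<bullet> v / norm (g x)" for v
    by (simp add: sgn_div_norm divide_inverse mult.commute)
  have neg: "sgn (g x) \<bullet> v < 0 \<longleftrightarrow> g x \<bullet> v < 0" for v
    unfolding sg using d(1) by (simp add: divide_less_0_iff)
  have le: "g x \<bullet> w \<le> 0" if "x + s *\<^sub>R w \<in> \<Omega>" "s > 0" for w s
  proof (rule d(3))
    have "\<forall>\<^sub>F r in at_right 0. r < s \<and> (0::real) < r"
      using that by (auto simp: eventually_at_right_field)
    then show "\<forall>\<^sub>F r in at_right 0. x + r *\<^sub>R w \<in> \<Omega>"
    proof eventually_elim
      case (elim r)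
      show ?case
        by (rule line_between[of x s w 0])
           (use that elim frontier_in_closure[OF x] in auto)
    qed
  qed
  show ?thesis
    unfolding n neg
  proof
    assume "g x \<bullet> v < 0"
    have "\<forall>\<^sub>F s in at_right 0. x + s *\<^sub>R v \<in> \<Omega> \<and> 0 < s"
      by (rule eventually_conj[OF d(2)[OF \<open>g x \<bullet> v < 0\<close>] eventually_at_right_less])
    from eventually_happens'[OF trivial_limit_at_right_real this]
    show "\<exists>s>0. x + s *\<^sub>R v \<in> \<Omega>" by blast
  next
    assume "\<exists>s>0. x + s *\<^sub>R v \<in> \<Omega>"
    then obtain s where s: "s > 0" "x + s *\<^sub>R v \<in> \<Omega>" by blast
    obtain \<delta> where \<delta>: "\<delta> > 0" "ball (x + s *\<^sub>R v) \<delta> \<subseteq> \<Omega>"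
      using open_dom s by (meson openE)
    \<comment> \<open>The tilt moves the point at parameter \<open>s\<close> by
      \<open>c *\<^sub>R g x\<close>, a vector of length \<open>\<delta> / 2\<close>.\<close>
    define c where "c = \<delta> / (2 * norm (g x))"
    have c: "c > 0" using \<delta> d(1) by (simp add: c_def)
    have "x + s *\<^sub>R (v + (c / s) *\<^sub>R g x) \<in> \<Omega>"
      using \<delta> s(1) d(1) by (intro subsetD[OF \<delta>(2)]) (auto simp: dist_norm algebra_simps c_def)
    from le[OF this s(1)] have "g x \<bullet> v + (c / s) * (g x \<bullet> g x) \<le> 0"
      by (simp add: inner_add_right)
    moreover have "(c / s) * (g x \<bullet> g x) > 0"
      using c s d(1) by simp
    ultimately show "g x \<bullet> v < 0" by linarith
  qed
qed

lemma mem_inflow_boundary: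
  assumes "C1_boundary \<Omega>"
  shows "(x, \<xi>) \<in> inflow_boundary \<Omega> \<longleftrightarrow> x \<in> frontier \<Omega> \<and> norm \<xi> = 1 \<and> (\<exists>s>0. x + s *\<^sub>R \<xi> \<in> \<Omega>)"
  using outer_unit_normal_directions[OF assms] by (auto simp: inflow_boundary_def)

lemma mem_outflow_boundary:
  assumes "C1_boundary \<Omega>"
  shows "(x, \<xi>) \<in> outflow_boundary \<Omega> \<longleftrightarrow> x \<in> frontier \<Omega> \<and> norm \<xi> = 1 \<and> (\<exists>s>0. x - s *\<^sub>R \<xi> \<in> \<Omega>)"
  using outer_unit_normal_directions[OF assms, of x "- \<xi>"] by (auto simp: outflow_boundary_def)

text \<open>The extended phase domain described without normals, as
  \<open>extended_phase_domain_eq\<close> shows. Lines that only touch the boundary are excluded;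
  there the exit time need not be continuous.\<close>

definition rays :: "('a \<times> 'a) set" where
  "rays = {(x, \<xi>). norm \<xi> = 1 \<and> x \<in> closure \<Omega> \<and> (\<exists>s. x + s *\<^sub>R \<xi> \<in> \<Omega>)}"

lemma raysD:
  assumes "(x, \<xi>) \<in> rays"
  shows "norm \<xi> = 1" "x \<in> closure \<Omega>" "\<exists>s. x + s *\<^sub>R \<xi> \<in> \<Omega>"
  using assms by (auto simp: rays_def)

lemma interior_rays: "x \<in> \<Omega> \<Longrightarrow> norm \<xi> = 1 \<Longrightarrow> (x, \<xi>) \<in> rays"
  using closure_subset[of \<Omega>] by (auto simp: rays_def intro!: exI[of _ 0])

lemma extended_phase_domain_eq:
  assumes "C1_boundary \<Omega>"
  shows "extended_phase_domain \<Omega> = rays"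
proof (rule set_eqI, clarify)
  fix x \<xi> :: 'a
  have *: "x \<in> closure \<Omega> \<longleftrightarrow> x \<in> \<Omega> \<or> x \<in> frontier \<Omega>"
    using open_dom closure_subset[of \<Omega>] by (auto simp: frontier_def interior_open)
  have "(\<exists>s. x + s *\<^sub>R \<xi> \<in> \<Omega>) \<longleftrightarrow> (\<exists>s>0. x + s *\<^sub>R \<xi> \<in> \<Omega>) \<or> (\<exists>s>0. x - s *\<^sub>R \<xi> \<in> \<Omega>)"
    if "x \<in> frontier \<Omega>"
  proof
    assume "\<exists>s. x + s *\<^sub>R \<xi> \<in> \<Omega>"
    then obtain s where s: "x + s *\<^sub>R \<xi> \<in> \<Omega>" by blast
    then have "s \<noteq> 0" using frontier_not_in[OF that] by auto
    then show "(\<exists>s>0. x + s *\<^sub>R \<xi> \<in> \<Omega>) \<or> (\<exists>s>0. x - s *\<^sub>R \<xi> \<in> \<Omega>)"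
      using s by (cases "s > 0") (auto intro: exI[of _ "- s"])
  qed (metis add_uminus_conv_diff scaleR_minus_left)
  then show "(x, \<xi>) \<in> extended_phase_domain \<Omega> \<longleftrightarrow> (x, \<xi>) \<in> rays"
    using interior_rays[of x \<xi>] *
    by (auto simp: extended_phase_domain_def phase_domain_def mem_inflow_boundary[OF assms]
        mem_outflow_boundary[OF assms] rays_def)
qed

section \<open>Backward exit times and entry points\<close>

abbreviation \<tau> where "\<tau> \<equiv> backward_exit_time \<Omega>"
abbreviation P where "P \<equiv> entry_point \<Omega>"

lemma exits:
  assumes "norm \<xi> = 1"
  shows "\<exists>t>0. \<forall>x\<in>closure \<Omega>. \<forall>s\<ge>t. \<forall>\<xi>. norm \<xi> = 1 \<longrightarrow> x - s *\<^sub>R \<xi> \<notin> closure \<Omega>"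
proof -
  obtain B where B: "\<And>x. x \<in> closure \<Omega> \<Longrightarrow> norm x \<le> B" "B > 0"
    using bounded_closure[OF bounded_dom] unfolding bounded_pos by blast
  show ?thesis
  proof (intro exI[of _ "2 * B + 1"] conjI ballI allI impI notI)
    fix x s and \<xi> :: 'a
    assume a: "x \<in> closure \<Omega>" "2 * B + 1 \<le> s" "norm \<xi> = 1" "x - s *\<^sub>R \<xi> \<in> closure \<Omega>"
    have "norm (s *\<^sub>R \<xi>) \<le> norm x + norm (x - s *\<^sub>R \<xi>)"
      using norm_triangle_ineq4[of x "x - s *\<^sub>R \<xi>"] by simp
    then show False using a B(1)[OF a(1)] B(1)[OF a(4)] by (simp add: abs_le_iff)
  qed (use B in auto)
qed

lemma exit_set:
  assumes "norm \<xi> = 1" "x \<in> closure \<Omega>"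
  shows "{t. 0 < t \<and> x - t *\<^sub>R \<xi> \<notin> \<Omega>} \<noteq> {}" "bdd_below {t. 0 < t \<and> x - t *\<^sub>R \<xi> \<notin> \<Omega>}"
proof -
  show "{t. 0 < t \<and> x - t *\<^sub>R \<xi> \<notin> \<Omega>} \<noteq> {}"
    using exits[OF assms(1)] assms closure_subset[of \<Omega>] by blast
  show "bdd_below {t. 0 < t \<and> x - t *\<^sub>R \<xi> \<notin> \<Omega>}"
    by (rule bdd_belowI[of _ 0]) auto
qed

lemma exit_time_nonneg: "norm \<xi> = 1 \<Longrightarrow> x \<in> closure \<Omega> \<Longrightarrow> 0 \<le> \<tau> x \<xi>"
  unfolding backward_exit_time_def by (rule cInf_greatest[OF exit_set(1)]) auto

lemma before_exit:
  assumes "norm \<xi> = 1" "x \<in> closure \<Omega>" "0 < s" "s < \<tau> x \<xi>"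
  shows "x - s *\<^sub>R \<xi> \<in> \<Omega>"
  using cInf_lower[OF _ exit_set(2)[OF assms(1,2)], of s] assms(3,4)
  unfolding backward_exit_time_def by force

lemma le_exit_time:
  assumes "(x, \<xi>) \<in> rays" "0 \<le> s" "x - s *\<^sub>R \<xi> \<in> closure \<Omega>"
  shows "s \<le> \<tau> x \<xi>"
proof (rule ccontr)
  assume "\<not> s \<le> \<tau> x \<xi>"
  then obtain s' where s': "0 < s'" "x - s' *\<^sub>R \<xi> \<notin> \<Omega>" "s' < s"
    using cInf_lessD[OF exit_set(1)[OF raysD(1,2)[OF assms(1)]], of s]
    unfolding backward_exit_time_def by auto
  \<comment> \<open>The line meets \<open>\<Omega>\<close> at parameter \<open>- t\<close>. If
    \<open>- t \<le> s'\<close>, the segment from there to the closure point at \<open>s\<close>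
    contains \<open>s'\<close>; otherwise the segment to \<open>x\<close> at parameter 0
    does.\<close>
  obtain t where t: "x - (- t) *\<^sub>R \<xi> \<in> \<Omega>" using raysD(3)[OF assms(1)] by auto
  have x: "x - 0 *\<^sub>R \<xi> \<in> closure \<Omega>" using raysD(2)[OF assms(1)] by simp
  show False
    using line_between_minus[OF t assms(3), of s'] line_between_minus[OF t x, of s'] s' by force
qed

lemma entry_point_frontier:
  assumes r: "(x, \<xi>) \<in> rays"
  shows "P x \<xi> \<in> frontier \<Omega>"
proof -
  note d = raysD[OF r]
  have \<tau>0: "0 \<le> \<tau> x \<xi>" using exit_time_nonneg d by blast
  have "P x \<xi> \<in> closure \<Omega>"
  proof (cases "\<tau> x \<xi> = 0")
    case True then show ?thesis using d by (simp add: entry_point_def)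
  next
    case False
    have "((\<lambda>s. x - s *\<^sub>R \<xi>) \<longlongrightarrow> x - \<tau> x \<xi> *\<^sub>R \<xi>) (at_left (\<tau> x \<xi>))"
      by (intro tendsto_intros)
    moreover have "\<forall>\<^sub>F s in at_left (\<tau> x \<xi>). x - s *\<^sub>R \<xi> \<in> closure \<Omega>"
      using False \<tau>0 before_exit[OF d(1,2)] closure_subset[of \<Omega>]
      by (auto simp: eventually_at_left_field intro!: exI[of _ 0])
    ultimately show ?thesis
      unfolding entry_point_def by (intro Lim_in_closed_set[of "closure \<Omega>"]) auto
  qed
  moreover have "P x \<xi> \<notin> \<Omega>"
  proof
    assume "P x \<xi> \<in> \<Omega>"
    then obtain e where e: "e > 0" "ball (P x \<xi>) e \<subseteq> \<Omega>" using open_dom by (meson openE)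
    have "x - (\<tau> x \<xi> + e / 2) *\<^sub>R \<xi> \<in> ball (P x \<xi>) e"
      using e d by (simp add: entry_point_def dist_norm algebra_simps)
    then have "x - (\<tau> x \<xi> + e / 2) *\<^sub>R \<xi> \<in> closure \<Omega>"
      using e closure_subset[of \<Omega>] by blast
    then show False
      using le_exit_time[OF r, of "\<tau> x \<xi> + e / 2"] e \<tau>0 by simp
  qed
  ultimately show ?thesis using open_dom by (simp add: frontier_def interior_open)
qed

text \<open>Points before the exit are interior and points beyond it lie outside the closure, so any
  explicit frontier point at a positive parameter identifies the exit time.\<close>

lemma exit_timeI:
  assumes r: "(x, \<xi>) \<in> rays" and x: "0 < s" "x - s *\<^sub>R \<xi> \<in> frontier \<Omega>"
  shows "\<tau> x \<xi> = s"
proof -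
  have "s \<le> \<tau> x \<xi>" using le_exit_time[OF r, of s] x frontier_in_closure by auto
  moreover have "\<not> s < \<tau> x \<xi>"
    using before_exit[OF raysD(1,2)[OF r], of s] x frontier_not_in by auto
  ultimately show ?thesis by simp
qed

lemma exit_time_pos: "x \<in> \<Omega> \<Longrightarrow> norm \<xi> = 1 \<Longrightarrow> 0 < \<tau> x \<xi>"
  using entry_point_frontier[OF interior_rays, of x \<xi>] frontier_not_in
    exit_time_nonneg[of \<xi> x] closure_subset[of \<Omega>]
  by (fastforce simp: entry_point_def less_le)

lemma entry_point_inflow:
  assumes r: "(x, \<xi>) \<in> rays"
  shows "\<exists>s>0. P x \<xi> + s *\<^sub>R \<xi> \<in> \<Omega>"
proof (cases "\<tau> x \<xi> = 0")
  case False
  then have t: "0 < \<tau> x \<xi>" using exit_time_nonneg raysD[OF r] by (simp add: less_le)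
  have "x - (\<tau> x \<xi> / 2) *\<^sub>R \<xi> \<in> \<Omega>" by (rule before_exit) (use raysD[OF r] t in auto)
  also have "x - (\<tau> x \<xi> / 2) *\<^sub>R \<xi> = P x \<xi> + (\<tau> x \<xi> / 2) *\<^sub>R \<xi>"
    using scaleR_left_distrib[of "\<tau> x \<xi> / 2" "\<tau> x \<xi> / 2" \<xi>] by (simp add: entry_point_def)
  finally show ?thesis using t by (intro exI[of _ "\<tau> x \<xi> / 2"]) auto
next
  case True
  obtain s where s: "x + s *\<^sub>R \<xi> \<in> \<Omega>" using raysD[OF r] by blast
  have "x \<notin> \<Omega>" using exit_time_pos[of x \<xi>] True raysD[OF r] by auto
  then have "s \<noteq> 0" using s by auto
  moreover have "\<not> s < 0"
  proof
    assume "s < 0"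
    then have "- s \<le> \<tau> x \<xi>" using s closure_subset[of \<Omega>] by (intro le_exit_time[OF r]) auto
    then show False using True \<open>s < 0\<close> by simp
  qed
  ultimately show ?thesis using s True by (intro exI[of _ s]) (auto simp: entry_point_def)
qed

lemma entry_point_translate:
  assumes r: "(x, \<xi>) \<in> rays" and s: "x + s *\<^sub>R \<xi> \<in> \<Omega>"
  shows "\<tau> (x + s *\<^sub>R \<xi>) \<xi> = \<tau> x \<xi> + s" "P (x + s *\<^sub>R \<xi>) \<xi> = P x \<xi>" "0 < \<tau> x \<xi> + s"
proof -
  have eq: "x + s *\<^sub>R \<xi> - (\<tau> x \<xi> + s) *\<^sub>R \<xi> = P x \<xi>"
    by (simp add: entry_point_def algebra_simps)
  have F: "P x \<xi> \<in> frontier \<Omega>" by (rule entry_point_frontier[OF r])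
  show pos: "0 < \<tau> x \<xi> + s"
  proof (rule ccontr)
    assume n: "\<not> 0 < \<tau> x \<xi> + s"
    then have "- s \<le> \<tau> x \<xi>"
      using s closure_subset[of \<Omega>] exit_time_nonneg[OF raysD(1,2)[OF r]]
      by (intro le_exit_time[OF r]) auto
    with n have "\<tau> x \<xi> = - s" by simp
    then have "P x \<xi> \<in> \<Omega>" using s by (simp add: entry_point_def)
    then show False using frontier_not_in[OF F] by simp
  qed
  show \<tau>: "\<tau> (x + s *\<^sub>R \<xi>) \<xi> = \<tau> x \<xi> + s"
    by (rule exit_timeI) (use interior_rays[OF s raysD(1)[OF r]] pos eq F in auto)
  show "P (x + s *\<^sub>R \<xi>) \<xi> = P x \<xi>"
    using eq unfolding entry_point_def[of \<Omega> "x + s *\<^sub>R \<xi>"] \<tau> by simp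
qed

text \<open>Both halves are stability of open conditions: a point before the exit lies in
  \<open>\<Omega>\<close>, which bounds nearby exit times from below, and a point beyond it lies
  outside the closure, which bounds them from above. Convexity enters through
  \<open>le_exit_time\<close>, which excludes a return to the closure.\<close>

lemma continuous_exit_time: "continuous_on rays (\<lambda>(x, \<xi>). \<tau> x \<xi>)"
  unfolding continuous_on_sequentially o_def
proof (intro allI ballI impI, elim conjE)
  fix z :: "nat \<Rightarrow> 'a \<times> 'a" and w
  assume w: "w \<in> rays" and zr: "\<forall>n. z n \<in> rays" and lim: "z \<longlonglongrightarrow> w"
  obtain x \<xi> where xw: "w = (x, \<xi>)" by force
  define X \<Xi> where "X = (\<lambda>n. fst (z n))" and "\<Xi> = (\<lambda>n. snd (z n))"
  have zX: "z n = (X n, \<Xi> n)" for n by (simp add: X_def \<Xi>_def)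
  have r: "(x, \<xi>) \<in> rays" and rn: "\<And>n. (X n, \<Xi> n) \<in> rays"
    using w zr xw zX by auto
  have lX: "X \<longlonglongrightarrow> x" "\<Xi> \<longlonglongrightarrow> \<xi>"
    using tendsto_fst[OF lim] tendsto_snd[OF lim] by (simp_all add: X_def \<Xi>_def xw)
  have lims: "(\<lambda>n. X n - s *\<^sub>R \<Xi> n) \<longlonglongrightarrow> x - s *\<^sub>R \<xi>" for s
    by (intro tendsto_intros lX)
  have \<tau>0: "0 \<le> \<tau> x \<xi>" "\<And>n. 0 \<le> \<tau> (X n) (\<Xi> n)"
    using exit_time_nonneg raysD[OF r] raysD[OF rn] by blast+
  have "(\<lambda>n. \<tau> (X n) (\<Xi> n)) \<longlonglongrightarrow> \<tau> x \<xi>"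
  proof (rule order_tendstoI)
    fix a assume a: "a < \<tau> x \<xi>"
    show "\<forall>\<^sub>F n in sequentially. a < \<tau> (X n) (\<Xi> n)"
    proof (cases "\<tau> x \<xi> = 0")
      case True
      then show ?thesis using a \<tau>0(2) by (simp add: less_le_trans always_eventually)
    next
      case False
      \<comment> \<open>Midpoint of \<open>max a 0\<close> and the exit time, because
        \<open>before_exit\<close> needs a positive parameter.\<close>
      define s where "s = (max a 0 + \<tau> x \<xi>) / 2"
      have s: "0 < s" "a < s" "s < \<tau> x \<xi>" using a False \<tau>0(1) by (auto simp: s_def max_def field_simps)
      then have "x - s *\<^sub>R \<xi> \<in> \<Omega>" using before_exit raysD[OF r] by blast
      then have "\<forall>\<^sub>F n in sequentially. X n - s *\<^sub>R \<Xi> n \<in> \<Omega>"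
        using lims open_dom by (rule topological_tendstoD[rotated -1])
      then show ?thesis
      proof eventually_elim
        case (elim n)
        then show ?case
          using le_exit_time[OF rn, of s n] s closure_subset[of \<Omega>] by force
      qed
    qed
  next
    fix a assume a: "\<tau> x \<xi> < a"
    then have "x - a *\<^sub>R \<xi> \<notin> closure \<Omega>" using le_exit_time[OF r, of a] \<tau>0 by force
    then have "\<forall>\<^sub>F n in sequentially. X n - a *\<^sub>R \<Xi> n \<in> - closure \<Omega>"
      by (intro topological_tendstoD[OF lims]) auto
    then show "\<forall>\<^sub>F n in sequentially. \<tau> (X n) (\<Xi> n) < a"
    proof eventually_elim
      case (elim n)
      show ?case
      proof (rule ccontr)
        assume n: "\<not> \<tau> (X n) (\<Xi> n) < a"
        have "X n - a *\<^sub>R \<Xi> n \<in> closure \<Omega>"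
        proof (cases "a = \<tau> (X n) (\<Xi> n)")
          case True
          then show ?thesis
            using frontier_in_closure[OF entry_point_frontier[OF rn[of n]]] by (simp add: entry_point_def)
        next
          case False
          then show ?thesis
            using before_exit[OF raysD(1,2)[OF rn[of n]], of a] n a \<tau>0(1) closure_subset[of \<Omega>] by auto
        qed
        then show False using elim by simp
      qed
    qed
  qed
  then show "(\<lambda>n. case z n of (x, \<xi>) \<Rightarrow> \<tau> x \<xi>) \<longlonglongrightarrow> (case w of (x, \<xi>) \<Rightarrow> \<tau> x \<xi>)"
    by (simp add: zX xw)
qed

lemma continuous_entry_point: "continuous_on rays (\<lambda>(x, \<xi>). P x \<xi>)"
  using continuous_exit_time
  by (auto simp: entry_point_def case_prod_beta' intro!: continuous_intros)

end

section \<open>Solid angles\<close>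

text \<open>The factor is not sharp: the cubes of a covering are mapped into cubes.\<close>

lemma Lipschitz_image_measure:
  fixes F :: "'a::euclidean_space \<Rightarrow> 'a"
  assumes S: "S \<in> lmeasurable" "bounded S" and T: "T \<in> lmeasurable" "T \<subseteq> F ` S"
    and L: "0 < L" "\<And>x y. x \<in> S \<Longrightarrow> y \<in> S \<Longrightarrow> norm (F x - F y) \<le> L * norm (x - y)"
  shows "measure lebesgue T \<le> (2 * L * DIM('a)) ^ DIM('a) * measure lebesgue S"
proof (rule field_le_epsilon)
  fix e :: real assume e: "0 < e"
  let ?K = "(2 * L * DIM('a)) ^ DIM('a)"
  have K: "0 < ?K" using L(1) by simp
  obtain c where c: "S \<subseteq> cbox (- c *\<^sub>R One) (c *\<^sub>R One)" "0 < c"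
  proof -
    obtain B where B: "\<And>x. x \<in> S \<Longrightarrow> norm x \<le> B"
      using S(2) bounded_iff by blast
    have "S \<subseteq> cbox (- (\<bar>B\<bar> + 1) *\<^sub>R One) ((\<bar>B\<bar> + 1) *\<^sub>R One)"
      using norm_bound_Basis_le Basis_le_norm
      by (fastforce simp: mem_box dest!: B intro: order_trans)
    then show ?thesis by (rule that) simp
  qed
  \<comment> \<open>The covering may overshoot by \<open>e / ?K\<close>, which the factor
    \<open>?K\<close> turns into \<open>e\<close>.\<close>
  have eK: "0 < e / ?K" using e K by simp
  obtain \<D> where D: "countable \<D>" "\<And>K. K \<in> \<D> \<Longrightarrow> K \<noteq> {} \<and> (\<exists>c d. K = cbox c d)"
      "pairwise (\<lambda>A B. interior A \<inter> interior B = {}) \<D>"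
      "\<And>u v. cbox u v \<in> \<D> \<Longrightarrow> \<exists>n. \<forall>i\<in>Basis. v \<bullet> i - u \<bullet> i = (2 * c) / 2 ^ n"
      "S \<subseteq> \<Union>\<D>" "\<Union>\<D> \<in> lmeasurable" "measure lebesgue (\<Union>\<D>) \<le> measure lebesgue S + e / ?K"
    by (rule measurable_outer_intervals_bounded[OF S(1) c(1) eK]) (auto simp: inner_diff_left)
  have "\<exists>V. V \<in> lmeasurable \<and> F ` (S \<inter> Q) \<subseteq> V \<and> measure lebesgue V \<le> ?K * measure lebesgue Q"
    if Q: "Q \<in> \<D>" for Q
  proof (cases "S \<inter> Q = {}")
    case True
    then show ?thesis using K by (intro exI[of _ "{}"]) simp
  next
    case False
    then obtain z where z: "z \<in> S" "z \<in> Q" by blast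
    obtain u v where uv: "Q = cbox u v" using D(2)[OF Q] by blast
    then obtain n where n: "\<And>i. i \<in> Basis \<Longrightarrow> v \<bullet> i - u \<bullet> i = (2 * c) / 2 ^ n"
      using D(4) Q by blast
    define h where "h = (2 * c) / 2 ^ n"
    have h: "0 < h" using c by (simp add: h_def)
    \<comment> \<open>Two points of a cube of side \<open>h\<close> differ by at most
      \<open>DIM('a) * h\<close> in the sum norm, so their images differ by at most
      \<open>m\<close>. The cube \<open>?V\<close> of side \<open>2 * m\<close> then yields the
      factor \<open>?K\<close>.\<close>
    define m where "m = L * (DIM('a) * h)"
    have m: "0 < m" using h L by (simp add: m_def)
    let ?V = "cbox (F z - m *\<^sub>R One) (F z + m *\<^sub>R One)"
    have "F y \<in> ?V" if y: "y \<in> S" "y \<in> Q" for y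
    proof -
      have "norm (y - z) \<le> (\<Sum>i\<in>Basis. \<bar>(y - z) \<bullet> i\<bar>)" by (rule norm_le_l1)
      also have "\<dots> \<le> real DIM('a) * h"
      proof (rule sum_bounded_above)
        fix i :: 'a assume i: "i \<in> Basis"
        have "u \<bullet> i \<le> y \<bullet> i" "y \<bullet> i \<le> v \<bullet> i" "u \<bullet> i \<le> z \<bullet> i" "z \<bullet> i \<le> v \<bullet> i"
          using y(2) z(2) i unfolding uv by (auto simp: mem_box)
        then show "\<bar>(y - z) \<bullet> i\<bar> \<le> h" using n[OF i] by (simp add: h_def inner_diff_left)
      qed
      finally have "L * norm (y - z) \<le> m" using L(1) by (simp add: m_def)
      then have *: "norm (F y - F z) \<le> m" using L(2)[OF y(1) z(1)] by linarith
      have "\<bar>F y \<bullet> i - F z \<bullet> i\<bar> \<le> m" if "i \<in> Basis" for i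
        using order_trans[OF Basis_le_norm[OF that, of "F y - F z"] *] by (simp add: inner_diff_left)
      then show ?thesis by (force simp: mem_box inner_diff_left inner_add_left abs_le_iff)
    qed
    moreover have "measure lebesgue ?V = ?K * measure lebesgue Q"
    proof -
      have "measure lebesgue ?V = (\<Prod>i\<in>(Basis::'a set). 2 * m)"
        using m by (simp add: content_cbox_cases inner_diff_left inner_add_left)
      moreover have "measure lebesgue Q = (\<Prod>i\<in>(Basis::'a set). h)"
        unfolding uv using n h by (auto simp: content_cbox_cases h_def intro!: prod.cong)
           (metis diff_ge_0_iff_ge less_eq_real_def)+
      ultimately show ?thesis by (simp add: m_def power_mult_distrib)
    qed
    ultimately show ?thesis by (intro exI[of _ ?V]) auto
  qed
  then obtain V where V: "\<And>Q. Q \<in> \<D> \<Longrightarrow> V Q \<in> lmeasurable"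
      "\<And>Q. Q \<in> \<D> \<Longrightarrow> F ` (S \<inter> Q) \<subseteq> V Q"
      "\<And>Q. Q \<in> \<D> \<Longrightarrow> measure lebesgue (V Q) \<le> ?K * measure lebesgue Q"
    by metis
  \<comment> \<open>The lemmas on countable unions ask for bounds on finite subfamilies; there the
    volumes add up because the interiors are disjoint.\<close>
  have bound: "measure lebesgue (\<Union>Q\<in>D'. V Q) \<le> ?K * measure lebesgue (\<Union>\<D>)"
    if D': "D' \<subseteq> \<D>" "finite D'" for D'
  proof -
    have div: "D' division_of \<Union>D'"
      using pairwise_subset[OF D(3) D'(1)] D'(2) D(2) subsetD[OF D'(1)]
      unfolding pairwise_def division_of_def by (auto 4 4)
    have "measure lebesgue (\<Union>Q\<in>D'. V Q) \<le> (\<Sum>Q\<in>D'. measure lebesgue (V Q))"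
      by (rule measure_UNION_le) (use D' V(1) in auto)
    also have "\<dots> \<le> (\<Sum>Q\<in>D'. ?K * measure lebesgue Q)"
      by (rule sum_mono) (use V(3) D' in auto)
    also have "\<dots> = ?K * measure lebesgue (\<Union>D')"
      using content_division[OF div] by (simp flip: sum_distrib_left)
    also have "measure lebesgue (\<Union>D') \<le> measure lebesgue (\<Union>\<D>)"
      by (rule measure_mono_fmeasurable) (use D'(1) fmeasurableD[OF lmeasurable_division[OF div]] D(6) in auto)
    finally show ?thesis using K by (simp add: mult_left_mono)
  qed
  have "measure lebesgue T \<le> measure lebesgue (\<Union>Q\<in>\<D>. V Q)"
  proof (rule measure_mono_fmeasurable)
    show "T \<subseteq> (\<Union>Q\<in>\<D>. V Q)" using T(2) D(5) V(2) by blast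
    show "(\<Union>Q\<in>\<D>. V Q) \<in> lmeasurable"
      by (rule fmeasurable_UN_bound[OF D(1) V(1) bound])
  qed (use T in auto)
  also have "\<dots> \<le> ?K * measure lebesgue (\<Union>\<D>)"
    by (rule measure_UN_bound[OF D(1) V(1) bound])
  also have "\<dots> \<le> ?K * (measure lebesgue S + e / ?K)"
    using D(7) K by simp
  also have "\<dots> = ?K * measure lebesgue S + e" using L(1) by (simp add: distrib_left)
  finally show "measure lebesgue T \<le> ?K * measure lebesgue S + e" .
qed


section \<open>Surface measure as the volume of cones\<close>

definition unit_cone :: "'a::euclidean_space set \<Rightarrow> 'a set" where
  "unit_cone E = {w \<in> ball 0 1 - {0}. sgn w \<in> E}"

lemma space_sphere_measure [simp]: "space sphere_measure = sphere 0 1"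
  by (simp add: sphere_measure_def space_restrict_space space_scale_measure)

lemma sgn_measurable:
  "sgn \<in> measurable (restrict_space lborel (ball 0 1 - {0::'a::euclidean_space}))
     (restrict_space borel (sphere 0 1))"
proof (rule measurable_restrict_space2)
  have "(sgn :: 'a \<Rightarrow> 'a) \<in> borel_measurable borel"
    unfolding sgn_div_norm[abs_def] by measurable
  then show "(sgn :: 'a \<Rightarrow> 'a) \<in> borel_measurable (restrict_space lborel (ball 0 1 - {0}))"
    by (intro measurable_restrict_space1) simp
qed (auto simp: space_restrict_space norm_sgn)

lemma
  assumes E: "E \<in> sets (restrict_space borel (sphere 0 (1::real)))"
  shows sets_unit_cone: "unit_cone E \<in> sets borel"
    and sets_sphere_measure: "E \<in> sets (sphere_measure :: 'a::euclidean_space measure)"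
    and emeasure_sphere_measure:
      "emeasure sphere_measure E = of_nat DIM('a) * emeasure lborel (unit_cone E)"
proof -
  have *: "sgn -` E \<inter> space (restrict_space lborel (ball 0 1 - {0})) = unit_cone E"
    by (auto simp: unit_cone_def space_restrict_space)
  show c: "unit_cone E \<in> sets borel"
    using measurable_sets[OF sgn_measurable E] unfolding *
    by (subst (asm) sets_restrict_space_iff) auto
  show "E \<in> sets sphere_measure"
    using E by (auto simp: sphere_measure_def sets_completionI_sets)
  show "emeasure sphere_measure E = of_nat DIM('a) * emeasure lborel (unit_cone E)"
  proof -
    have "emeasure (completion M) E = emeasure M E" if "E \<in> sets M" for M
      using that by (simp add: sets_completionI_sets)
    then have "emeasure sphere_measure E = of_nat DIM('a) *
        emeasure (distr (restrict_space lborel (ball 0 1 - {0})) (restrict_space borel (sphere 0 1)) sgn) E"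
      using E by (simp add: sphere_measure_def)
    also have "\<dots> = of_nat DIM('a) * emeasure (restrict_space lborel (ball 0 1 - {0})) (unit_cone E)"
      using * by (simp add: emeasure_distr[OF sgn_measurable E] space_restrict_space)
    also have "\<dots> = of_nat DIM('a) * emeasure lborel (unit_cone E)"
      by (subst emeasure_restrict_space) (auto simp: unit_cone_def)
    finally show ?thesis .
  qed
qed

lemma bounded_unit_cone: "bounded (unit_cone E)"
  by (rule bounded_subset[of "ball 0 1"]) (auto simp: unit_cone_def)

lemma lmeasurable_unit_cone:
  "E \<in> sets (restrict_space borel (sphere 0 1)) \<Longrightarrow> unit_cone E \<in> lmeasurable"
  using sets_unit_cone[of E] by (intro bounded_set_imp_lmeasurable bounded_unit_cone) (simp add: sets_completionI_sets)

lemma sphere_in_sets: "sphere 0 1 \<in> sets (restrict_space borel (sphere 0 (1::real)))"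
  by (auto simp: sets_restrict_space intro!: image_eqI[of _ _ UNIV])

text \<open>Solid angles become volumes in full dimension, where a Lipschitz map can be controlled
  by covering with cubes.\<close>

lemma measure_sphere_measure:
  assumes "E \<in> sets (restrict_space borel (sphere 0 1))"
  shows "measure sphere_measure E = real DIM('a) * measure lebesgue (unit_cone (E :: 'a::euclidean_space set))"
  using emeasure_sphere_measure[OF assms] sets_unit_cone[OF assms]
  by (simp add: measure_def enn2real_mult flip: ennreal_of_nat_eq_real_of_nat)

interpretation sphere: finite_measure "sphere_measure :: 'a::euclidean_space measure"
proof
  have "emeasure lborel (unit_cone (sphere 0 1) :: 'a set) < \<infinity>"
    using emeasure_bounded_finite[OF bounded_unit_cone] by auto
  then show "emeasure (sphere_measure :: 'a measure) (space sphere_measure) \<noteq> \<infinity>"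
    using emeasure_sphere_measure[OF sphere_in_sets, where 'a='a]
    by (simp add: ennreal_mult_eq_top_iff less_top)
qed

text \<open>Dominated convergence for indicator functions. The sets may be arbitrary; each point
  just has to leave them eventually, at its own pace.\<close>

lemma (in finite_measure) measure_eventually_notin:
  assumes A: "\<And>n. A n \<in> sets M" and ev: "\<And>x. x \<in> space M \<Longrightarrow> \<forall>\<^sub>F n in sequentially. x \<notin> A n"
  shows "(\<lambda>n. measure M (A n)) \<longlonglongrightarrow> 0"
proof -
  have "(\<lambda>n. integral\<^sup>L M (indicat_real (A n))) \<longlonglongrightarrow> integral\<^sup>L M (\<lambda>x. 0)"
  proof (rule integral_dominated_convergence[where w="\<lambda>x. 1"])
    show "AE x in M. (\<lambda>n. indicat_real (A n) x) \<longlonglongrightarrow> 0"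
    proof (rule AE_I2)
      fix x assume "x \<in> space M"
      from ev[OF this] show "(\<lambda>n. indicat_real (A n) x) \<longlonglongrightarrow> 0"
        by (intro tendsto_eventually) (auto elim!: eventually_mono)
    qed
  qed (use A in \<open>auto simp: indicator_def\<close>)
  then show ?thesis using sets.sets_into_space[OF A] by (simp add: Int_absorb2)
qed

section \<open>Solid angles under which boundary sets are seen\<close>

context convex_domain
begin

lemma continuous_entry_point_direction:
  assumes "x \<in> \<Omega>"
  shows "continuous_on (sphere 0 1) (P x)"
proof -
  have "continuous_on (sphere 0 1) (\<lambda>\<xi>. case (x, \<xi>) of (x, \<xi>) \<Rightarrow> P x \<xi>)"
    by (rule continuous_on_compose2[OF continuous_entry_point])
       (use assms interior_rays in \<open>auto intro!: continuous_intros\<close>)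
  then show ?thesis by simp
qed

lemma measurable_entry_point:
  "x \<in> \<Omega> \<Longrightarrow> P x \<in> measurable (restrict_space borel (sphere 0 1)) borel"
  by (rule borel_measurable_continuous_on_restrict[OF continuous_entry_point_direction])

text \<open>Here \<open>\<xi>\<close> is the direction of travel, so \<open>E\<close> is looked at
  along \<open>- \<xi>\<close>. This sign is why the gauge below belongs to
  \<open>x - \<Omega>\<close>.\<close>

definition seen :: "'a \<Rightarrow> 'a set \<Rightarrow> 'a set" where
  "seen x E = {\<xi> \<in> sphere 0 1. P x \<xi> \<in> E}"

lemma sets_seen: "x \<in> \<Omega> \<Longrightarrow> E \<in> sets borel \<Longrightarrow> seen x E \<in> sets (restrict_space borel (sphere 0 1))"
  using measurable_sets[OF measurable_entry_point, of x E]
  by (simp add: space_restrict_space seen_def vimage_def Int_def conj_commute)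

text \<open>The gauge of the convex set \<open>x - \<Omega>\<close>.\<close>

definition gauge_at :: "'a \<Rightarrow> 'a \<Rightarrow> real" where
  "gauge_at x w = norm w / \<tau> x (sgn w)"

text \<open>Subadditivity of the gauge, combined with its bound \<open>norm u / r\<close> on a
  vector \<open>u\<close>, which the ball of radius \<open>r\<close> provides. With \<open>a\<close>
  the gauge of \<open>v\<close> and \<open>b\<close> the bound for \<open>w - v\<close>, the points
  \<open>x - (1 / a) *\<^sub>R v\<close> and \<open>x - (1 / b) *\<^sub>R (w - v)\<close> lie in the
  closure, and their convex combination with weights proportional to \<open>a\<close> and
  \<open>b\<close> is \<open>x - (1 / (a + b)) *\<^sub>R w\<close>.\<close>

lemma gauge_at_le:
  assumes x: "x \<in> \<Omega>" "cball x r \<subseteq> closure \<Omega>" "0 < r" and w: "w \<noteq> 0" "v \<noteq> 0"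
  shows "gauge_at x w \<le> gauge_at x v + norm (w - v) / r"
proof (cases "w = v")
  case False
  have nw: "norm (sgn w) = 1" and nv: "norm (sgn v) = 1" using w by (auto simp: norm_sgn)
  note t = exit_time_pos[OF x(1) nw] exit_time_pos[OF x(1) nv]
  define a where "a = gauge_at x v"
  define b where "b = norm (w - v) / r"
  have ab: "0 < a" "0 < b" using t w x False by (auto simp: a_def b_def gauge_at_def)
  have y: "x - (1 / a) *\<^sub>R v \<in> closure \<Omega>"
  proof -
    have "(1 / a) *\<^sub>R v = \<tau> x (sgn v) *\<^sub>R sgn v"
      using w by (simp add: a_def gauge_at_def sgn_div_norm divide_inverse)
    then have "x - (1 / a) *\<^sub>R v = P x (sgn v)" by (simp add: entry_point_def)
    then show ?thesis
      using frontier_in_closure[OF entry_point_frontier[OF interior_rays[OF x(1) nv]]] by simp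
  qed
  have z: "x - (1 / b) *\<^sub>R (w - v) \<in> closure \<Omega>"
    using x False by (intro subsetD[OF x(2)]) (simp add: dist_norm b_def)
  have "(a / (a + b)) *\<^sub>R (x - (1 / a) *\<^sub>R v) + (b / (a + b)) *\<^sub>R (x - (1 / b) *\<^sub>R (w - v)) \<in> closure \<Omega>"
    using ab by (intro convexD[OF convex_closure[OF convex_dom] y z]) (auto simp flip: add_divide_distrib)
  also have "(a / (a + b)) *\<^sub>R (x - (1 / a) *\<^sub>R v) + (b / (a + b)) *\<^sub>R (x - (1 / b) *\<^sub>R (w - v))
      = (a / (a + b) + b / (a + b)) *\<^sub>R x - (1 / (a + b)) *\<^sub>R v - (1 / (a + b)) *\<^sub>R (w - v)"
    using ab by (simp add: algebra_simps)
  also have "\<dots> = x - (norm w / (a + b)) *\<^sub>R sgn w"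
    using ab w by (simp add: sgn_div_norm algebra_simps flip: add_divide_distrib)
  finally have "norm w / (a + b) \<le> \<tau> x (sgn w)"
    using ab by (intro le_exit_time interior_rays x nw) auto
  then show ?thesis
    using t(1) ab by (simp add: gauge_at_def[of x w] a_def[symmetric] b_def[symmetric] field_simps)
qed simp

text \<open>Each frontier point \<open>y\<close> contributes multiples of \<open>x - y\<close> to
  one cone and of \<open>x' - y\<close> to the other. The map \<open>F\<close> sends
  \<open>k *\<^sub>R (x - y)\<close> to \<open>(k * R / r) *\<^sub>R (x' - y)\<close>: the gauge
  recovers the coefficient \<open>k\<close>, and adding \<open>k *\<^sub>R (x' - x)\<close> moves
  the apex. Since the gauge is Lipschitz, so is \<open>F\<close>, with a constant independent of
  \<open>E\<close>. This uniformity matters because the bound is later applied to shrinking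
  neighbourhoods.\<close>

lemma solid_angle_comparable:
  assumes x: "x \<in> \<Omega>"
  shows "\<exists>C \<delta>. 0 < \<delta> \<and> 0 < C \<and> (\<forall>x'\<in>ball x \<delta>. x' \<in> \<Omega> \<and> (\<forall>E\<in>sets borel.
    measure sphere_measure (seen x' E) \<le> C * measure sphere_measure (seen x E)))"
proof -
  obtain r' where r': "r' > 0" "cball x r' \<subseteq> \<Omega>" using open_dom x open_contains_cball by blast
  \<comment> \<open>Halving leaves room: balls of radius \<open>r\<close> around all
    \<open>x'\<close> within \<open>r\<close> of \<open>x\<close> stay in
    \<open>\<Omega>\<close>.\<close>
  define r where "r = r' / 2"
  have r: "r > 0" using r' by (simp add: r_def)
  obtain R where R: "R > 0" "\<And>y. y \<in> closure \<Omega> \<Longrightarrow> norm (x - y) \<le> R"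
  proof -
    obtain B where "B > 0" "\<And>y. y \<in> closure \<Omega> \<Longrightarrow> norm y \<le> B"
      using bounded_closure[OF bounded_dom] unfolding bounded_pos by blast
    then have "norm x + B > 0 \<and> (\<forall>y\<in>closure \<Omega>. norm (x - y) \<le> norm x + B)"
      using order_trans[OF norm_triangle_ineq4[of x]] by (auto intro: add_nonneg_pos)
    then show ?thesis using that by blast
  qed
  \<comment> \<open>\<open>R / r\<close> is the scaling in \<open>F\<close>; the factor 2 counts the
    vector itself and the gauge term, each contributing at most \<open>norm (w - v)\<close>.\<close>
  define L where "L = 2 * R / r"
  have L: "L > 0" using R r by (simp add: L_def)
  have ball: "cball x' r \<subseteq> \<Omega>" if "x' \<in> cball x r" for x'
  proof
    fix z assume "z \<in> cball x' r"
    then have "dist x z \<le> r'" using that dist_triangle[of x z x'] by (simp add: r_def)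
    then show "z \<in> \<Omega>" using r' by auto
  qed
  show ?thesis
  proof (rule exI[of _ "(2 * L * DIM('a)) ^ DIM('a)"], rule exI[of _ r], intro conjI ballI r)
    show "0 < (2 * L * DIM('a)) ^ DIM('a)" using L by simp
    fix x' assume x': "x' \<in> ball x r"
    then have bx: "cball x' r \<subseteq> \<Omega>" "cball x r \<subseteq> \<Omega>" using ball r by auto
    then show x'\<Omega>: "x' \<in> \<Omega>" using r by auto
    fix E :: "'a set" assume E: "E \<in> sets borel"
    let ?S = "unit_cone (seen x E)" and ?T = "unit_cone (seen x' E)"
    define F where "F = (\<lambda>w. (1 / r) *\<^sub>R (R *\<^sub>R w + (R * gauge_at x w) *\<^sub>R (x' - x)))"
    have "measure lebesgue ?T \<le> (2 * L * DIM('a)) ^ DIM('a) * measure lebesgue ?S"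
    proof (rule Lipschitz_image_measure[where F=F])
      show "?S \<in> lmeasurable" "bounded ?S" "?T \<in> lmeasurable" "0 < L"
        using lmeasurable_unit_cone sets_seen x x'\<Omega> E bounded_unit_cone L by auto
      fix w v assume "w \<in> ?S" "v \<in> ?S"
      then have nz: "w \<noteq> 0" "v \<noteq> 0" by (auto simp: unit_cone_def)
      have "cball x r \<subseteq> closure \<Omega>" using bx closure_subset by blast
      then have "\<bar>gauge_at x w - gauge_at x v\<bar> \<le> norm (w - v) / r"
        using gauge_at_le[OF x _ r nz] gauge_at_le[OF x _ r nz(2,1)]
        by (simp add: abs_le_iff norm_minus_commute)
      then have "\<bar>gauge_at x w - gauge_at x v\<bar> * norm (x' - x) \<le> norm (w - v) / r * r"
        using x' r by (intro mult_mono) (auto simp: dist_norm norm_minus_commute)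
      then have g: "\<bar>gauge_at x w - gauge_at x v\<bar> * norm (x' - x) \<le> norm (w - v)"
        using r by simp
      have "F w - F v = (R / r) *\<^sub>R ((w - v) + (gauge_at x w - gauge_at x v) *\<^sub>R (x' - x))"
        using r by (simp add: F_def algebra_simps)
      then have "norm (F w - F v) = (R / r) * norm ((w - v) + (gauge_at x w - gauge_at x v) *\<^sub>R (x' - x))"
        using r R by simp
      also have "\<dots> \<le> (R / r) * (norm (w - v) + norm (w - v))"
        using r R g by (intro mult_left_mono order_trans[OF norm_triangle_ineq] add_mono) auto
      finally show "norm (F w - F v) \<le> L * norm (w - v)" by (simp add: L_def mult_ac)
    next
      show "?T \<subseteq> F ` ?S"
      proof
        fix w' assume "w' \<in> ?T"
        then have w': "norm w' < 1" "w' \<noteq> 0" "P x' (sgn w') \<in> E" by (auto simp: unit_cone_def seen_def)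
        define y where "y = P x' (sgn w')"
        have n1: "norm (sgn w') = 1" using w' by (simp add: norm_sgn)
        have yF: "y \<in> frontier \<Omega>"
          unfolding y_def by (intro entry_point_frontier interior_rays x'\<Omega> n1)
        have t: "r \<le> \<tau> x' (sgn w')"
        proof (rule le_exit_time)
          have "x' - r *\<^sub>R sgn w' \<in> cball x' r" using n1 r by (simp add: dist_norm)
          then show "x' - r *\<^sub>R sgn w' \<in> closure \<Omega>" using bx(1) closure_subset by blast
        qed (use r interior_rays[OF x'\<Omega> n1] in auto)
        \<comment> \<open>Chosen so that \<open>w' = (\<theta> / r) *\<^sub>R (x' - y)\<close>. The
          bounds \<open>r \<le> \<tau> x' (sgn w')\<close> and \<open>norm (x - y) \<le> R\<close>
          then keep the preimage \<open>w\<close> inside the unit ball.\<close>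
        define \<theta> where "\<theta> = r * norm w' / \<tau> x' (sgn w')"
        have \<theta>: "0 < \<theta>" "\<theta> < 1"
        proof -
          show "0 < \<theta>" using t r w' by (simp add: \<theta>_def)
          have "r * norm w' < r * 1" using w' r by (intro mult_strict_left_mono) auto
          then have "r * norm w' < \<tau> x' (sgn w')" using t by linarith
          then show "\<theta> < 1" using t r by (simp add: \<theta>_def)
        qed
        define w where "w = (\<theta> / R) *\<^sub>R (x - y)"
        have xy: "x \<noteq> y" using yF frontier_not_in x by auto
        have "P x (sgn (x - y)) = y \<and> \<tau> x (sgn (x - y)) = norm (x - y)"
        proof -
          have *: "x - norm (x - y) *\<^sub>R sgn (x - y) = y" using xy by (simp add: sgn_div_norm)
          then have "\<tau> x (sgn (x - y)) = norm (x - y)"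
            using xy yF x by (intro exit_timeI interior_rays) (auto simp: norm_sgn)
          then show ?thesis using * by (simp add: entry_point_def)
        qed
        moreover have sw: "sgn w = sgn (x - y)"
          using \<theta> R by (simp add: w_def sgn_scaleR)
        ultimately have Pw: "P x (sgn w) = y" "\<tau> x (sgn w) = norm (x - y)" by auto
        have nw: "norm w < 1"
        proof -
          have "norm w = \<theta> * (norm (x - y) / R)" using \<theta> R by (simp add: w_def)
          also have "\<dots> \<le> \<theta> * 1"
            using R(1) R(2)[OF frontier_in_closure[OF yF]] \<theta> by (intro mult_left_mono) auto
          finally show ?thesis using \<theta> by simp
        qed
        have w0: "w \<noteq> 0" using xy \<theta> R by (simp add: w_def)
        have "w \<in> ?S"
          using nw w0 Pw w'(3) by (auto simp: unit_cone_def seen_def y_def norm_sgn)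
        moreover have "F w = w'"
        proof -
          have "gauge_at x w = \<theta> / R" using Pw xy \<theta> R by (simp add: gauge_at_def w_def)
          then have "F w = (\<theta> / r) *\<^sub>R (x' - y)"
            using R by (simp add: F_def w_def algebra_simps)
          also have "x' - y = \<tau> x' (sgn w') *\<^sub>R sgn w'" by (simp add: y_def entry_point_def)
          finally show ?thesis using t r w' by (simp add: \<theta>_def sgn_div_norm)
        qed
        ultimately show "w' \<in> F ` ?S" by blast
      qed
    qed
    then show "measure sphere_measure (seen x' E)
        \<le> (2 * L * DIM('a)) ^ DIM('a) * measure sphere_measure (seen x E)"
      using sets_seen[OF _ E] x x'\<Omega> by (simp add: measure_sphere_measure mult.left_commute mult_left_mono)
  qed
qed


lemma tendsto_entry_point:
  assumes "x \<in> \<Omega>" "\<And>n. X n \<in> \<Omega>" "X \<longlonglongrightarrow> x" "norm \<xi> = 1"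
  shows "(\<lambda>n. P (X n) \<xi>) \<longlonglongrightarrow> P x \<xi>"
proof -
  have "(\<lambda>n. (X n, \<xi>)) \<longlonglongrightarrow> (x, \<xi>)" by (intro tendsto_intros assms)
  then show ?thesis
    using continuous_on_tendsto_compose[OF continuous_entry_point, of "\<lambda>n. (X n, \<xi>)" "(x, \<xi>)" sequentially]
      assms interior_rays by auto
qed

text \<open>
  The relative boundary of \<open>K\<close> may be seen under a positive solid angle, so the indicator functions
  need not converge almost everywhere. Directions in which \<open>K\<close> is lost are seen from the nearby
  point in a small neighbourhood of \<open>K\<close>, and this contribution is bounded by comparing solid angles.
\<close>

lemma seen_continuous:
  assumes x: "x \<in> \<Omega>" "\<And>n. X n \<in> \<Omega>" "X \<longlonglongrightarrow> x" and K: "closed K"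
  shows "(\<lambda>n. measure sphere_measure (sym_diff (seen (X n) K) (seen x K))) \<longlonglongrightarrow> 0"
\<comment> \<open>\<open>infdist\<close> to the empty set is 0 by convention, so the sets
  \<open>U k\<close> below would not shrink to \<open>K\<close>.\<close>
proof (cases "K = {}")
  case False
  let ?\<sigma> = "measure (sphere_measure :: 'a measure)"
  have Kb: "K \<in> sets borel" using K by auto
  have sets: "seen y E \<in> sets sphere_measure" if "y \<in> \<Omega>" "E \<in> sets borel" for y E
    using that by (intro sets_sphere_measure sets_seen)
  obtain C \<delta> where C: "0 < \<delta>" "0 < C" "\<And>x' E. x' \<in> ball x \<delta> \<Longrightarrow> E \<in> sets borel \<Longrightarrow>
      ?\<sigma> (seen x' E) \<le> C * ?\<sigma> (seen x E)"
    using solid_angle_comparable[OF x(1)] by blast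
  define U where "U k = {y. infdist y K < 1 / Suc k}" for k :: nat
  have U: "open (U k)" for k
    unfolding U_def by (intro open_Collect_less continuous_intros)
  have KU: "K \<subseteq> U k" for k by (auto simp: U_def)
  have UK: "(\<lambda>k. ?\<sigma> (seen x (U k - K))) \<longlonglongrightarrow> 0"
  proof (rule sphere.measure_eventually_notin)
    fix \<xi> :: 'a assume "\<xi> \<in> space sphere_measure"
    show "\<forall>\<^sub>F k in sequentially. \<xi> \<notin> seen x (U k - K)"
    proof (cases "P x \<xi> \<in> K")
      case False
      then have "0 < infdist (P x \<xi>) K"
        using in_closed_iff_infdist_zero[OF K \<open>K \<noteq> {}\<close>, of "P x \<xi>"] infdist_nonneg[of "P x \<xi>" K] by (simp add: less_le)
      moreover have "(\<lambda>k. 1 / real (Suc k)) \<longlonglongrightarrow> 0"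
        using LIMSEQ_inverse_real_of_nat by (simp add: inverse_eq_divide)
      ultimately have "\<forall>\<^sub>F k in sequentially. 1 / real (Suc k) < infdist (P x \<xi>) K"
        by (rule order_tendstoD(2)[rotated])
      then show ?thesis by eventually_elim (auto simp: seen_def U_def)
    qed (simp add: seen_def)
  qed (use sets x U Kb in \<open>auto intro!: borel_open\<close>)
  show ?thesis
  proof (rule order_tendstoI)
    fix e :: real assume e: "0 < e"
    then have e4: "0 < e / 4" by simp
    \<comment> \<open>The neighbourhood is fixed before \<open>n\<close>; the factor
      \<open>C\<close> anticipates that it will be viewed from the moving point.\<close>
    obtain k where k: "?\<sigma> (seen x (U k - K)) < e / (2 * C)"
      using order_tendstoD(2)[OF UK, of "e / (2 * C)"] e C eventually_sequentially by auto
    \<comment> \<open>Directions gained: the complement of \<open>K\<close> is open, so pointwise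
      convergence of the entry points suffices.\<close>
    have lim1: "(\<lambda>n. ?\<sigma> (seen (X n) K - seen x K)) \<longlonglongrightarrow> 0"
    proof (rule sphere.measure_eventually_notin)
      fix \<xi> :: 'a assume \<xi>: "\<xi> \<in> space sphere_measure"
      show "\<forall>\<^sub>F n in sequentially. \<xi> \<notin> seen (X n) K - seen x K"
      proof (cases "P x \<xi> \<in> K")
        case False
        then have "\<forall>\<^sub>F n in sequentially. P (X n) \<xi> \<in> - K"
          using \<xi> K by (intro topological_tendstoD[OF tendsto_entry_point[OF x]]) auto
        then show ?thesis by eventually_elim (auto simp: seen_def)
      qed (use \<xi> in \<open>simp add: seen_def\<close>)
    qed (use sets x Kb in auto)
    have lim2: "(\<lambda>n. ?\<sigma> (seen x K - seen (X n) (U k))) \<longlonglongrightarrow> 0"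
    proof (rule sphere.measure_eventually_notin)
      fix \<xi> :: 'a assume \<xi>: "\<xi> \<in> space sphere_measure"
      show "\<forall>\<^sub>F n in sequentially. \<xi> \<notin> seen x K - seen (X n) (U k)"
      proof (cases "P x \<xi> \<in> K")
        case True
        then have "\<forall>\<^sub>F n in sequentially. P (X n) \<xi> \<in> U k"
          using \<xi> U KU by (intro topological_tendstoD[OF tendsto_entry_point[OF x]]) auto
        then show ?thesis by eventually_elim (use \<xi> in \<open>auto simp: seen_def\<close>)
      qed (simp add: seen_def)
    qed (use sets x Kb U in \<open>auto intro!: borel_open\<close>)
    have ev: "\<forall>\<^sub>F n in sequentially. X n \<in> ball x \<delta>"
      using C by (intro topological_tendstoD[OF x(3)]) auto
    show "\<forall>\<^sub>F n in sequentially. ?\<sigma> (sym_diff (seen (X n) K) (seen x K)) < e"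
      using order_tendstoD(2)[OF lim1 e4] order_tendstoD(2)[OF lim2 e4] ev
    proof eventually_elim
      case (elim n)
      let ?A = "seen (X n) K - seen x K" and ?B = "seen x K - seen (X n) (U k)"
      let ?D = "seen (X n) (U k - K)"
      have UKb: "U k - K \<in> sets borel" using U Kb by (auto intro: borel_open)
      have s: "?A \<in> sets sphere_measure" "?B \<in> sets sphere_measure" "?D \<in> sets sphere_measure"
        using sets x Kb U UKb by (auto intro!: borel_open)
      \<comment> \<open>Followed back from \<open>X n\<close>, a lost direction leads either outside
        \<open>U k\<close>, which \<open>?B\<close> counts, or into \<open>U k - K\<close>, which
        \<open>?D\<close> counts.\<close>
      have "?\<sigma> (sym_diff (seen (X n) K) (seen x K)) \<le> ?\<sigma> (?A \<union> ?B \<union> ?D)"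
        by (rule sphere.finite_measure_mono) (use s in \<open>auto simp: seen_def\<close>)
      also have "\<dots> \<le> ?\<sigma> ?A + ?\<sigma> ?B + ?\<sigma> ?D"
        using measure_Un_le[of "?A \<union> ?B" sphere_measure ?D] measure_Un_le[of ?A sphere_measure ?B] s by auto
      also have "?\<sigma> ?D \<le> C * ?\<sigma> (seen x (U k - K))"
        using elim(3) UKb by (rule C(3))
      also have "C * ?\<sigma> (seen x (U k - K)) < e / 2"
        using k C by (simp add: field_simps)
      finally show ?case using elim by simp
    qed
  qed (simp add: order_less_le_trans[OF _ measure_nonneg])
qed (simp add: seen_def)

end

section \<open>Transport along characteristics\<close>

text \<open>A limsup form of Fatou's lemma for functions that may fail to converge: the excess of
  \<open>u n\<close> over \<open>w\<close> is bounded and tends to 0, so dominated convergence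
  applies to it.\<close>

lemma (in finite_measure) eventually_integral_le:
  fixes u :: "nat \<Rightarrow> 'a \<Rightarrow> real"
  assumes u: "\<And>n. u n \<in> borel_measurable M" "\<And>n x. x \<in> space M \<Longrightarrow> \<bar>u n x\<bar> \<le> B"
    and w: "integrable M w" "\<And>x. x \<in> space M \<Longrightarrow> 0 \<le> w x"
    and ev: "AE x in M. \<forall>\<epsilon>>0. \<forall>\<^sub>F n in sequentially. u n x \<le> w x + \<epsilon>"
    and \<epsilon>: "0 < \<epsilon>"
  shows "\<forall>\<^sub>F n in sequentially. integral\<^sup>L M (u n) \<le> integral\<^sup>L M w + \<epsilon>"
proof -
  have [measurable]: "u n \<in> borel_measurable M" "w \<in> borel_measurable M" for n using u w by auto
  have ui: "integrable M (u n)" for n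
    by (rule integrable_const_bound[where B=B]) (use u in auto)
  have bd: "norm (max (u n x - w x) 0) \<le> B" if "x \<in> space M" for n x
    using u(2)[OF that, of n] w(2)[OF that] by (auto simp: max_def abs_le_iff)
  have mi: "integrable M (\<lambda>x. max (u n x - w x) 0)" for n
    by (rule integrable_const_bound[where B=B]) (use bd in auto)
  have "(\<lambda>n. integral\<^sup>L M (\<lambda>x. max (u n x - w x) 0)) \<longlonglongrightarrow> integral\<^sup>L M (\<lambda>x. 0)"
  proof (rule integral_dominated_convergence[where w="\<lambda>x. B"])
    show "AE x in M. (\<lambda>n. max (u n x - w x) 0) \<longlonglongrightarrow> 0"
      using ev
    proof eventually_elim
      case (elim x)
      show ?case
      proof (rule LIMSEQ_I)
        fix r :: real assume "0 < r"
        with elim have "\<forall>\<^sub>F n in sequentially. u n x \<le> w x + r / 2" by simp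
        then have "\<forall>\<^sub>F n in sequentially. norm (max (u n x - w x) 0 - 0) < r"
          by eventually_elim (use \<open>0 < r\<close> in \<open>auto simp: max_def\<close>)
        then show "\<exists>no. \<forall>n\<ge>no. norm (max (u n x - w x) 0 - 0) < r"
          by (simp add: eventually_sequentially)
      qed
    qed
  qed (use bd in auto)
  then have "\<forall>\<^sub>F n in sequentially. integral\<^sup>L M (\<lambda>x. max (u n x - w x) 0) < \<epsilon>"
    using \<epsilon> by (intro order_tendstoD(2)) auto
  then show ?thesis
  proof eventually_elim
    case (elim n)
    have "integral\<^sup>L M (u n) \<le> integral\<^sup>L M (\<lambda>x. w x + max (u n x - w x) 0)"
      by (rule integral_mono[OF ui]) (use w mi in auto)
    also have "\<dots> = integral\<^sup>L M w + integral\<^sup>L M (\<lambda>x. max (u n x - w x) 0)"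
      by (rule Bochner_Integration.integral_add[OF w(1) mi])
    finally show ?case using elim by simp
  qed
qed

lemma lebesgue_on_Icc_finite: "finite_measure (lebesgue_on {a..b::real})"
  by standard (simp add: emeasure_restrict_space emeasure_lborel_Icc_eq)

lemma integrable_lebesgue_on_Icc:
  fixes h :: "real \<Rightarrow> real"
  assumes "h \<in> borel_measurable (lebesgue_on {a..b})" "\<And>s. s \<in> {a..b} \<Longrightarrow> \<bar>h s\<bar> \<le> B"
  shows "integrable (lebesgue_on {a..b}) h" "h integrable_on {a..b}"
    "integral\<^sup>L (lebesgue_on {a..b}) h = integral {a..b} h"
proof -
  show i: "integrable (lebesgue_on {a..b}) h"
    by (rule finite_measure.integrable_const_bound[OF lebesgue_on_Icc_finite, where B=B])
       (use assms in auto)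
  show "h integrable_on {a..b}" using integrable_on_lebesgue_on[OF i] by simp
  show "integral\<^sup>L (lebesgue_on {a..b}) h = integral {a..b} h"
    using lebesgue_integral_eq_integral[OF i] by simp
qed

lemma borel_measurable_lebesgue_on:
  fixes h :: "real \<Rightarrow> real"
  shows "h \<in> borel_measurable borel \<Longrightarrow> h \<in> borel_measurable (lebesgue_on S)"
  by (intro measurable_restrict_space1 measurable_completion) simp

lemma AE_lebesgue_on_finite:
  fixes S :: "real set"
  assumes "finite S" "\<And>s. s \<in> {a..b} \<Longrightarrow> s \<notin> S \<Longrightarrow> Q s"
  shows "AE s in lebesgue_on {a..b}. Q s"
proof -
  have "AE s in lebesgue. s \<notin> S"
    using assms(1) by (intro AE_not_in) (simp add: negligible_iff_null_sets[symmetric] negligible_finite)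
  then show ?thesis
    by (subst AE_restrict_space_iff) (use assms(2) in \<open>auto elim!: eventually_mono\<close>)
qed

text \<open>\<open>A'\<close> stands for \<open>A \<union> \<gamma>\<close>; its closedness makes
  the solid angle under which it is seen continuous. By equality of the closures, a point of
  \<open>\<Omega>\<close> outside \<open>\<Omega>\<^sub>0\<close> lies on
  \<open>frontier \<Omega>\<^sub>0\<close>, so within \<open>\<Omega>\<close> each line misses
  \<open>\<Omega>\<^sub>0\<close> at finitely many parameters.\<close>

locale transport = convex_domain \<Omega> for \<Omega> :: "'a::euclidean_space set" +
  fixes \<Omega>\<^sub>0 A' :: "'a set" and l :: "'a \<Rightarrow> 'a \<Rightarrow> nat" and t :: "'a \<Rightarrow> 'a \<Rightarrow> nat \<Rightarrow> real"
    and \<mu>\<^sub>t \<mu>\<^sub>s :: "'a \<Rightarrow> real" and p :: "'a \<Rightarrow> 'a \<Rightarrow> 'a \<Rightarrow> real"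
    and I :: real and f\<^sub>0 f :: "'a \<times> 'a \<Rightarrow> real"
  assumes C1: "C1_boundary \<Omega>"
    and open_sub: "open \<Omega>\<^sub>0" and sub_dom: "\<Omega>\<^sub>0 \<subseteq> \<Omega>" and closure_sub: "closure \<Omega>\<^sub>0 = closure \<Omega>"
    and gen_convex: "generalized_convexity \<Omega> \<Omega>\<^sub>0 l t"
    and coeff: "admissible_coefficients \<Omega>\<^sub>0 \<mu>\<^sub>t \<mu>\<^sub>s p"
    and sol: "transport_solution \<Omega> \<Omega>\<^sub>0 l t \<mu>\<^sub>t \<mu>\<^sub>s p f\<^sub>0 f"
    and closed_A: "closed A'"
    and f0: "\<And>x \<xi>. (x, \<xi>) \<in> inflow_boundary \<Omega> \<Longrightarrow> f\<^sub>0 (x, \<xi>) = I * indicator A' x"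
begin

section \<open>Bounds of the data and crossings of the interfaces\<close>

lemma \<mu>t_nonneg: "0 \<le> \<mu>\<^sub>t x" and \<mu>s_nonneg: "0 \<le> \<mu>\<^sub>s x" and \<mu>s_le: "\<mu>\<^sub>s x \<le> \<mu>\<^sub>t x"
  and \<mu>_outside: "x \<notin> \<Omega>\<^sub>0 \<Longrightarrow> \<mu>\<^sub>t x = 0" "x \<notin> \<Omega>\<^sub>0 \<Longrightarrow> \<mu>\<^sub>s x = 0"
  and \<mu>t_cont: "continuous_on \<Omega>\<^sub>0 \<mu>\<^sub>t" and \<mu>s_cont: "continuous_on \<Omega>\<^sub>0 \<mu>\<^sub>s"
proof -
  note c = coeff[unfolded admissible_coefficients_def]
  show "0 \<le> \<mu>\<^sub>t x" "0 \<le> \<mu>\<^sub>s x" "continuous_on \<Omega>\<^sub>0 \<mu>\<^sub>t" "continuous_on \<Omega>\<^sub>0 \<mu>\<^sub>s" using c by auto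
  show o: "x \<notin> \<Omega>\<^sub>0 \<Longrightarrow> \<mu>\<^sub>t x = 0" "x \<notin> \<Omega>\<^sub>0 \<Longrightarrow> \<mu>\<^sub>s x = 0" using c by auto
  show "\<mu>\<^sub>s x \<le> \<mu>\<^sub>t x" using c o by (cases "x \<in> \<Omega>\<^sub>0") auto
qed

lemma ex_bounds:
  "\<exists>m. 0 < m \<and> (\<forall>x. \<mu>\<^sub>t x \<le> m)"
  "\<exists>m. 0 < m \<and> (\<forall>x. \<forall>\<xi>\<in>sphere 0 1. \<forall>\<xi>'\<in>sphere 0 1. p x \<xi> \<xi>' \<le> m)"
  "\<exists>m. 0 < m \<and> (\<forall>z\<in>phase_domain \<Omega>. \<bar>f z\<bar> \<le> m)"
  "\<exists>r. 0 < r \<and> (\<forall>x\<in>closure \<Omega>. \<forall>s\<ge>r. \<forall>\<xi>. norm \<xi> = 1 \<longrightarrow> x - s *\<^sub>R \<xi> \<notin> closure \<Omega>)"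
proof -
  have "bounded (range \<mu>\<^sub>t)" "bounded (f ` phase_domain \<Omega>)"
    using coeff sol unfolding admissible_coefficients_def transport_solution_def by blast+
  then obtain m m' where "0 < m" "\<And>x. \<bar>\<mu>\<^sub>t x\<bar> \<le> m" "0 < m'" "\<And>z. z \<in> phase_domain \<Omega> \<Longrightarrow> \<bar>f z\<bar> \<le> m'"
    unfolding bounded_pos by auto
  then show "\<exists>m. 0 < m \<and> (\<forall>x. \<mu>\<^sub>t x \<le> m)" "\<exists>m. 0 < m \<and> (\<forall>z\<in>phase_domain \<Omega>. \<bar>f z\<bar> \<le> m)"
    by (auto simp: abs_le_iff)
  obtain m where m: "\<forall>x. \<forall>\<xi>\<in>sphere 0 1. \<forall>\<xi>'\<in>sphere 0 1. p x \<xi> \<xi>' \<le> m"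
    using coeff unfolding admissible_coefficients_def by blast
  show "\<exists>m. 0 < m \<and> (\<forall>x. \<forall>\<xi>\<in>sphere 0 1. \<forall>\<xi>'\<in>sphere 0 1. p x \<xi> \<xi>' \<le> m)"
    by (intro exI[of _ "max m 1"]) (use m in \<open>auto simp: le_max_iff_disj\<close>)
  obtain b :: 'a where "b \<in> Basis" using nonempty_Basis by blast
  then show "\<exists>r. 0 < r \<and> (\<forall>x\<in>closure \<Omega>. \<forall>s\<ge>r. \<forall>\<xi>. norm \<xi> = 1 \<longrightarrow> x - s *\<^sub>R \<xi> \<notin> closure \<Omega>)"
    using exits[of b] by simp
qed

text \<open>The bounds \<open>m\<^sub>t\<close>, \<open>m\<^sub>p\<close> and
  \<open>m\<^sub>f\<close> are strictly positive, as they occur in denominators when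
  \<open>\<epsilon>\<close> is split.\<close>

definition "m\<^sub>t = (SOME m. 0 < m \<and> (\<forall>x. \<mu>\<^sub>t x \<le> m))"
definition "m\<^sub>p = (SOME m. 0 < m \<and> (\<forall>x. \<forall>\<xi>\<in>sphere 0 1. \<forall>\<xi>'\<in>sphere 0 1. p x \<xi> \<xi>' \<le> m))"
definition "m\<^sub>f = (SOME m. 0 < m \<and> (\<forall>z\<in>phase_domain \<Omega>. \<bar>f z\<bar> \<le> m))"
text \<open>A length common to all backward rays. Line integrals run over the fixed interval
  \<open>{0..R}\<close> instead of up to a varying exit time, which is harmless because the
  integrands vanish outside \<open>\<Omega>\<close>.\<close>

definition "R = (SOME r. 0 < r \<and> (\<forall>x\<in>closure \<Omega>. \<forall>s\<ge>r. \<forall>\<xi>. norm \<xi> = 1 \<longrightarrow> x - s *\<^sub>R \<xi> \<notin> closure \<Omega>))"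

lemma mt: "0 < m\<^sub>t" "\<mu>\<^sub>t x \<le> m\<^sub>t" "\<mu>\<^sub>s x \<le> m\<^sub>t"
  using someI_ex[OF ex_bounds(1), folded m\<^sub>t_def] \<mu>s_le[of x] by (auto intro: order_trans)

lemma mp: "0 < m\<^sub>p" "norm \<xi> = 1 \<Longrightarrow> norm \<xi>' = 1 \<Longrightarrow> p x \<xi> \<xi>' \<le> m\<^sub>p"
  and p_nonneg: "norm \<xi> = 1 \<Longrightarrow> norm \<xi>' = 1 \<Longrightarrow> 0 \<le> p x \<xi> \<xi>'"
proof -
  show "0 < m\<^sub>p" "norm \<xi> = 1 \<Longrightarrow> norm \<xi>' = 1 \<Longrightarrow> p x \<xi> \<xi>' \<le> m\<^sub>p"
    using someI_ex[OF ex_bounds(2), folded m\<^sub>p_def] by auto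
  show "norm \<xi> = 1 \<Longrightarrow> norm \<xi>' = 1 \<Longrightarrow> 0 \<le> p x \<xi> \<xi>'"
    using coeff unfolding admissible_coefficients_def by auto
qed

lemma mf: "0 < m\<^sub>f" "z \<in> phase_domain \<Omega> \<Longrightarrow> \<bar>f z\<bar> \<le> m\<^sub>f"
  using someI_ex[OF ex_bounds(3), folded m\<^sub>f_def] by auto

lemma R: "0 < R" "x \<in> closure \<Omega> \<Longrightarrow> norm \<xi> = 1 \<Longrightarrow> R \<le> s \<Longrightarrow> x - s *\<^sub>R \<xi> \<notin> closure \<Omega>"
  using someI_ex[OF ex_bounds(4), folded R_def] by auto

lemma interior_phase: "x \<in> \<Omega> \<Longrightarrow> norm \<xi> = 1 \<Longrightarrow> (x, \<xi>) \<in> phase_domain \<Omega>"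
  by (simp add: phase_domain_def)

lemma phase_rays: "z \<in> phase_domain \<Omega> \<Longrightarrow> z \<in> rays"
  using extended_phase_domain_eq[OF C1] by (auto simp: extended_phase_domain_def)

lemma exit_time_le_R: "(x, \<xi>) \<in> rays \<Longrightarrow> \<tau> x \<xi> \<le> R"
  using R(2)[of x \<xi> "\<tau> x \<xi>"] raysD[of x \<xi>] frontier_in_closure[OF entry_point_frontier, of x \<xi>]
  by (force simp: entry_point_def)

definition bad :: "'a \<Rightarrow> 'a \<Rightarrow> real set" where
  "bad x \<xi> = {s. x - s *\<^sub>R \<xi> \<in> frontier \<Omega>\<^sub>0}"

text \<open>Generalized convexity counts crossings on backward half-lines from points of
  \<open>\<Omega>\<close>, whereas \<open>x\<close> may lie on the boundary and \<open>s\<close> may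
  be negative. The line is therefore based at one of its points in \<open>\<Omega>\<close> and
  covered by the half-lines for \<open>\<xi>\<close> and \<open>- \<xi>\<close>.\<close>

lemma finite_bad:
  assumes "(x, \<xi>) \<in> rays"
  shows "finite (bad x \<xi>)"
proof -
  obtain c where c: "x + c *\<^sub>R \<xi> \<in> \<Omega>" using raysD[OF assms] by blast
  have fin: "finite {s. 0 \<le> s \<and> y - s *\<^sub>R \<eta> \<in> frontier \<Omega>\<^sub>0}" if "y \<in> \<Omega>" "norm \<eta> = 1" for y \<eta>
  proof (rule finite_subset)
    show "{s. 0 \<le> s \<and> y - s *\<^sub>R \<eta> \<in> frontier \<Omega>\<^sub>0} \<subseteq> t y \<eta> ` {1..l y \<eta>}"
      using gen_convex that unfolding generalized_convexity_def by fastforce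
  qed simp
  let ?y = "x + c *\<^sub>R \<xi>"
  have "bad x \<xi> \<subseteq> (\<lambda>s. s - c) ` {s. 0 \<le> s \<and> ?y - s *\<^sub>R \<xi> \<in> frontier \<Omega>\<^sub>0}
      \<union> (\<lambda>s. - s - c) ` {s. 0 \<le> s \<and> ?y - s *\<^sub>R (- \<xi>) \<in> frontier \<Omega>\<^sub>0}"
  proof
    fix s assume s: "s \<in> bad x \<xi>"
    show "s \<in> (\<lambda>s. s - c) ` {s. 0 \<le> s \<and> ?y - s *\<^sub>R \<xi> \<in> frontier \<Omega>\<^sub>0}
      \<union> (\<lambda>s. - s - c) ` {s. 0 \<le> s \<and> ?y - s *\<^sub>R (- \<xi>) \<in> frontier \<Omega>\<^sub>0}"
    proof (cases "0 \<le> s + c")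
      case True
      then have "s + c \<in> {s. 0 \<le> s \<and> ?y - s *\<^sub>R \<xi> \<in> frontier \<Omega>\<^sub>0}"
        using s by (simp add: bad_def algebra_simps)
      then show ?thesis by (intro UnI1 image_eqI[of _ _ "s + c"]) auto
    next
      case False
      then have "- s - c \<in> {s. 0 \<le> s \<and> ?y - s *\<^sub>R (- \<xi>) \<in> frontier \<Omega>\<^sub>0}"
        using s by (simp add: bad_def algebra_simps)
      then show ?thesis by (intro UnI2 image_eqI[of _ _ "- s - c"]) auto
    qed
  qed
  then show ?thesis
    by (rule finite_subset) (use fin[OF c, of \<xi>] fin[OF c, of "- \<xi>"] raysD(1)[OF assms] in simp)
qed

lemma not_bad: "s \<notin> bad x \<xi> \<Longrightarrow> x - s *\<^sub>R \<xi> \<in> \<Omega>\<^sub>0 \<or> x - s *\<^sub>R \<xi> \<in> - closure \<Omega>\<^sub>0"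
  using open_sub by (auto simp: bad_def frontier_def interior_open)

lemma \<mu>t_isCont: "x \<in> \<Omega>\<^sub>0 \<or> x \<in> - closure \<Omega>\<^sub>0 \<Longrightarrow> isCont \<mu>\<^sub>t x"
  and \<mu>s_isCont: "x \<in> \<Omega>\<^sub>0 \<or> x \<in> - closure \<Omega>\<^sub>0 \<Longrightarrow> isCont \<mu>\<^sub>s x"
proof -
  have ev: "\<forall>\<^sub>F y in nhds x. y \<in> - closure \<Omega>\<^sub>0" if "x \<in> - closure \<Omega>\<^sub>0"
    using that by (intro eventually_nhds_in_open) auto
  have *: "isCont \<mu> x" if "\<And>y. y \<notin> \<Omega>\<^sub>0 \<Longrightarrow> \<mu> y = 0" "x \<in> - closure \<Omega>\<^sub>0" for \<mu> :: "'a \<Rightarrow> real"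
  proof -
    have "\<forall>\<^sub>F y in nhds x. \<mu> y = 0"
      using ev[OF that(2)] by eventually_elim (use that(1) closure_subset in auto)
    then show ?thesis by (subst isCont_cong[where g="\<lambda>_. 0"]) auto
  qed
  show "x \<in> \<Omega>\<^sub>0 \<or> x \<in> - closure \<Omega>\<^sub>0 \<Longrightarrow> isCont \<mu>\<^sub>t x" "x \<in> \<Omega>\<^sub>0 \<or> x \<in> - closure \<Omega>\<^sub>0 \<Longrightarrow> isCont \<mu>\<^sub>s x"
    using \<mu>t_cont \<mu>s_cont open_sub *[OF \<mu>_outside(1)] *[OF \<mu>_outside(2)]
    by (auto simp: continuous_on_eq_continuous_at)
qed

lemma \<mu>_borel: "\<mu>\<^sub>t \<in> borel_measurable borel" "\<mu>\<^sub>s \<in> borel_measurable borel"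
proof -
  have "(\<lambda>x. indicator \<Omega>\<^sub>0 x *\<^sub>R \<mu>\<^sub>t x) \<in> borel_measurable borel"
    "(\<lambda>x. indicator \<Omega>\<^sub>0 x *\<^sub>R \<mu>\<^sub>s x) \<in> borel_measurable borel"
    by (rule borel_measurable_continuous_on_indicator[OF borel_open[OF open_sub] \<mu>t_cont],
        rule borel_measurable_continuous_on_indicator[OF borel_open[OF open_sub] \<mu>s_cont])
  moreover have "(\<lambda>x. indicator \<Omega>\<^sub>0 x *\<^sub>R \<mu>\<^sub>t x) = \<mu>\<^sub>t" "(\<lambda>x. indicator \<Omega>\<^sub>0 x *\<^sub>R \<mu>\<^sub>s x) = \<mu>\<^sub>s"
    using \<mu>_outside by (auto simp: fun_eq_iff indicator_def)
  ultimately show "\<mu>\<^sub>t \<in> borel_measurable borel" "\<mu>\<^sub>s \<in> borel_measurable borel" by simp_all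
qed

lemma \<mu>_line_borel:
  "(\<lambda>s. \<mu>\<^sub>t (x - s *\<^sub>R \<xi>)) \<in> borel_measurable borel" "(\<lambda>s. \<mu>\<^sub>s (x - s *\<^sub>R \<xi>)) \<in> borel_measurable borel"
  using \<mu>_borel by measurable

lemma \<mu>t_integrable:
  "(\<lambda>r. \<mu>\<^sub>t (x - r *\<^sub>R \<xi>)) integrable_on {a..b}"
  "integral\<^sup>L (lebesgue_on {a..b}) (\<lambda>r. \<mu>\<^sub>t (x - r *\<^sub>R \<xi>)) = integral {a..b} (\<lambda>r. \<mu>\<^sub>t (x - r *\<^sub>R \<xi>))"
  by (rule integrable_lebesgue_on_Icc[where B="m\<^sub>t"];
      use \<mu>t_nonneg mt in \<open>auto intro!: borel_measurable_lebesgue_on \<mu>_line_borel\<close>)+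

section \<open>Optical depth of a backward path\<close>

definition depth :: "'a \<Rightarrow> 'a \<Rightarrow> real \<Rightarrow> real" where
  "depth x \<xi> s = integral {0..s} (\<lambda>r. \<mu>\<^sub>t (x - r *\<^sub>R \<xi>))"

lemma depth_0 [simp]: "depth x \<xi> 0 = 0"
  by (simp add: depth_def)

lemma depth_nonneg: "0 \<le> depth x \<xi> s"
  unfolding depth_def by (intro integral_nonneg \<mu>t_integrable) (simp add: \<mu>t_nonneg)

lemma depth_le: "0 \<le> s \<Longrightarrow> depth x \<xi> s \<le> m\<^sub>t * s"
  unfolding depth_def
  using integral_le[of "\<lambda>r. \<mu>\<^sub>t (x - r *\<^sub>R \<xi>)" "{0..s}" "\<lambda>_. m\<^sub>t"] \<mu>t_integrable(1)[of x \<xi> 0 s] mt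
    integrable_const_ivl[of m\<^sub>t 0 s]
  by (simp add: mult.commute)

lemma continuous_on_depth: "continuous_on {0..b} (depth x \<xi>)"
  unfolding depth_def[abs_def] by (rule indefinite_integral_continuous_1[OF \<mu>t_integrable(1)])

lemma DERIV_depth:
  assumes "0 < s" "s \<notin> bad x \<xi>"
  shows "(depth x \<xi> has_real_derivative \<mu>\<^sub>t (x - s *\<^sub>R \<xi>)) (at s)"
proof -
  have "isCont (\<lambda>r. \<mu>\<^sub>t (x - r *\<^sub>R \<xi>)) s"
    by (rule isCont_o2[where g=\<mu>\<^sub>t]) (auto intro!: continuous_intros \<mu>t_isCont not_bad[OF assms(2)])
  then have "((\<lambda>u. integral {0..u} (\<lambda>r. \<mu>\<^sub>t (x - r *\<^sub>R \<xi>))) has_vector_derivative \<mu>\<^sub>t (x - s *\<^sub>R \<xi>))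
      (at s within ({0..s + 1} - {}))"
    by (intro integral_has_vector_derivative_continuous_at \<mu>t_integrable)
       (use assms in \<open>auto intro: continuous_at_imp_continuous_within\<close>)
  moreover have "at s within ({0..s + 1} - {}) = at s"
    using assms by (intro at_within_interior) auto
  ultimately show ?thesis
    by (simp add: depth_def[abs_def] has_real_derivative_iff_has_vector_derivative)
qed

text \<open>\<open>\<mu>\<^sub>t\<close> vanishes after the exit. This restores the exit time in
  formulas written with \<open>R\<close>.\<close>

lemma depth_beyond:
  assumes "(x, \<xi>) \<in> rays" "\<tau> x \<xi> \<le> s"
  shows "depth x \<xi> s = depth x \<xi> (\<tau> x \<xi>)"
proof -
  have t0: "0 \<le> \<tau> x \<xi>" using exit_time_nonneg raysD[OF assms(1)] by blast
  have "integral {\<tau> x \<xi>..s} (\<lambda>r. \<mu>\<^sub>t (x - r *\<^sub>R \<xi>)) = integral {\<tau> x \<xi>..s} (\<lambda>r. 0)"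
  proof (rule integral_spike[of "{\<tau> x \<xi>}"])
    fix r assume r: "r \<in> {\<tau> x \<xi>..s} - {\<tau> x \<xi>}"
    then have "x - r *\<^sub>R \<xi> \<notin> closure \<Omega>" using le_exit_time[OF assms(1), of r] t0 by force
    then show "0 = \<mu>\<^sub>t (x - r *\<^sub>R \<xi>)" using \<mu>_outside sub_dom closure_subset[of \<Omega>] by auto
  qed auto
  then show ?thesis
    using Henstock_Kurzweil_Integration.integral_combine[OF t0 assms(2) \<mu>t_integrable(1)[of x \<xi>]]
    by (simp add: depth_def)
qed

text \<open>The integrands converge wherever the limit line does not cross an interface, hence
  almost everywhere, and \<open>m\<^sub>t\<close> dominates them. It does not matter where the
  approximating lines cross.\<close>

lemma depth_tendsto:
  assumes r: "(x, \<xi>) \<in> rays" and lim: "X \<longlonglongrightarrow> x" "\<Xi> \<longlonglongrightarrow> \<xi>"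
  shows "(\<lambda>n. depth (X n) (\<Xi> n) s) \<longlonglongrightarrow> depth x \<xi> s"
proof -
  have "(\<lambda>n. integral\<^sup>L (lebesgue_on {0..s}) (\<lambda>r. \<mu>\<^sub>t (X n - r *\<^sub>R \<Xi> n)))
      \<longlonglongrightarrow> integral\<^sup>L (lebesgue_on {0..s}) (\<lambda>r. \<mu>\<^sub>t (x - r *\<^sub>R \<xi>))"
  proof (rule integral_dominated_convergence[where w="\<lambda>_. m\<^sub>t"])
    show "AE r in lebesgue_on {0..s}. (\<lambda>n. \<mu>\<^sub>t (X n - r *\<^sub>R \<Xi> n)) \<longlonglongrightarrow> \<mu>\<^sub>t (x - r *\<^sub>R \<xi>)"
    proof (rule AE_lebesgue_on_finite[OF finite_bad[OF r]])
      fix r assume "r \<notin> bad x \<xi>"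
      then show "(\<lambda>n. \<mu>\<^sub>t (X n - r *\<^sub>R \<Xi> n)) \<longlonglongrightarrow> \<mu>\<^sub>t (x - r *\<^sub>R \<xi>)"
        by (intro isCont_tendsto_compose[OF \<mu>t_isCont[OF not_bad]] tendsto_intros lim)
    qed
    show "integrable (lebesgue_on {0..s}) (\<lambda>_. m\<^sub>t)"
      by (simp add: finite_measure.integrable_const[OF lebesgue_on_Icc_finite])
  qed (use \<mu>t_nonneg mt in \<open>auto intro!: borel_measurable_lebesgue_on \<mu>_line_borel\<close>)
  then show ?thesis by (simp add: \<mu>t_integrable(2) depth_def)
qed

section \<open>The scattering term along characteristics\<close>

definition scattering :: "'a \<Rightarrow> 'a \<Rightarrow> real" where
  "scattering x \<xi> = \<mu>\<^sub>s x * (\<integral>\<xi>'. p x \<xi> \<xi>' * f (x, \<xi>') \<partial>sphere_measure)"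

lemma phase_function:
  assumes x: "x \<in> \<Omega>\<^sub>0" and \<xi>: "norm \<xi> = 1"
  shows "integrable sphere_measure (p x \<xi>)" "(\<integral>\<xi>'. p x \<xi> \<xi>' \<partial>sphere_measure) = 1"
    "integrable sphere_measure (\<lambda>\<xi>'. p x \<xi> \<xi>' * f (x, \<xi>'))"
    "\<bar>\<integral>\<xi>'. p x \<xi> \<xi>' * f (x, \<xi>') \<partial>sphere_measure\<bar> \<le> m\<^sub>f"
proof -
  show one: "(\<integral>\<xi>'. p x \<xi> \<xi>' \<partial>sphere_measure) = 1"
    using coeff x \<xi> unfolding admissible_coefficients_def by auto
  \<comment> \<open>The Bochner integral of a non-integrable function is 0, so the value 1 forces
    integrability.\<close>
  then show i: "integrable sphere_measure (p x \<xi>)"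
    using not_integrable_integral_eq by fastforce
  show fi: "integrable sphere_measure (\<lambda>\<xi>'. p x \<xi> \<xi>' * f (x, \<xi>'))"
    using sol x \<xi> unfolding transport_solution_def by auto
  have "\<bar>\<integral>\<xi>'. p x \<xi> \<xi>' * f (x, \<xi>') \<partial>sphere_measure\<bar> \<le> (\<integral>\<xi>'. \<bar>p x \<xi> \<xi>' * f (x, \<xi>')\<bar> \<partial>sphere_measure)"
    by (rule integral_abs_bound)
  also have "\<dots> \<le> (\<integral>\<xi>'. p x \<xi> \<xi>' * m\<^sub>f \<partial>sphere_measure)"
  proof (rule integral_mono)
    fix \<xi>' :: 'a assume "\<xi>' \<in> space sphere_measure"
    then show "\<bar>p x \<xi> \<xi>' * f (x, \<xi>')\<bar> \<le> p x \<xi> \<xi>' * m\<^sub>f"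
      using p_nonneg[OF \<xi>, of \<xi>' x] mf(2)[OF interior_phase, of x \<xi>'] x sub_dom
      by (auto simp: abs_mult intro!: mult_left_mono)
  qed (use fi i in auto)
  finally show "\<bar>\<integral>\<xi>'. p x \<xi> \<xi>' * f (x, \<xi>') \<partial>sphere_measure\<bar> \<le> m\<^sub>f" using one by simp
qed

lemma scattering_bound: "norm \<xi> = 1 \<Longrightarrow> \<bar>scattering x \<xi>\<bar> \<le> \<mu>\<^sub>s x * m\<^sub>f"
  using phase_function(4)[of x \<xi>] \<mu>_outside(2)[of x] \<mu>s_nonneg[of x]
  by (cases "x \<in> \<Omega>\<^sub>0") (auto simp: scattering_def abs_mult intro!: mult_left_mono)

lemma scattering_outside: "x \<notin> \<Omega>\<^sub>0 \<Longrightarrow> scattering x \<xi> = 0"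
  by (simp add: scattering_def \<mu>_outside)

lemma solution_on_\<Omega>0:
  assumes "x \<in> \<Omega>\<^sub>0" "norm \<xi> = 1"
  shows "((\<lambda>s. f (x + s *\<^sub>R \<xi>, \<xi>)) has_real_derivative directional_derivative f x \<xi>) (at 0)"
    and "directional_derivative f x \<xi> = scattering x \<xi> - \<mu>\<^sub>t x * f (x, \<xi>)"
proof -
  have "(\<lambda>s. f (x + s *\<^sub>R \<xi>, \<xi>)) field_differentiable at 0"
    "directional_derivative f x \<xi> + \<mu>\<^sub>t x * f (x, \<xi>) = scattering x \<xi>"
    using sol assms unfolding transport_solution_def scattering_def by auto
  then show "((\<lambda>s. f (x + s *\<^sub>R \<xi>, \<xi>)) has_real_derivative directional_derivative f x \<xi>) (at 0)"
    "directional_derivative f x \<xi> = scattering x \<xi> - \<mu>\<^sub>t x * f (x, \<xi>)"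
    by (simp_all add: directional_derivative_def DERIV_deriv_iff_field_differentiable)
qed

lemma DERIV_solution_line:
  assumes "x - s *\<^sub>R \<xi> \<in> \<Omega>\<^sub>0" "norm \<xi> = 1"
  shows "((\<lambda>r. f (x - r *\<^sub>R \<xi>, \<xi>)) has_real_derivative
    \<mu>\<^sub>t (x - s *\<^sub>R \<xi>) * f (x - s *\<^sub>R \<xi>, \<xi>) - scattering (x - s *\<^sub>R \<xi>) \<xi>) (at s)"
proof -
  let ?D = "directional_derivative f (x - s *\<^sub>R \<xi>) \<xi>"
  have "((\<lambda>h. f (x - s *\<^sub>R \<xi> + h *\<^sub>R \<xi>, \<xi>)) has_real_derivative ?D) (at (s - s))"
    using solution_on_\<Omega>0(1)[OF assms] by simp
  then have "((\<lambda>r. f (x - s *\<^sub>R \<xi> + (s - r) *\<^sub>R \<xi>, \<xi>)) has_real_derivative ?D * (0 - 1)) (at s)"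
    by (rule DERIV_chain2) (auto intro!: derivative_eq_intros)
  then show ?thesis
    by (simp add: solution_on_\<Omega>0(2)[OF assms] algebra_simps)
qed

text \<open>The equation is read backwards: along a line the scattering term equals the directional
  derivative plus \<open>\<mu>\<^sub>t * f\<close>, and the derivative is continuous on segments
  between crossings by the definition of a solution. This gives measurability of the source before
  \<open>f\<close> is known to be regular across lines.\<close>

lemma scattering_line_continuous:
  assumes y: "x - s *\<^sub>R \<xi> \<in> \<Omega>\<^sub>0" and \<xi>: "norm \<xi> = 1"
  shows "isCont (\<lambda>r. scattering (x - r *\<^sub>R \<xi>) \<xi>) s"
proof -
  obtain e where e: "e > 0" "ball (x - s *\<^sub>R \<xi>) e \<subseteq> \<Omega>\<^sub>0" using open_sub y by (meson openE)
  define d where "d = e / 2"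
  have d: "0 < d" using e by (simp add: d_def)
  have near: "x - r *\<^sub>R \<xi> \<in> \<Omega>\<^sub>0" if "\<bar>r - s\<bar> \<le> d" for r
  proof -
    have "dist (x - s *\<^sub>R \<xi>) (x - r *\<^sub>R \<xi>) = \<bar>r - s\<bar>"
      using \<xi> by (simp add: dist_norm flip: scaleR_left_diff_distrib)
    then show ?thesis using that e d_def by (intro subsetD[OF e(2)]) simp
  qed
  \<comment> \<open>The base point is moved to parameter \<open>s - d\<close>, so that
    \<open>s\<close> falls into the interior of the first segment, which starts at
    \<open>t ?z \<xi> 0 = 0\<close> and is longer than \<open>2 * d\<close>.\<close>
  let ?z = "x - (s - d) *\<^sub>R \<xi>"
  have z: "?z \<in> \<Omega>\<^sub>0" "?z \<in> \<Omega>" using near[of "s - d"] d sub_dom by auto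
  have tz: "t ?z \<xi> 0 = 0" "1 \<le> l ?z \<xi>" "0 \<le> t ?z \<xi> 1" "?z - t ?z \<xi> 1 *\<^sub>R \<xi> \<in> frontier \<Omega>\<^sub>0"
    using gen_convex z(2) \<xi> unfolding generalized_convexity_def by auto
  have "?z - t ?z \<xi> 1 *\<^sub>R \<xi> = x - (s - d + t ?z \<xi> 1) *\<^sub>R \<xi>" by (simp add: algebra_simps)
  with tz(4) have "x - (s - d + t ?z \<xi> 1) *\<^sub>R \<xi> \<in> frontier \<Omega>\<^sub>0" by (simp only:)
  then have "x - (s - d + t ?z \<xi> 1) *\<^sub>R \<xi> \<notin> \<Omega>\<^sub>0"
    using open_sub by (simp add: frontier_def interior_open)
  have t1: "2 * d < t ?z \<xi> 1"
  proof (rule ccontr)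
    assume "\<not> 2 * d < t ?z \<xi> 1"
    then have "\<bar>s - d + t ?z \<xi> 1 - s\<bar> \<le> d" using tz(3) by linarith
    from near[OF this] \<open>x - (s - d + t ?z \<xi> 1) *\<^sub>R \<xi> \<notin> \<Omega>\<^sub>0\<close> show False by (rule notE[rotated])
  qed
  have "\<forall>x\<in>\<Omega>\<^sub>0. \<forall>\<xi>\<in>sphere 0 1. \<forall>j\<in>{1..l x \<xi>}.
      continuous_on {x - s *\<^sub>R \<xi> |s. t x \<xi> (j - 1) < s \<and> s < t x \<xi> j} (\<lambda>y. directional_derivative f y \<xi>)"
    using sol unfolding transport_solution_def by (elim conjE)
  from bspec[OF bspec[OF bspec[OF this z(1)], of \<xi>], of 1]
  have "continuous_on {?z - r *\<^sub>R \<xi> |r. t ?z \<xi> (1 - 1) < r \<and> r < t ?z \<xi> 1} (\<lambda>y. directional_derivative f y \<xi>)"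
    using \<xi> tz(2) by simp
  then have "continuous_on {s - d<..<s + d} (\<lambda>r. directional_derivative f (x - r *\<^sub>R \<xi>) \<xi>)"
  proof (rule continuous_on_compose2)
    show "(\<lambda>r. x - r *\<^sub>R \<xi>) ` {s - d<..<s + d} \<subseteq> {?z - r *\<^sub>R \<xi> |r. t ?z \<xi> (1 - 1) < r \<and> r < t ?z \<xi> 1}"
    proof clarify
      fix r assume "r \<in> {s - d<..<s + d}"
      then show "\<exists>r'. x - r *\<^sub>R \<xi> = ?z - r' *\<^sub>R \<xi> \<and> t ?z \<xi> (1 - 1) < r' \<and> r' < t ?z \<xi> 1"
        using tz t1 by (intro exI[of _ "r - (s - d)"]) (auto simp: algebra_simps)
    qed
  qed (intro continuous_intros)
  then have "isCont (\<lambda>r. directional_derivative f (x - r *\<^sub>R \<xi>) \<xi>) s"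
    using d by (simp add: continuous_on_eq_continuous_at)
  moreover have "isCont (\<lambda>r. f (x - r *\<^sub>R \<xi>, \<xi>)) s"
    by (rule DERIV_isCont[OF DERIV_solution_line[OF y \<xi>]])
  moreover have "isCont (\<lambda>r. \<mu>\<^sub>t (x - r *\<^sub>R \<xi>)) s"
    by (rule isCont_o2[where g=\<mu>\<^sub>t]) (use y in \<open>auto intro!: continuous_intros \<mu>t_isCont\<close>)
  ultimately have "isCont (\<lambda>r. directional_derivative f (x - r *\<^sub>R \<xi>) \<xi> + \<mu>\<^sub>t (x - r *\<^sub>R \<xi>) * f (x - r *\<^sub>R \<xi>, \<xi>)) s"
    by (intro continuous_intros)
  moreover have "\<forall>\<^sub>F r in nhds s. directional_derivative f (x - r *\<^sub>R \<xi>) \<xi> + \<mu>\<^sub>t (x - r *\<^sub>R \<xi>) * f (x - r *\<^sub>R \<xi>, \<xi>)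
      = scattering (x - r *\<^sub>R \<xi>) \<xi>"
  proof -
    have "\<forall>\<^sub>F r in nhds s. r \<in> {s - d<..<s + d}" using d by (intro eventually_nhds_in_open) auto
    then show ?thesis
      by eventually_elim (simp add: solution_on_\<Omega>0(2)[OF near \<xi>] abs_le_iff)
  qed
  ultimately show ?thesis by (simp add: isCont_cong)
qed

lemma scattering_line_borel:
  assumes \<xi>: "norm \<xi> = 1"
  shows "(\<lambda>s. scattering (x - s *\<^sub>R \<xi>) \<xi>) \<in> borel_measurable borel"
proof -
  let ?O = "(\<lambda>s. x - s *\<^sub>R \<xi>) -` \<Omega>\<^sub>0"
  have O: "open ?O" by (intro open_vimage open_sub continuous_intros)
  then have "(\<lambda>s. indicator ?O s *\<^sub>R scattering (x - s *\<^sub>R \<xi>) \<xi>) \<in> borel_measurable borel"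
    using scattering_line_continuous[OF _ \<xi>]
    by (intro borel_measurable_continuous_on_indicator borel_open)
       (auto simp: continuous_on_eq_continuous_at)
  also have "(\<lambda>s. indicator ?O s *\<^sub>R scattering (x - s *\<^sub>R \<xi>) \<xi>) = (\<lambda>s. scattering (x - s *\<^sub>R \<xi>) \<xi>)"
    by (auto simp: fun_eq_iff indicator_def scattering_outside)
  finally show ?thesis .
qed

section \<open>The equation in integrated form\<close>

definition source :: "'a \<Rightarrow> 'a \<Rightarrow> real \<Rightarrow> real" where
  "source x \<xi> s = exp (- depth x \<xi> s) * scattering (x - s *\<^sub>R \<xi>) \<xi>"

lemma depth_measurable: "depth x \<xi> \<in> borel_measurable (lebesgue_on {0..b})"
  by (intro continuous_imp_measurable_on_sets_lebesgue continuous_on_depth) simp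

lemma source_bound:
  assumes "norm \<xi> = 1"
  shows "\<bar>source x \<xi> s\<bar> \<le> m\<^sub>t * m\<^sub>f"
proof -
  have "\<bar>source x \<xi> s\<bar> \<le> 1 * (\<mu>\<^sub>s (x - s *\<^sub>R \<xi>) * m\<^sub>f)"
    unfolding source_def abs_mult
    by (rule mult_mono) (use scattering_bound[OF assms] depth_nonneg in auto)
  also have "\<dots> \<le> m\<^sub>t * m\<^sub>f" using mt(3) mf(1) by (simp add: mult_right_mono)
  finally show ?thesis .
qed

lemma source_measurable: "norm \<xi> = 1 \<Longrightarrow> source x \<xi> \<in> borel_measurable (lebesgue_on {0..b})"
  unfolding source_def[abs_def]
  using depth_measurable[of x \<xi> b] borel_measurable_lebesgue_on[OF scattering_line_borel[of \<xi> x], of "{0..b}"]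
  by measurable

lemmas source_integrable = integrable_lebesgue_on_Icc[OF source_measurable source_bound]

text \<open>This is \<open>T f\<close> of the overview, and \<open>attenuation\<close> below is its
  factor \<open>\<sigma>\<close>, both taken over the common interval \<open>{0..R}\<close>.\<close>

definition scattered :: "'a \<Rightarrow> 'a \<Rightarrow> real" where
  "scattered x \<xi> = integral {0..R} (source x \<xi>)"

definition attenuation :: "'a \<Rightarrow> 'a \<Rightarrow> real" where
  "attenuation x \<xi> = exp (- depth x \<xi> R)"

lemma phase_line:
  assumes "(x, \<xi>) \<in> phase_domain \<Omega>" "0 \<le> s" "s \<le> \<tau> x \<xi>"
  shows "x - s *\<^sub>R \<xi> \<in> \<Omega> \<union> {y. (y, \<xi>) \<in> inflow_boundary \<Omega>}"
proof -
  have r: "(x, \<xi>) \<in> rays" using phase_rays assms(1) by blast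
  consider "s = 0" | "s = \<tau> x \<xi>" | "0 < s" "s < \<tau> x \<xi>" using assms by linarith
  then show ?thesis
  proof cases
    case 1 then show ?thesis using assms by (auto simp: phase_domain_def)
  next
    case 2
    then show ?thesis
      using entry_point_frontier[OF r] entry_point_inflow[OF r] raysD[OF r]
      by (simp add: mem_inflow_boundary[OF C1] entry_point_def)
  next
    case 3 then show ?thesis using before_exit raysD[OF r] by blast
  qed
qed

lemma entry_inflow: "(x, \<xi>) \<in> rays \<Longrightarrow> (P x \<xi>, \<xi>) \<in> inflow_boundary \<Omega>"
  using entry_point_frontier entry_point_inflow raysD by (simp add: mem_inflow_boundary[OF C1])

text \<open>Away from the crossings, \<open>exp (- depth x \<xi> s)\<close> is an integrating
  factor, and the derivative of
  \<open>- exp (- depth x \<xi> s) * f (x - s *\<^sub>R \<xi>, \<xi>)\<close> is the source. At the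
  finitely many crossings the derivative may fail to exist, but continuity of \<open>f\<close> along
  the line, up to and including the entry point, carries the fundamental theorem of calculus
  across.\<close>

lemma Duhamel:
  assumes z: "(x, \<xi>) \<in> phase_domain \<Omega>"
  shows "f (x, \<xi>) = I * indicator A' (P x \<xi>) * attenuation x \<xi> + scattered x \<xi>"
proof -
  have r: "(x, \<xi>) \<in> rays" using phase_rays z by blast
  have \<xi>: "norm \<xi> = 1" using raysD[OF r] by blast
  have t: "0 \<le> \<tau> x \<xi>" "\<tau> x \<xi> \<le> R" using exit_time_nonneg raysD[OF r] exit_time_le_R[OF r] by auto
  let ?v = "\<lambda>s. - (exp (- depth x \<xi> s) * f (x - s *\<^sub>R \<xi>, \<xi>))"
  have "(source x \<xi> has_integral ?v (\<tau> x \<xi>) - ?v 0) {0..\<tau> x \<xi>}"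
  proof (rule fundamental_theorem_of_calculus_interior_strong[OF finite_bad[OF r] t(1)])
    fix s assume s: "s \<in> {0<..<\<tau> x \<xi>} - bad x \<xi>"
    have "x - s *\<^sub>R \<xi> \<in> \<Omega>" using before_exit[of \<xi> x s] s raysD[OF r] by auto
    then have O: "x - s *\<^sub>R \<xi> \<in> \<Omega>\<^sub>0"
      using not_bad[of s x \<xi>] s closure_sub closure_subset[of \<Omega>] by auto
    show "(?v has_vector_derivative source x \<xi> s) (at s)"
      unfolding has_real_derivative_iff_has_vector_derivative[symmetric]
      by (rule DERIV_cong[OF DERIV_minus[OF DERIV_mult[OF DERIV_fun_exp[OF DERIV_minus[OF DERIV_depth]]
          DERIV_solution_line[OF O \<xi>]]]]) (use s in \<open>auto simp: source_def algebra_simps\<close>)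
  next
    have "continuous_on ({x + s *\<^sub>R \<xi> |s. True} \<inter> (\<Omega> \<union> {y. (y, \<xi>) \<in> inflow_boundary \<Omega>})) (\<lambda>y. f (y, \<xi>))"
      using sol z unfolding transport_solution_def by blast
    then have "continuous_on {0..\<tau> x \<xi>} (\<lambda>s. f (x - s *\<^sub>R \<xi>, \<xi>))"
    proof (rule continuous_on_compose2)
      show "(\<lambda>s. x - s *\<^sub>R \<xi>) ` {0..\<tau> x \<xi>} \<subseteq>
          {x + s *\<^sub>R \<xi> |s. True} \<inter> (\<Omega> \<union> {y. (y, \<xi>) \<in> inflow_boundary \<Omega>})"
        using phase_line[OF z] by (force intro: exI[of _ "- s" for s])
    qed (intro continuous_intros)
    then show "continuous_on {0..\<tau> x \<xi>} ?v"
      by (intro continuous_intros continuous_on_depth)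
  qed
  moreover have "(source x \<xi> has_integral 0) {\<tau> x \<xi>..R}"
  proof (rule has_integral_spike[of "{\<tau> x \<xi>}" _ _ "\<lambda>_. 0"])
    fix s assume s: "s \<in> {\<tau> x \<xi>..R} - {\<tau> x \<xi>}"
    then have "x - s *\<^sub>R \<xi> \<notin> closure \<Omega>" using le_exit_time[OF r, of s] t by force
    then have "x - s *\<^sub>R \<xi> \<notin> \<Omega>\<^sub>0" using sub_dom closure_subset[of \<Omega>] by blast
    then show "source x \<xi> s = 0" by (simp add: source_def scattering_outside)
  qed auto
  ultimately have "(source x \<xi> has_integral ?v (\<tau> x \<xi>) - ?v 0 + 0) {0..R}"
    by (rule has_integral_combine[OF t])
  then have "scattered x \<xi> = f (x, \<xi>) - exp (- depth x \<xi> (\<tau> x \<xi>)) * f (P x \<xi>, \<xi>)"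
    by (simp add: scattered_def integral_unique entry_point_def)
  moreover have "f (P x \<xi>, \<xi>) = I * indicator A' (P x \<xi>)"
    using sol entry_inflow[OF r] f0 unfolding transport_solution_def by auto
  ultimately show ?thesis
    by (simp add: attenuation_def depth_beyond[OF r t(2)])
qed

section \<open>Contraction of the oscillation\<close>

definition albedo :: real where "albedo = 1 - exp (- m\<^sub>t * R)"

lemma albedo: "0 \<le> albedo" "albedo < 1"
  using mt(1) R(1) by (auto simp: albedo_def)

text \<open>With \<open>\<mu>\<^sub>t\<close> in place of \<open>\<mu>\<^sub>s\<close> the integrand
  has the antiderivative \<open>- exp (- depth x \<xi> s)\<close>, so the integral is
  \<open>1 - exp (- depth x \<xi> R)\<close>, and the depth is at most \<open>m\<^sub>t * R\<close>.
  Thus \<open>albedo\<close> bounds the share of radiation that interacts at all along a path; it is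
  not the ratio of \<open>\<mu>\<^sub>s\<close> to \<open>\<mu>\<^sub>t\<close>, which may be
  1.\<close>

lemma absorbed_le:
  assumes r: "(x, \<xi>) \<in> rays"
  shows "integrable (lebesgue_on {0..R}) (\<lambda>s. exp (- depth x \<xi> s) * \<mu>\<^sub>s (x - s *\<^sub>R \<xi>))"
    and "integral\<^sup>L (lebesgue_on {0..R}) (\<lambda>s. exp (- depth x \<xi> s) * \<mu>\<^sub>s (x - s *\<^sub>R \<xi>)) \<le> albedo"
proof -
  have meas: "(\<lambda>s. exp (- depth x \<xi> s) * \<mu> (x - s *\<^sub>R \<xi>)) \<in> borel_measurable (lebesgue_on {0..R})"
    if "(\<lambda>s. \<mu> (x - s *\<^sub>R \<xi>)) \<in> borel_measurable borel" for \<mu> :: "'a \<Rightarrow> real"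
    using depth_measurable[of x \<xi> R] borel_measurable_lebesgue_on[OF that, of "{0..R}"] by measurable
  have bd: "\<bar>exp (- depth x \<xi> s) * \<mu> (x - s *\<^sub>R \<xi>)\<bar> \<le> m\<^sub>t"
    if "\<And>x. 0 \<le> \<mu> x" "\<And>x. \<mu> x \<le> m\<^sub>t" for \<mu> s
    using mult_mono[of "exp (- depth x \<xi> s)" 1 "\<mu> (x - s *\<^sub>R \<xi>)" m\<^sub>t] that depth_nonneg[of x \<xi> s]
    by (auto simp: abs_mult)
  note js = integrable_lebesgue_on_Icc[OF meas[OF \<mu>_line_borel(2)] bd[of \<mu>\<^sub>s, OF \<mu>s_nonneg mt(3)]]
  note it = integrable_lebesgue_on_Icc[OF meas[OF \<mu>_line_borel(1)] bd[of \<mu>\<^sub>t, OF \<mu>t_nonneg mt(2)]]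
  show "integrable (lebesgue_on {0..R}) (\<lambda>s. exp (- depth x \<xi> s) * \<mu>\<^sub>s (x - s *\<^sub>R \<xi>))" by (rule js(1))
  have "((\<lambda>s. exp (- depth x \<xi> s) * \<mu>\<^sub>t (x - s *\<^sub>R \<xi>)) has_integral
      - exp (- depth x \<xi> R) - (- exp (- depth x \<xi> 0))) {0..R}"
  proof (rule fundamental_theorem_of_calculus_interior_strong[OF finite_bad[OF r]])
    fix s assume s: "s \<in> {0<..<R} - bad x \<xi>"
    show "((\<lambda>s. - exp (- depth x \<xi> s)) has_vector_derivative exp (- depth x \<xi> s) * \<mu>\<^sub>t (x - s *\<^sub>R \<xi>)) (at s)"
      unfolding has_real_derivative_iff_has_vector_derivative[symmetric]
      by (rule derivative_eq_intros DERIV_depth refl)+ (use s in auto)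
  qed (use R in \<open>auto intro!: continuous_intros continuous_on_depth\<close>)
  then have "integral {0..R} (\<lambda>s. exp (- depth x \<xi> s) * \<mu>\<^sub>t (x - s *\<^sub>R \<xi>)) = 1 - exp (- depth x \<xi> R)"
    by (simp add: integral_unique)
  also have "\<dots> \<le> albedo" using depth_le[of R x \<xi>] R(1) by (simp add: albedo_def)
  finally have "integral {0..R} (\<lambda>s. exp (- depth x \<xi> s) * \<mu>\<^sub>t (x - s *\<^sub>R \<xi>)) \<le> albedo" .
  moreover have "integral {0..R} (\<lambda>s. exp (- depth x \<xi> s) * \<mu>\<^sub>s (x - s *\<^sub>R \<xi>))
      \<le> integral {0..R} (\<lambda>s. exp (- depth x \<xi> s) * \<mu>\<^sub>t (x - s *\<^sub>R \<xi>))"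
    by (rule integral_le[OF js(2) it(2)]) (simp add: \<mu>s_le)
  ultimately show "integral\<^sup>L (lebesgue_on {0..R}) (\<lambda>s. exp (- depth x \<xi> s) * \<mu>\<^sub>s (x - s *\<^sub>R \<xi>)) \<le> albedo"
    using js(3) by simp
qed

lemma attenuation_bounds: "0 < attenuation x \<xi>" "attenuation x \<xi> \<le> 1"
  using depth_nonneg by (auto simp: attenuation_def)

lemma attenuation_tendsto:
  "(x, \<xi>) \<in> rays \<Longrightarrow> X \<longlonglongrightarrow> x \<Longrightarrow> \<Xi> \<longlonglongrightarrow> \<xi> \<Longrightarrow> (\<lambda>n. attenuation (X n) (\<Xi> n)) \<longlonglongrightarrow> attenuation x \<xi>"
  unfolding attenuation_def by (intro tendsto_intros depth_tendsto)

text \<open>The limsup of the change of \<open>T f\<close> is at most \<open>K\<close>, for a fixed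
  direction and an interior limit point. The threshold index may depend on \<open>\<xi>\<close> and
  on the sequence, which avoids suprema over directions and questions of their
  measurability.\<close>

definition oscillation_le :: "real \<Rightarrow> bool" where
  "oscillation_le K \<longleftrightarrow> (\<forall>x\<in>\<Omega>. \<forall>\<xi>. norm \<xi> = 1 \<longrightarrow> (\<forall>X. (\<forall>n. X n \<in> \<Omega>) \<longrightarrow> X \<longlonglongrightarrow> x \<longrightarrow>
     (\<forall>\<epsilon>>0. \<forall>\<^sub>F n in sequentially. \<bar>scattered (X n) \<xi> - scattered x \<xi>\<bar> \<le> K + \<epsilon>)))"

text \<open>The change of \<open>f\<close> at a fixed \<open>\<xi>'\<close> splits into the change
  of the indicator of \<open>A'\<close>, the change of the attenuation, which tends to 0, and the
  change of \<open>T f\<close>, asymptotically at most \<open>K\<close>. The first part need not be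
  small for any given \<open>\<xi>'\<close>, but it is supported on \<open>D n\<close>, whose
  measure tends to 0. The normalisation of \<open>p\<close> then leaves exactly \<open>K\<close>
  under the integral.\<close>

lemma scattering_oscillation:
  assumes K: "oscillation_le K" "0 \<le> K"
    and x: "x \<in> \<Omega>\<^sub>0" "\<And>n. X n \<in> \<Omega>\<^sub>0" "X \<longlonglongrightarrow> x"
    and \<xi>: "norm \<xi> = 1" "\<And>n. norm (\<Xi> n) = 1" "\<Xi> \<longlonglongrightarrow> \<xi>" and \<epsilon>: "0 < \<epsilon>"
  shows "\<forall>\<^sub>F n in sequentially. \<bar>scattering (X n) (\<Xi> n) - scattering x \<xi>\<bar> \<le> \<mu>\<^sub>s x * K + \<epsilon>"
proof -
  have xd: "x \<in> \<Omega>" "\<And>n. X n \<in> \<Omega>" using x sub_dom by auto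
  define h where "h n \<xi>' = p (X n) (\<Xi> n) \<xi>' * f (X n, \<xi>')" for n \<xi>'
  define k where "k \<xi>' = p x \<xi> \<xi>' * f (x, \<xi>')" for \<xi>'
  \<comment> \<open>Bounds \<open>p\<close> times the change of the boundary value.\<close>
  define c where "c = m\<^sub>p * \<bar>I\<bar>"
  have c: "0 \<le> c" using mp by (simp add: c_def)
  define D where "D n = sym_diff (seen (X n) A') (seen x A')" for n
  have D: "D n \<in> sets sphere_measure" for n
    unfolding D_def using closed_A xd by (intro sets.Un sets.Diff sets_sphere_measure sets_seen) auto
  have Dlim: "(\<lambda>n. measure sphere_measure (D n)) \<longlonglongrightarrow> 0"
    unfolding D_def by (rule seen_continuous[OF xd x(3) closed_A])
  \<comment> \<open>The contribution of \<open>D n\<close> is subtracted before the pointwise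
    estimate and returned after integration as
    \<open>c * measure sphere_measure (D n)\<close>.\<close>
  define u where "u n \<xi>' = \<bar>h n \<xi>' - k \<xi>'\<bar> - c * indicator (D n) \<xi>'" for n \<xi>'
  have hi: "integrable sphere_measure (h n)" and ki: "integrable sphere_measure k" for n
    unfolding h_def[abs_def] k_def[abs_def] using phase_function(3) x \<xi> by auto
  have [measurable]: "h n \<in> borel_measurable sphere_measure" "k \<in> borel_measurable sphere_measure" for n
    using hi ki by auto
  have hb: "\<bar>h n \<xi>'\<bar> \<le> m\<^sub>p * m\<^sub>f" and kb: "\<bar>k \<xi>'\<bar> \<le> m\<^sub>p * m\<^sub>f" if "norm \<xi>' = 1" for n \<xi>'
    unfolding h_def k_def abs_mult using that \<xi> xd mp p_nonneg mf(1)
    by (auto intro!: mult_mono mf(2) interior_phase)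
  have ev: "\<forall>\<^sub>F n in sequentially. u n \<xi>' \<le> p x \<xi> \<xi>' * K + \<delta>" if \<xi>': "norm \<xi>' = 1" and \<delta>: "0 < \<delta>" for \<xi>' \<delta>
  proof -
    define e where "e n = attenuation (X n) \<xi>'" for n
    have elim: "e \<longlonglongrightarrow> attenuation x \<xi>'"
      unfolding e_def[abs_def] by (intro attenuation_tendsto interior_rays xd \<xi>' x) simp
    have "(x, \<xi>, \<xi>') \<in> \<Omega>\<^sub>0 \<times> sphere 0 1 \<times> sphere 0 1"
        "\<forall>\<^sub>F n in sequentially. (X n, \<Xi> n, \<xi>') \<in> \<Omega>\<^sub>0 \<times> sphere 0 1 \<times> sphere 0 1"
      using x \<xi> \<xi>' by auto
    moreover have "continuous_on (\<Omega>\<^sub>0 \<times> sphere 0 1 \<times> sphere 0 1) (\<lambda>(x, \<xi>, \<xi>'). p x \<xi> \<xi>')"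
      using coeff unfolding admissible_coefficients_def by blast
    moreover have "(\<lambda>n. (X n, \<Xi> n, \<xi>')) \<longlonglongrightarrow> (x, \<xi>, \<xi>')"
      by (intro tendsto_intros x \<xi>)
    ultimately have plim: "(\<lambda>n. p (X n) (\<Xi> n) \<xi>') \<longlonglongrightarrow> p x \<xi> \<xi>'"
      using continuous_on_tendsto_compose[of _ "\<lambda>(x, \<xi>, \<xi>'). p x \<xi> \<xi>'" "\<lambda>n. (X n, \<Xi> n, \<xi>')" "(x, \<xi>, \<xi>')"]
      by auto
    define r where "r n = \<bar>p (X n) (\<Xi> n) \<xi>' - p x \<xi> \<xi>'\<bar> * m\<^sub>f + c * \<bar>e n - attenuation x \<xi>'\<bar>" for n
    have "r \<longlonglongrightarrow> \<bar>p x \<xi> \<xi>' - p x \<xi> \<xi>'\<bar> * m\<^sub>f + c * \<bar>attenuation x \<xi>' - attenuation x \<xi>'\<bar>"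
      unfolding r_def[abs_def] by (intro tendsto_intros plim elim)
    then have rlim: "r \<longlonglongrightarrow> 0" by simp
    have half: "0 < \<delta> / 2" "0 < \<delta> / (2 * m\<^sub>p)" using \<delta> mp by auto
    have Tev: "\<forall>\<^sub>F n in sequentially. \<bar>scattered (X n) \<xi>' - scattered x \<xi>'\<bar> \<le> K + \<delta> / (2 * m\<^sub>p)"
      using K(1) xd x(3) \<xi>' half(2) unfolding oscillation_le_def by blast
    show ?thesis
      using order_tendstoD(2)[OF rlim half(1)] Tev
    proof eventually_elim
      case (elim n)
      define i j :: real where "i = indicator A' (P (X n) \<xi>')" and "j = indicator A' (P x \<xi>')"
      have ij: "\<bar>i - j\<bar> = indicator (D n) \<xi>'" "\<bar>j\<bar> \<le> 1"
        using \<xi>' by (auto simp: i_def j_def D_def seen_def indicator_def)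
      have fn: "f (X n, \<xi>') = I * i * e n + scattered (X n) \<xi>'"
          "f (x, \<xi>') = I * j * attenuation x \<xi>' + scattered x \<xi>'"
        using Duhamel[OF interior_phase] xd \<xi>' by (auto simp: i_def j_def e_def)
      have "f (X n, \<xi>') - f (x, \<xi>') = I * ((i - j) * e n + j * (e n - attenuation x \<xi>'))
          + (scattered (X n) \<xi>' - scattered x \<xi>')"
        unfolding fn by (simp add: algebra_simps)
      also have "\<bar>\<dots>\<bar> \<le> \<bar>I\<bar> * (\<bar>i - j\<bar> * 1 + 1 * \<bar>e n - attenuation x \<xi>'\<bar>)
          + \<bar>scattered (X n) \<xi>' - scattered x \<xi>'\<bar>"
      proof (intro order_trans[OF abs_triangle_ineq] add_mono order_refl)
        have "\<bar>e n\<bar> \<le> 1" using attenuation_bounds[of "X n" \<xi>'] by (simp add: e_def)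
        then show "\<bar>I * ((i - j) * e n + j * (e n - attenuation x \<xi>'))\<bar>
            \<le> \<bar>I\<bar> * (\<bar>i - j\<bar> * 1 + 1 * \<bar>e n - attenuation x \<xi>'\<bar>)"
          unfolding abs_mult using ij(2)
          by (intro mult_left_mono order_trans[OF abs_triangle_ineq] add_mono) (auto simp: abs_mult intro: mult_left_le mult_left_le_one_le)
      qed
      finally have df: "\<bar>f (X n, \<xi>') - f (x, \<xi>')\<bar> \<le> \<bar>I\<bar> * (indicator (D n) \<xi>' + \<bar>e n - attenuation x \<xi>'\<bar>)
          + \<bar>scattered (X n) \<xi>' - scattered x \<xi>'\<bar>" by (simp add: ij)
      let ?p = "p x \<xi> \<xi>'"
      have p: "0 \<le> ?p" "?p \<le> m\<^sub>p" using p_nonneg mp \<xi> \<xi>' by auto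
      have "h n \<xi>' - k \<xi>' = (p (X n) (\<Xi> n) \<xi>' - ?p) * f (X n, \<xi>') + ?p * (f (X n, \<xi>') - f (x, \<xi>'))"
        by (simp add: h_def k_def algebra_simps)
      also have "\<bar>\<dots>\<bar> \<le> \<bar>p (X n) (\<Xi> n) \<xi>' - ?p\<bar> * m\<^sub>f + ?p * \<bar>f (X n, \<xi>') - f (x, \<xi>')\<bar>"
        using mf(2)[OF interior_phase[OF xd(2)[of n] \<xi>']] p
        by (intro order_trans[OF abs_triangle_ineq] add_mono) (auto simp: abs_mult intro!: mult_left_mono)
      also have "?p * \<bar>f (X n, \<xi>') - f (x, \<xi>')\<bar> \<le> ?p * (\<bar>I\<bar> * (indicator (D n) \<xi>' + \<bar>e n - attenuation x \<xi>'\<bar>))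
          + ?p * (K + \<delta> / (2 * m\<^sub>p))"
        using mult_left_mono[OF df p(1)] mult_left_mono[OF elim(2) p(1)] by (simp add: distrib_left)
      also have "?p * (\<bar>I\<bar> * (indicator (D n) \<xi>' + \<bar>e n - attenuation x \<xi>'\<bar>))
          \<le> c * (indicator (D n) \<xi>' + \<bar>e n - attenuation x \<xi>'\<bar>)"
        unfolding c_def mult.assoc[symmetric] using p by (intro mult_right_mono) auto
      also have "?p * (K + \<delta> / (2 * m\<^sub>p)) \<le> ?p * K + m\<^sub>p * (\<delta> / (2 * m\<^sub>p))"
        unfolding distrib_left using p half by (intro add_mono order_refl mult_right_mono) auto
      finally have "\<bar>h n \<xi>' - k \<xi>'\<bar> \<le> r n + c * indicator (D n) \<xi>' + ?p * K + \<delta> / 2"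
        using mp(1) by (simp add: r_def distrib_left)
      then show ?case using elim(1) by (simp add: u_def)
    qed
  qed
  have ubound: "\<forall>\<^sub>F n in sequentially. integral\<^sup>L sphere_measure (u n) \<le> (\<integral>\<xi>'. p x \<xi> \<xi>' * K \<partial>sphere_measure) + \<eta>"
    if "0 < \<eta>" for \<eta>
  proof (rule sphere.eventually_integral_le[OF _ _ _ _ _ that])
    show "u n \<in> borel_measurable sphere_measure" for n
      unfolding u_def[abs_def] using D[of n] by measurable
    show "\<bar>u n \<xi>'\<bar> \<le> 2 * (m\<^sub>p * m\<^sub>f) + c" if "\<xi>' \<in> space sphere_measure" for n \<xi>'
    proof -
      have "0 \<le> c * indicator (D n) \<xi>'" "c * indicator (D n) \<xi>' \<le> c" using c by (auto simp: indicator_def)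
      then show ?thesis using hb[of \<xi>' n] kb[of \<xi>'] that by (auto simp: u_def abs_le_iff)
    qed
    show "integrable sphere_measure (\<lambda>\<xi>'. p x \<xi> \<xi>' * K)" using phase_function(1)[OF x(1) \<xi>(1)] by simp
    show "AE \<xi>' in sphere_measure. \<forall>\<epsilon>>0. \<forall>\<^sub>F n in sequentially. u n \<xi>' \<le> p x \<xi> \<xi>' * K + \<epsilon>"
      using ev by (intro AE_I2) auto
  qed (use p_nonneg \<xi> K(2) in auto)
  \<comment> \<open>Two errors of \<open>\<epsilon> / (4 * (m\<^sub>t + 1))\<close>, from
    \<open>u n\<close> and from \<open>D n\<close>, get multiplied by
    \<open>\<mu>\<^sub>s x \<le> m\<^sub>t + 1\<close>; with \<open>\<epsilon> / 4\<close> from the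
    variation of \<open>\<mu>\<^sub>s\<close> the total is three quarters of
    \<open>\<epsilon>\<close>.\<close>
  have half: "0 < \<epsilon> / (4 * (m\<^sub>t + 1))" "0 < \<epsilon> / (4 * m\<^sub>f)" using \<epsilon> mt(1) mf(1) by auto
  have "(\<lambda>n. c * measure sphere_measure (D n)) \<longlonglongrightarrow> c * 0" by (intro tendsto_intros Dlim)
  then have cD: "\<forall>\<^sub>F n in sequentially. c * measure sphere_measure (D n) < \<epsilon> / (4 * (m\<^sub>t + 1))"
    using half by (intro order_tendstoD(2)) auto
  have "(\<lambda>n. \<mu>\<^sub>s (X n)) \<longlonglongrightarrow> \<mu>\<^sub>s x"
    by (rule isCont_tendsto_compose[OF \<mu>s_isCont x(3)]) (use x in auto)
  then have \<mu>: "\<forall>\<^sub>F n in sequentially. \<bar>\<mu>\<^sub>s (X n) - \<mu>\<^sub>s x\<bar> < \<epsilon> / (4 * m\<^sub>f)"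
    using tendstoD[of _ "\<mu>\<^sub>s x" sequentially, OF _ half(2)] by (simp add: dist_real_def)
  show ?thesis
    using ubound[OF half(1)] cD \<mu>
  proof eventually_elim
    case (elim n)
    let ?h = "integral\<^sup>L sphere_measure (h n)" and ?k = "integral\<^sup>L sphere_measure k"
    have ui: "integrable sphere_measure (\<lambda>\<xi>'. \<bar>h n \<xi>' - k \<xi>'\<bar>)" using hi ki by auto
    have Di: "integrable sphere_measure (\<lambda>\<xi>'. c * indicat_real (D n) \<xi>')"
      using D[of n] by (intro integrable_mult_right sphere.integrable_const_bound[where B=1]) (auto simp: indicator_def)
    have "\<bar>?h - ?k\<bar> = \<bar>\<integral>\<xi>'. h n \<xi>' - k \<xi>' \<partial>sphere_measure\<bar>"
      using hi ki by simp
    also have "\<dots> \<le> (\<integral>\<xi>'. \<bar>h n \<xi>' - k \<xi>'\<bar> \<partial>sphere_measure)" by (rule integral_abs_bound)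
    also have "\<dots> = integral\<^sup>L sphere_measure (u n) + c * measure sphere_measure (D n)"
    proof -
      have "integral\<^sup>L sphere_measure (u n) = (\<integral>\<xi>'. \<bar>h n \<xi>' - k \<xi>'\<bar> \<partial>sphere_measure)
          - (\<integral>\<xi>'. c * indicat_real (D n) \<xi>' \<partial>sphere_measure)"
        unfolding u_def[abs_def] by (rule Bochner_Integration.integral_diff[OF ui Di])
      moreover have "(\<integral>\<xi>'. c * indicat_real (D n) \<xi>' \<partial>sphere_measure) = c * measure sphere_measure (D n)"
        using sets.sets_into_space[OF D[of n]] by (simp add: Int_absorb2)
      ultimately show ?thesis by linarith
    qed
    also have "\<dots> \<le> K + 2 * (\<epsilon> / (4 * (m\<^sub>t + 1)))"
      using elim(1,2) phase_function(2)[OF x(1) \<xi>(1)] by simp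
    finally have hk: "\<bar>?h - ?k\<bar> \<le> K + \<epsilon> / (2 * (m\<^sub>t + 1))"
      using mt(1) by (simp add: field_simps)
    have "scattering (X n) (\<Xi> n) - scattering x \<xi> = (\<mu>\<^sub>s (X n) - \<mu>\<^sub>s x) * ?h + \<mu>\<^sub>s x * (?h - ?k)"
      by (simp add: scattering_def h_def[abs_def] k_def[abs_def] algebra_simps)
    also have "\<bar>\<dots>\<bar> \<le> \<epsilon> / (4 * m\<^sub>f) * m\<^sub>f + \<mu>\<^sub>s x * (K + \<epsilon> / (2 * (m\<^sub>t + 1)))"
    proof (intro order_trans[OF abs_triangle_ineq] add_mono)
      have "\<bar>?h\<bar> \<le> m\<^sub>f" unfolding h_def[abs_def] by (rule phase_function(4)[OF x(2) \<xi>(2)])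
      then show "\<bar>(\<mu>\<^sub>s (X n) - \<mu>\<^sub>s x) * ?h\<bar> \<le> \<epsilon> / (4 * m\<^sub>f) * m\<^sub>f"
        unfolding abs_mult using elim(3) half by (intro mult_mono) auto
      show "\<bar>\<mu>\<^sub>s x * (?h - ?k)\<bar> \<le> \<mu>\<^sub>s x * (K + \<epsilon> / (2 * (m\<^sub>t + 1)))"
        using hk \<mu>s_nonneg[of x] by (simp add: abs_mult mult_left_mono)
    qed
    also have "\<dots> = \<epsilon> / 4 + \<mu>\<^sub>s x * K + \<mu>\<^sub>s x * (\<epsilon> / (2 * (m\<^sub>t + 1)))"
      using mf(1) by (simp add: distrib_left)
    also have "\<mu>\<^sub>s x * (\<epsilon> / (2 * (m\<^sub>t + 1))) \<le> (m\<^sub>t + 1) * (\<epsilon> / (2 * (m\<^sub>t + 1)))"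
      using mt(3)[of x] mt(1) \<epsilon> by (intro mult_right_mono) auto
    also have "(m\<^sub>t + 1) * (\<epsilon> / (2 * (m\<^sub>t + 1))) = \<epsilon> / 2" using mt(1) by (simp add: field_simps)
    finally show ?case using \<epsilon> by linarith
  qed
qed

text \<open>Off the crossings, a point of the limit ray lies either outside the closure of
  \<open>\<Omega>\<^sub>0\<close>, where the sources vanish from some index on, or in
  \<open>\<Omega>\<^sub>0\<close>, where \<open>scattering_oscillation\<close> applies. Integration
  along the ray turns the local factor \<open>\<mu>\<^sub>s\<close> into \<open>albedo\<close>. The
  conclusion is wider than the hypothesis, as it covers moving directions and starting points on the
  boundary.\<close>

lemma scattered_oscillation:
  assumes K: "oscillation_le K" "0 \<le> K" and r: "(x, \<xi>) \<in> rays" "\<And>n. (X n, \<Xi> n) \<in> rays"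
    and lim: "X \<longlonglongrightarrow> x" "\<Xi> \<longlonglongrightarrow> \<xi>" and \<epsilon>: "0 < \<epsilon>"
  shows "\<forall>\<^sub>F n in sequentially. \<bar>scattered (X n) (\<Xi> n) - scattered x \<xi>\<bar> \<le> albedo * K + \<epsilon>"
proof -
  have \<xi>: "norm \<xi> = 1" "\<And>n. norm (\<Xi> n) = 1" using raysD(1)[OF r(1)] raysD(1)[OF r(2)] by auto
  define u where "u n s = \<bar>source (X n) (\<Xi> n) s - source x \<xi> s\<bar>" for n s
  define w where "w s = exp (- depth x \<xi> s) * \<mu>\<^sub>s (x - s *\<^sub>R \<xi>) * K" for s
  let ?M = "lebesgue_on {0..R}"
  have wi: "integrable ?M w" and w0: "0 \<le> w s" for s
    unfolding w_def[abs_def] using absorbed_le(1)[OF r(1)] \<mu>s_nonneg K by auto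
  have [measurable]: "source (X n) (\<Xi> n) \<in> borel_measurable ?M" "source x \<xi> \<in> borel_measurable ?M" for n
    using source_measurable \<xi> by auto
  have ev: "\<forall>\<^sub>F n in sequentially. u n s \<le> w s + \<delta>" if s: "s \<notin> bad x \<xi>" and \<delta>: "0 < \<delta>" for s \<delta>
  proof -
    have slim: "(\<lambda>n. X n - s *\<^sub>R \<Xi> n) \<longlonglongrightarrow> x - s *\<^sub>R \<xi>" by (intro tendsto_intros lim)
    from not_bad[OF s] show ?thesis
    proof
      assume "x - s *\<^sub>R \<xi> \<in> - closure \<Omega>\<^sub>0"
      moreover from this have "\<forall>\<^sub>F n in sequentially. X n - s *\<^sub>R \<Xi> n \<in> - closure \<Omega>\<^sub>0"
        by (intro topological_tendstoD[OF slim]) auto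
      moreover have "scattering y \<eta> = 0" if "y \<in> - closure \<Omega>\<^sub>0" for y \<eta>
        using that closure_subset[of \<Omega>\<^sub>0] by (intro scattering_outside) auto
      ultimately show ?thesis
        by (auto elim!: eventually_mono simp: u_def source_def w0 \<delta> less_imp_le add_nonneg_nonneg)
    next
      assume O: "x - s *\<^sub>R \<xi> \<in> \<Omega>\<^sub>0"
      then have "\<forall>\<^sub>F n in sequentially. X n - s *\<^sub>R \<Xi> n \<in> \<Omega>\<^sub>0"
        by (intro topological_tendstoD[OF slim] open_sub)
      \<comment> \<open>The points reach \<open>\<Omega>\<^sub>0\<close> only from some index on,
        whereas \<open>scattering_oscillation\<close> wants the whole sequence there; hence the
        shift by \<open>N\<close>.\<close>
      then obtain N where N: "\<And>n. N \<le> n \<Longrightarrow> X n - s *\<^sub>R \<Xi> n \<in> \<Omega>\<^sub>0"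
        by (auto simp: eventually_sequentially)
      have half: "0 < \<delta> / 2" "0 < \<delta> / (2 * (m\<^sub>t * m\<^sub>f))" using \<delta> mt(1) mf(1) by auto
      have "\<forall>\<^sub>F n in sequentially. \<bar>scattering (X (n + N) - s *\<^sub>R \<Xi> (n + N)) (\<Xi> (n + N)) - scattering (x - s *\<^sub>R \<xi>) \<xi>\<bar>
          \<le> \<mu>\<^sub>s (x - s *\<^sub>R \<xi>) * K + \<delta> / 2"
        using N \<xi> LIMSEQ_ignore_initial_segment[OF slim, of N] LIMSEQ_ignore_initial_segment[OF lim(2), of N]
        by (intro scattering_oscillation[OF K O, where X="\<lambda>n. X (n + N) - s *\<^sub>R \<Xi> (n + N)"] half) auto
      then have sc: "\<forall>\<^sub>F n in sequentially. \<bar>scattering (X n - s *\<^sub>R \<Xi> n) (\<Xi> n) - scattering (x - s *\<^sub>R \<xi>) \<xi>\<bar>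
          \<le> \<mu>\<^sub>s (x - s *\<^sub>R \<xi>) * K + \<delta> / 2"
        by (subst (asm) eventually_sequentially_seg)
      have "(\<lambda>n. exp (- depth (X n) (\<Xi> n) s)) \<longlonglongrightarrow> exp (- depth x \<xi> s)"
        by (intro tendsto_intros depth_tendsto r lim)
      from tendstoD[OF this half(2)]
      have "\<forall>\<^sub>F n in sequentially. \<bar>exp (- depth (X n) (\<Xi> n) s) - exp (- depth x \<xi> s)\<bar> < \<delta> / (2 * (m\<^sub>t * m\<^sub>f))"
        by (simp add: dist_real_def)
      with sc show ?thesis
      proof eventually_elim
        case (elim n)
        let ?a = "exp (- depth (X n) (\<Xi> n) s)" and ?b = "exp (- depth x \<xi> s)"
        let ?g = "scattering (X n - s *\<^sub>R \<Xi> n) (\<Xi> n)" and ?k = "scattering (x - s *\<^sub>R \<xi>) \<xi>"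
        have "source (X n) (\<Xi> n) s - source x \<xi> s = (?a - ?b) * ?g + ?b * (?g - ?k)"
          by (simp add: source_def algebra_simps)
        also have "\<bar>\<dots>\<bar> \<le> \<delta> / (2 * (m\<^sub>t * m\<^sub>f)) * (m\<^sub>t * m\<^sub>f) + ?b * (\<mu>\<^sub>s (x - s *\<^sub>R \<xi>) * K + \<delta> / 2)"
        proof (intro order_trans[OF abs_triangle_ineq] add_mono)
          have "\<bar>?g\<bar> \<le> m\<^sub>t * m\<^sub>f"
            using scattering_bound[OF \<xi>(2), of "X n - s *\<^sub>R \<Xi> n" n] mt(3)[of "X n - s *\<^sub>R \<Xi> n"] mf(1)
            by (meson mult_right_mono less_imp_le order_trans)
          then show "\<bar>(?a - ?b) * ?g\<bar> \<le> \<delta> / (2 * (m\<^sub>t * m\<^sub>f)) * (m\<^sub>t * m\<^sub>f)"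
            unfolding abs_mult using elim(2) half by (intro mult_mono) auto
          show "\<bar>?b * (?g - ?k)\<bar> \<le> ?b * (\<mu>\<^sub>s (x - s *\<^sub>R \<xi>) * K + \<delta> / 2)"
            using elim(1) by (simp add: abs_mult)
        qed
        also have "\<dots> = \<delta> / 2 + w s + ?b * (\<delta> / 2)"
          using mt(1) mf(1) by (simp add: w_def distrib_left)
        also have "?b * (\<delta> / 2) \<le> 1 * (\<delta> / 2)"
          using depth_nonneg \<delta> by (intro mult_right_mono) auto
        finally show ?case by (simp add: u_def)
      qed
    qed
  qed
  have "\<forall>\<^sub>F n in sequentially. integral\<^sup>L ?M (u n) \<le> integral\<^sup>L ?M w + \<epsilon>"
  proof (rule finite_measure.eventually_integral_le[OF lebesgue_on_Icc_finite _ _ wi _ _ \<epsilon>])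
    show "u n \<in> borel_measurable ?M" for n unfolding u_def[abs_def] by measurable
    show "\<bar>u n s\<bar> \<le> 2 * (m\<^sub>t * m\<^sub>f)" for n s
      using source_bound[OF \<xi>(2), of "X n" n s] source_bound[OF \<xi>(1), of x s]
      by (auto simp: u_def abs_le_iff)
    show "AE s in ?M. \<forall>\<epsilon>>0. \<forall>\<^sub>F n in sequentially. u n s \<le> w s + \<epsilon>"
      by (rule AE_lebesgue_on_finite[OF finite_bad[OF r(1)]]) (use ev in auto)
  qed (rule w0)
  then show ?thesis
  proof eventually_elim
    case (elim n)
    have "\<bar>scattered (X n) (\<Xi> n) - scattered x \<xi>\<bar> = \<bar>\<integral>s. source (X n) (\<Xi> n) s - source x \<xi> s \<partial>?M\<bar>"
      using source_integrable[OF \<xi>(2) \<xi>(2)] source_integrable[OF \<xi>(1) \<xi>(1)]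
      by (simp add: scattered_def)
    also have "\<dots> \<le> integral\<^sup>L ?M (u n)" unfolding u_def[abs_def] by (rule integral_abs_bound)
    also have "\<dots> \<le> integral\<^sup>L ?M w + \<epsilon>" by (rule elim)
    also have "integral\<^sup>L ?M w \<le> albedo * K"
      unfolding w_def[abs_def] using absorbed_le(2)[OF r(1)] K(2) by (simp add: mult_right_mono)
    finally show ?case by simp
  qed
qed

text \<open>A bound on \<open>T f\<close> gives a first finite \<open>K\<close>, and each
  application of the contraction multiplies it by \<open>albedo\<close>, whose powers tend to
  0.\<close>

lemma oscillation_zero: "oscillation_le 0"
proof -
  define K where "K = 2 * (m\<^sub>t * m\<^sub>f * R)"
  have K: "0 \<le> K" using mt(1) mf(1) R(1) by (simp add: K_def)
  have b: "\<bar>scattered x \<xi>\<bar> \<le> m\<^sub>t * m\<^sub>f * R" if "norm \<xi> = 1" for x \<xi>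
  proof -
    have "norm (integral {0..R} (source x \<xi>)) \<le> integral {0..R} (\<lambda>_. m\<^sub>t * m\<^sub>f)"
      by (rule integral_norm_bound_integral[OF source_integrable(2)[OF that that]])
         (use source_bound[OF that] in auto)
    then show ?thesis using R(1) by (simp add: scattered_def mult_ac)
  qed
  have base: "oscillation_le K"
    unfolding oscillation_le_def
  proof (intro ballI allI impI always_eventually)
    fix x \<xi> :: 'a and X \<epsilon> and n :: nat assume "norm \<xi> = 1" "(0::real) < \<epsilon>"
    then show "\<bar>scattered (X n) \<xi> - scattered x \<xi>\<bar> \<le> K + \<epsilon>"
      using b[of \<xi> x] b[of \<xi> "X n"] by (auto simp: K_def abs_le_iff)
  qed
  have it: "oscillation_le (albedo ^ k * K)" for k
  proof (induction k)
    case (Suc k)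
    have "0 \<le> albedo ^ k * K" using albedo K by simp
    from scattered_oscillation[OF Suc this interior_rays interior_rays _ tendsto_const] show ?case
      unfolding oscillation_le_def by (simp add: mult.assoc)
  qed (use base in simp)
  show ?thesis
    unfolding oscillation_le_def
  proof (intro ballI allI impI)
    fix x \<xi> :: 'a and X and \<epsilon> :: real
    assume a: "x \<in> \<Omega>" "norm \<xi> = 1" "\<forall>n. X n \<in> \<Omega>" "X \<longlonglongrightarrow> x" "0 < \<epsilon>"
    have "(\<lambda>k. albedo ^ k * K) \<longlonglongrightarrow> 0 * K"
      using albedo by (intro tendsto_intros LIMSEQ_realpow_zero)
    then have "\<forall>\<^sub>F k in sequentially. albedo ^ k * K < \<epsilon> / 2"
      using a(5) by (intro order_tendstoD(2)) auto
    then obtain k where k: "albedo ^ k * K < \<epsilon> / 2" by (auto simp: eventually_sequentially)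
    have "\<forall>\<^sub>F n in sequentially. \<bar>scattered (X n) \<xi> - scattered x \<xi>\<bar> \<le> albedo ^ k * K + \<epsilon> / 2"
      using it[of k, unfolded oscillation_le_def] a by simp
    then show "\<forall>\<^sub>F n in sequentially. \<bar>scattered (X n) \<xi> - scattered x \<xi>\<bar> \<le> 0 + \<epsilon>"
      by eventually_elim (use k in auto)
  qed
qed

section \<open>Joint continuity and the form of the extended solution\<close>

lemma continuous_on_raysI:
  assumes "\<And>x \<xi> X \<Xi>. (x, \<xi>) \<in> rays \<Longrightarrow> (\<And>n. (X n, \<Xi> n) \<in> rays) \<Longrightarrow> X \<longlonglongrightarrow> x \<Longrightarrow> \<Xi> \<longlonglongrightarrow> \<xi> \<Longrightarrow>
    (\<lambda>n. g (X n) (\<Xi> n)) \<longlonglongrightarrow> (g x \<xi> :: real)"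
  shows "continuous_on rays (\<lambda>(x, \<xi>). g x \<xi>)"
  unfolding continuous_on_sequentially o_def
proof (intro allI ballI impI, elim conjE)
  fix z :: "nat \<Rightarrow> 'a \<times> 'a" and w
  assume "w \<in> rays" "\<forall>n. z n \<in> rays" "z \<longlonglongrightarrow> w"
  then show "(\<lambda>n. case z n of (x, \<xi>) \<Rightarrow> g x \<xi>) \<longlonglongrightarrow> (case w of (x, \<xi>) \<Rightarrow> g x \<xi>)"
    using assms[of "fst w" "snd w" "fst \<circ> z" "snd \<circ> z"] tendsto_fst[of z w] tendsto_snd[of z w]
    by (simp add: case_prod_beta o_def)
qed

lemma continuous_attenuation: "continuous_on rays (\<lambda>(x, \<xi>). attenuation x \<xi>)"
  by (rule continuous_on_raysI) (rule attenuation_tendsto)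

text \<open>One last use of the contraction estimate, with oscillation bound 0, passes from fixed
  directions and interior points to all of \<open>rays\<close>.\<close>

lemma continuous_scattered: "continuous_on rays (\<lambda>(x, \<xi>). scattered x \<xi>)"
proof (rule continuous_on_raysI)
  fix x \<xi> X \<Xi>
  assume a: "(x, \<xi>) \<in> rays" "\<And>n. (X n, \<Xi> n) \<in> rays" "X \<longlonglongrightarrow> x" "\<Xi> \<longlonglongrightarrow> \<xi>"
  show "(\<lambda>n. scattered (X n) (\<Xi> n)) \<longlonglongrightarrow> scattered x \<xi>"
  proof (rule tendstoI)
    fix e :: real assume "0 < e"
    then have "\<forall>\<^sub>F n in sequentially. \<bar>scattered (X n) (\<Xi> n) - scattered x \<xi>\<bar> \<le> albedo * 0 + e / 2"
      by (intro scattered_oscillation[OF oscillation_zero order_refl a]) simp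
    then show "\<forall>\<^sub>F n in sequentially. dist (scattered (X n) (\<Xi> n)) (scattered x \<xi>) < e"
      by eventually_elim (use \<open>0 < e\<close> in \<open>auto simp: dist_real_def\<close>)
  qed
qed

text \<open>The integrated equation with the boundary value at the entry point frozen at
  \<open>c\<close>. It is continuous on \<open>rays\<close>, and the extended solution agrees with
  it wherever the actual entry value is \<open>c\<close>.\<close>

definition smooth_part :: "real \<Rightarrow> 'a \<times> 'a \<Rightarrow> real" where
  "smooth_part c = (\<lambda>(x, \<xi>). c * attenuation x \<xi> + scattered x \<xi>)"

lemma continuous_smooth_part: "continuous_on rays (smooth_part c)"
  using continuous_attenuation continuous_scattered
  by (auto simp: smooth_part_def case_prod_beta' intro!: continuous_intros)

lemma solution_eq:
  "(x, \<xi>) \<in> phase_domain \<Omega> \<Longrightarrow> f (x, \<xi>) = smooth_part (I * indicator A' (P x \<xi>)) (x, \<xi>)"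
  using Duhamel by (simp add: smooth_part_def)

text \<open>The entry point does not change along a line, so the limit that defines the extension is
  taken within a single continuous \<open>smooth_part\<close>.\<close>

lemma extended_solution_eq:
  assumes r: "(x, \<xi>) \<in> rays"
  shows "extended_solution \<Omega> f (x, \<xi>) = smooth_part (I * indicator A' (P x \<xi>)) (x, \<xi>)"
proof (cases "(x, \<xi>) \<in> phase_domain \<Omega>")
  case True
  then show ?thesis using solution_eq by (simp add: extended_solution_def)
next
  case False
  let ?c = "I * indicator A' (P x \<xi>)"
  have "x \<notin> \<Omega>" using False raysD[OF r] by (auto simp: phase_domain_def)
  moreover have "\<tau> x \<xi> \<noteq> 0"
  proof
    assume "\<tau> x \<xi> = 0"
    then show False using entry_inflow[OF r] False by (auto simp: entry_point_def phase_domain_def)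
  qed
  ultimately have t: "0 < \<tau> x \<xi>" using exit_time_nonneg raysD[OF r] by (simp add: less_le)
  have \<xi>: "norm \<xi> = 1" using raysD[OF r] by blast
  have ev: "\<forall>\<^sub>F s in at_right 0. 0 < s \<and> s < \<tau> x \<xi>"
    using t by (auto simp: eventually_at_right_field)
  have in\<Omega>: "x - s *\<^sub>R \<xi> \<in> \<Omega>" "P (x - s *\<^sub>R \<xi>) \<xi> = P x \<xi>" if "0 < s \<and> s < \<tau> x \<xi>" for s
  proof -
    show *: "x - s *\<^sub>R \<xi> \<in> \<Omega>" using before_exit[of \<xi> x s] that raysD[OF r] by auto
    show "P (x - s *\<^sub>R \<xi>) \<xi> = P x \<xi>" using entry_point_translate(2)[OF r, of "- s"] * by simp
  qed
  have "((\<lambda>s. smooth_part ?c (x - s *\<^sub>R \<xi>, \<xi>)) \<longlongrightarrow> smooth_part ?c (x, \<xi>)) (at_right 0)"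
  proof (rule continuous_on_tendsto_compose[OF continuous_smooth_part _ r])
    have "((\<lambda>s. (x - s *\<^sub>R \<xi>, \<xi>)) \<longlongrightarrow> (x - 0 *\<^sub>R \<xi>, \<xi>)) (at_right 0)" by (intro tendsto_intros)
    then show "((\<lambda>s. (x - s *\<^sub>R \<xi>, \<xi>)) \<longlongrightarrow> (x, \<xi>)) (at_right 0)" by simp
    show "\<forall>\<^sub>F s in at_right 0. (x - s *\<^sub>R \<xi>, \<xi>) \<in> rays"
      using ev by eventually_elim (auto intro: interior_rays in\<Omega> \<xi>)
  qed
  moreover have "\<forall>\<^sub>F s in at_right 0. smooth_part ?c (x - s *\<^sub>R \<xi>, \<xi>) = f (x - s *\<^sub>R \<xi>, \<xi>)"
    using ev
  proof eventually_elim
    case (elim s)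
    show ?case using solution_eq[OF interior_phase[OF in\<Omega>(1)[OF elim] \<xi>]] in\<Omega>(2)[OF elim] by simp
  qed
  ultimately have "((\<lambda>s. f (x - s *\<^sub>R \<xi>, \<xi>)) \<longlongrightarrow> smooth_part ?c (x, \<xi>)) (at_right 0)"
    by (rule Lim_transform_eventually)
  then show ?thesis
    using False by (simp add: extended_solution_def tendsto_Lim)
qed

section \<open>Location of the discontinuities and value of the jump\<close>

text \<open>
  Near a ray whose entry point has a neighbourhood on one side of the relative boundary of \<open>A'\<close>, the
  solution coincides with a continuous function.
\<close>

lemma disc_entry_point:
  assumes d: "(x, \<xi>) \<in> disc rays (extended_solution \<Omega> f)" and U: "open U" "P x \<xi> \<in> U"
  shows "frontier \<Omega> \<inter> U \<inter> A' \<noteq> {}" "frontier \<Omega> \<inter> U - A' \<noteq> {}"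
proof -
  have r: "(x, \<xi>) \<in> rays" and nc: "\<not> continuous (at (x, \<xi>) within rays) (extended_solution \<Omega> f)"
    using d by (auto simp: disc_def)
  have const: False if c: "\<And>y. y \<in> frontier \<Omega> \<inter> U \<Longrightarrow> I * indicator A' y = c" for c
  proof -
    have "((\<lambda>z. case z of (x, \<xi>) \<Rightarrow> P x \<xi>) \<longlongrightarrow> P x \<xi>) (at (x, \<xi>) within rays)"
      using continuous_entry_point r by (auto simp: continuous_on_def)
    then have "\<forall>\<^sub>F z in at (x, \<xi>) within rays. (case z of (x, \<xi>) \<Rightarrow> P x \<xi>) \<in> U"
      using U by (rule topological_tendstoD)
    moreover have "\<forall>\<^sub>F z in at (x, \<xi>) within rays. z \<in> rays" by (simp add: eventually_at_filter)
    ultimately have "\<forall>\<^sub>F z in at (x, \<xi>) within rays. smooth_part c z = extended_solution \<Omega> f z"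
    proof eventually_elim
      case (elim z)
      then show ?case
        using extended_solution_eq[of "fst z" "snd z"] entry_point_frontier[of "fst z" "snd z"] c
        by (auto simp: case_prod_beta)
    qed
    moreover have "smooth_part c (x, \<xi>) = extended_solution \<Omega> f (x, \<xi>)"
      using extended_solution_eq[OF r] entry_point_frontier[OF r] c[of "P x \<xi>"] U by simp
    moreover have "(smooth_part c \<longlongrightarrow> smooth_part c (x, \<xi>)) (at (x, \<xi>) within rays)"
      using continuous_smooth_part r by (auto simp: continuous_on_def)
    ultimately have "continuous (at (x, \<xi>) within rays) (extended_solution \<Omega> f)"
      unfolding continuous_within using Lim_transform_eventually by fastforce
    then show False using nc by blast
  qed
  show "frontier \<Omega> \<inter> U \<inter> A' \<noteq> {}"
  proof
    assume "frontier \<Omega> \<inter> U \<inter> A' = {}"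
    then show False by (intro const[of 0]) (auto simp: indicator_def)
  qed
  show "frontier \<Omega> \<inter> U - A' \<noteq> {}"
  proof
    assume "frontier \<Omega> \<inter> U - A' = {}"
    then show False by (intro const[of I]) auto
  qed
qed

text \<open>Points of \<open>C\<close> near the entry point are transported along
  \<open>\<xi>\<close> by one fixed length \<open>\<rho>\<close>. They arrive near \<open>x\<close>,
  and by \<open>exit_timeI\<close> each has the point of \<open>C\<close> it started from as its
  entry point.\<close>

lemma islimpt_entering:
  assumes r: "(x, \<xi>) \<in> rays" and C: "C \<subseteq> frontier \<Omega>" "P x \<xi> \<in> closure C"
  shows "x islimpt {y. (y, \<xi>) \<in> phase_domain \<Omega> \<and> P y \<xi> \<in> C}"
proof (rule islimptI)
  fix T assume T: "x \<in> T" "open T"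
  have \<xi>: "norm \<xi> = 1" using raysD[OF r] by blast
  \<comment> \<open>The target is a point of \<open>\<Omega>\<close> near \<open>x\<close> but
    different from it. If \<open>x\<close> is on the boundary, transported points aimed at
    \<open>x\<close> itself could fall outside \<open>\<Omega>\<close>.\<close>
  obtain s where s: "s \<noteq> 0" "x + s *\<^sub>R \<xi> \<in> \<Omega>" "x + s *\<^sub>R \<xi> \<in> T"
  proof -
    obtain c where c: "c \<noteq> 0" "x + c *\<^sub>R \<xi> \<in> \<Omega>"
    proof (cases "x \<in> \<Omega>")
      case True
      then obtain e where e: "e > 0" "ball x e \<subseteq> \<Omega>" using open_dom by (meson openE)
      have "x + (e / 2) *\<^sub>R \<xi> \<in> \<Omega>" using e \<xi> by (intro subsetD[OF e(2)]) (simp add: dist_norm)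
      then show ?thesis using e by (intro that[of "e / 2"]) auto
    next
      case False
      obtain c where c: "x + c *\<^sub>R \<xi> \<in> \<Omega>" using raysD(3)[OF r] by blast
      then have "c \<noteq> 0" using False by auto
      then show ?thesis using c by (rule that)
    qed
    have "((\<lambda>u. x + (u * c) *\<^sub>R \<xi>) \<longlongrightarrow> x + (0 * c) *\<^sub>R \<xi>) (at_right 0)" by (intro tendsto_intros)
    then have "\<forall>\<^sub>F u in at_right 0. x + (u * c) *\<^sub>R \<xi> \<in> T"
      using T by (intro topological_tendstoD) auto
    moreover have "\<forall>\<^sub>F u in at_right 0. (0::real) < u \<and> u < 1" by (auto simp: eventually_at_right_field intro!: exI[of _ 1])
    ultimately have "\<forall>\<^sub>F u in at_right 0. x + (u * c) *\<^sub>R \<xi> \<in> T \<and> 0 < u \<and> u < 1"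
      by (rule eventually_conj)
    from eventually_happens'[OF trivial_limit_at_right_real this]
    obtain u where u: "x + (u * c) *\<^sub>R \<xi> \<in> T" "0 < u" "u < 1" by auto
    have "u *\<^sub>R (x + c *\<^sub>R \<xi>) + (1 - u) *\<^sub>R x \<in> \<Omega>"
      by (rule closure_segment) (use c u raysD[OF r] in auto)
    also have "u *\<^sub>R (x + c *\<^sub>R \<xi>) + (1 - u) *\<^sub>R x = x + (u * c) *\<^sub>R \<xi>" by (simp add: algebra_simps)
    finally show ?thesis using u c by (intro that[of "u * c"]) auto
  qed
  define \<rho> where "\<rho> = \<tau> x \<xi> + s"
  have \<rho>: "0 < \<rho>" using entry_point_translate(3)[OF r s(2)] by (simp add: \<rho>_def)
  define V where "V = (\<lambda>y. y + \<rho> *\<^sub>R \<xi>) -` (\<Omega> \<inter> T - {x})"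
  have V: "open V"
    unfolding V_def using open_dom T by (intro open_vimage continuous_intros open_Diff open_Int) auto
  have "P x \<xi> + \<rho> *\<^sub>R \<xi> = x + s *\<^sub>R \<xi>" by (simp add: entry_point_def \<rho>_def algebra_simps)
  moreover have "x + s *\<^sub>R \<xi> \<noteq> x" using s \<xi> by auto
  ultimately have "P x \<xi> \<in> V" using s by (simp add: V_def)
  then have "V \<inter> C \<noteq> {}" using C(2) open_Int_closure_eq_empty[OF V, of C] by auto
  then obtain q where q: "q \<in> C" "q \<in> V" by auto
  let ?y = "q + \<rho> *\<^sub>R \<xi>"
  have y: "?y \<in> \<Omega>" "?y \<in> T" "?y \<noteq> x" using q by (auto simp: V_def)
  have "\<tau> ?y \<xi> = \<rho>"
    by (rule exit_timeI[OF interior_rays[OF y(1) \<xi>] \<rho>]) (use q C in auto)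
  then have "P ?y \<xi> = q" by (simp add: entry_point_def)
  then show "\<exists>y\<in>{y. (y, \<xi>) \<in> phase_domain \<Omega> \<and> P y \<xi> \<in> C}. y \<in> T \<and> y \<noteq> x"
    using y q(1) interior_phase[OF y(1) \<xi>] by (intro bexI[of _ ?y]) auto
qed

text \<open>On each side the solution equals one \<open>smooth_part\<close>, whose limit at
  \<open>x\<close> is its value there. Both one-sided limits contain the same scattered part, so
  only the attenuation times \<open>I\<close> is left.\<close>

theorem jump:
  assumes d: "(x, \<xi>) \<in> disc rays (extended_solution \<Omega> f)"
    and C: "A' \<union> B = frontier \<Omega>" "A' \<inter> B = {}"
  shows "has_jump \<Omega> A' B f x \<xi> (I * exp (- integral {0..\<tau> x \<xi>} (\<lambda>r. \<mu>\<^sub>t (x - r *\<^sub>R \<xi>))))"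
proof -
  have r: "(x, \<xi>) \<in> rays" using d by (auto simp: disc_def)
  define S where "S C = {y. (y, \<xi>) \<in> phase_domain \<Omega> \<and> P y \<xi> \<in> C}" for C
  \<comment> \<open>If the entry point missed one of the closures, the complement of that closure
    would be a neighbourhood excluded by \<open>disc_entry_point\<close>.\<close>
  have cl: "P x \<xi> \<in> closure A'" "P x \<xi> \<in> closure B"
    using disc_entry_point(1)[OF d, of "- closure A'"] disc_entry_point(2)[OF d, of "- closure B"]
      closure_subset[of A'] closure_subset[of B] C by auto
  have lim: "x islimpt S A'" "x islimpt S B"
    unfolding S_def using C cl by (auto intro!: islimpt_entering[OF r])
  have tends: "((\<lambda>y. f (y, \<xi>)) \<longlongrightarrow> smooth_part c (x, \<xi>)) (at x within S D)"
    if c: "\<And>y. y \<in> D \<Longrightarrow> I * indicator A' y = c" for c D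
  proof (rule Lim_transform_eventually)
    show "((\<lambda>y. smooth_part c (y, \<xi>)) \<longlongrightarrow> smooth_part c (x, \<xi>)) (at x within S D)"
    proof (rule continuous_on_tendsto_compose[OF continuous_smooth_part _ r])
      show "((\<lambda>y. (y, \<xi>)) \<longlongrightarrow> (x, \<xi>)) (at x within S D)" by (intro tendsto_intros)
      show "\<forall>\<^sub>F y in at x within S D. (y, \<xi>) \<in> rays"
        using phase_rays by (auto simp: eventually_at_filter S_def)
    qed
    show "\<forall>\<^sub>F y in at x within S D. smooth_part c (y, \<xi>) = f (y, \<xi>)"
      using solution_eq c by (auto simp: eventually_at_filter S_def)
  qed
  have "((\<lambda>y. f (y, \<xi>)) \<longlongrightarrow> smooth_part I (x, \<xi>)) (at x within S A')"
    "((\<lambda>y. f (y, \<xi>)) \<longlongrightarrow> smooth_part 0 (x, \<xi>)) (at x within S B)"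
    by (rule tends; use C in \<open>auto simp: indicator_def\<close>)+
  moreover have "I * exp (- integral {0..\<tau> x \<xi>} (\<lambda>r. \<mu>\<^sub>t (x - r *\<^sub>R \<xi>))) = smooth_part I (x, \<xi>) - smooth_part 0 (x, \<xi>)"
    using depth_beyond[OF r exit_time_le_R[OF r]] by (simp add: smooth_part_def attenuation_def depth_def)
  ultimately show ?thesis
    using lim unfolding has_jump_def Let_def S_def by (intro conjI exI)
qed

end

section \<open>Topology of the two boundary parts\<close>

lemma clopen_component:
  assumes "components S = {A, B}" "A \<noteq> B"
  shows "openin (top_of_set S) A" "closedin (top_of_set S) A"
    "A \<noteq> {}" "B \<noteq> {}" "A \<union> B = S" "A \<inter> B = {}"
proof -
  have cl: "closedin (top_of_set S) A" "closedin (top_of_set S) B"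
    using assms by (simp_all add: closedin_component)
  show u: "A \<union> B = S" using Union_components[of S] assms by auto
  show d: "A \<inter> B = {}" using components_nonoverlap[of A S B] assms by simp
  show "A \<noteq> {}" "B \<noteq> {}" using assms in_components_nonempty[of _ S] by auto
  show "closedin (top_of_set S) A" by (rule cl)
  \<comment> \<open>With just two components, each is the complement of the other, so closedness of
    \<open>B\<close> makes \<open>A\<close> open.\<close>
  have "A = S - B" using u d by blast
  then show "openin (top_of_set S) A" using cl(2) by (metis openin_diff openin_subtopology_self)
qed

lemma separating_set_closed:
  assumes "separating_set \<Omega> \<gamma>"
  shows "closed \<gamma>"
  using assms
proof (unfold separating_set_def, elim conjE disjE exE)
  assume "card \<gamma> = 2"
  \<comment> \<open>An infinite set has \<open>card\<close> 0, so \<open>card \<gamma> = 2\<close>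
    contains finiteness.\<close>
  then show ?thesis using card.infinite[of \<gamma>] by (intro finite_imp_closed) fastforce
next
  fix c assume "simple_path c" "path_image c = \<gamma>"
  then show ?thesis using closed_path_image simple_path_imp_path by blast
qed

theorem theorem3:
  fixes \<Omega> \<Omega>\<^sub>0 \<gamma> A B :: "'a::euclidean_space set"
    and N :: nat and W :: "nat \<Rightarrow> 'a set"
    and l :: "'a \<Rightarrow> 'a \<Rightarrow> nat" and t :: "'a \<Rightarrow> 'a \<Rightarrow> nat \<Rightarrow> real"
    and \<mu>\<^sub>t \<mu>\<^sub>s :: "'a \<Rightarrow> real" and p :: "'a \<Rightarrow> 'a \<Rightarrow> 'a \<Rightarrow> real"
    and I :: real and f\<^sub>0 f :: "'a \<times> 'a \<Rightarrow> real"
    and x' \<xi>' :: 'a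
  assumes "DIM('a) = 2 \<or> DIM('a) = 3"
    and "open \<Omega>" "\<Omega> \<noteq> {}" "bounded \<Omega>" "convex \<Omega>" "C1_boundary \<Omega>"
    and "subdomain_decomposition \<Omega> N W" "\<Omega>\<^sub>0 = (\<Union>j\<in>{1..N}. W j)"
    and "generalized_convexity \<Omega> \<Omega>\<^sub>0 l t"
    and "admissible_coefficients \<Omega>\<^sub>0 \<mu>\<^sub>t \<mu>\<^sub>s p"
    and "separating_set \<Omega> \<gamma>" "components (frontier \<Omega> - \<gamma>) = {A, B}" "A \<noteq> B"
    and "\<And>x \<xi>. (x, \<xi>) \<in> ((A \<union> \<gamma>) \<times> sphere 0 1) \<inter> inflow_boundary \<Omega> \<Longrightarrow> f\<^sub>0 (x, \<xi>) = I"
    and "\<And>x \<xi>. (x, \<xi>) \<in> (B \<times> sphere 0 1) \<inter> inflow_boundary \<Omega> \<Longrightarrow> f\<^sub>0 (x, \<xi>) = 0"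
    and "transport_solution \<Omega> \<Omega>\<^sub>0 l t \<mu>\<^sub>t \<mu>\<^sub>s p f\<^sub>0 f"
    and "(x', \<xi>') \<in> disc (extended_phase_domain \<Omega>) (extended_solution \<Omega> f)"
  shows "has_jump \<Omega> (A \<union> \<gamma>) B f x' \<xi>'
           (I * exp (- integral {0..backward_exit_time \<Omega> x' \<xi>'} (\<lambda>r. \<mu>\<^sub>t (x' - r *\<^sub>R \<xi>'))))"
proof -
  interpret convex_domain \<Omega>
    using assms(2,4,5) by unfold_locales
  have sub: "open (W j)" "W j \<subseteq> \<Omega>" if "j \<in> {1..N}" for j
    using assms(7) that by (auto simp: subdomain_decomposition_def)
  have \<gamma>: "closed \<gamma>" "\<gamma> \<subseteq> frontier \<Omega>"
    using separating_set_closed assms(11) by (auto simp: separating_set_def)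
  note AB = clopen_component[OF assms(12,13)]
  have BA: "components (frontier \<Omega> - \<gamma>) = {B, A}" "B \<noteq> A" using assms(12,13) by auto
  have part: "A \<union> \<gamma> \<union> B = frontier \<Omega>" "(A \<union> \<gamma>) \<inter> B = {}" using AB(5,6) \<gamma>(2) by auto
  \<comment> \<open>\<open>A \<union> \<gamma>\<close> is the frontier without \<open>B\<close>, and
    \<open>B\<close> is relatively open: first in the frontier without \<open>\<gamma>\<close>, then
    in the frontier because \<open>\<gamma>\<close> is closed.\<close>
  have "closed (A \<union> \<gamma>)"
  proof -
    have "openin (top_of_set (frontier \<Omega>)) (frontier \<Omega> - \<gamma>)"
      using \<gamma> by (intro openin_diff) (auto simp: closedin_closed_eq closed_subset)
    then have "openin (top_of_set (frontier \<Omega>)) B"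
      using clopen_component(1)[OF BA] openin_trans by blast
    then have "closedin (top_of_set (frontier \<Omega>)) (frontier \<Omega> - B)" by (intro closedin_diff) auto
    moreover have "frontier \<Omega> - B = A \<union> \<gamma>" using part by blast
    ultimately show ?thesis by (simp add: closedin_closed_eq)
  qed
  have transport: "transport \<Omega> \<Omega>\<^sub>0 (A \<union> \<gamma>) l t \<mu>\<^sub>t \<mu>\<^sub>s p I f\<^sub>0 f"
  proof unfold_locales
    show "C1_boundary \<Omega>" "generalized_convexity \<Omega> \<Omega>\<^sub>0 l t" "admissible_coefficients \<Omega>\<^sub>0 \<mu>\<^sub>t \<mu>\<^sub>s p"
      "transport_solution \<Omega> \<Omega>\<^sub>0 l t \<mu>\<^sub>t \<mu>\<^sub>s p f\<^sub>0 f" "closed (A \<union> \<gamma>)"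
      by fact+
    show "open \<Omega>\<^sub>0" using sub(1) by (auto simp: assms(8))
    show "\<Omega>\<^sub>0 \<subseteq> \<Omega>" unfolding assms(8) by (rule UN_least[OF sub(2)])
    show "closure \<Omega>\<^sub>0 = closure \<Omega>"
    proof -
      have "closure (\<Union>j\<in>J. W j) = (\<Union>j\<in>J. closure (W j))" if "finite J" for J
        using that by (induction rule: finite_induct) auto
      then show ?thesis using assms(7) by (simp add: subdomain_decomposition_def assms(8))
    qed
    fix x \<xi> assume z: "(x, \<xi>) \<in> inflow_boundary \<Omega>"
    then have "x \<in> A \<union> \<gamma> \<union> B" "\<xi> \<in> sphere 0 1"
      using part by (auto simp: inflow_boundary_def)
    then show "f\<^sub>0 (x, \<xi>) = I * indicator (A \<union> \<gamma>) x"
      using assms(14)[of x \<xi>] assms(15)[of x \<xi>] z part(2) by (auto simp: indicator_def)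
  qed
  show ?thesis
    by (rule transport.jump[OF transport])
       (use assms(17) part extended_phase_domain_eq[OF assms(6)] in auto)
qed

end
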